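(* Let $d,m,k$ be positive integers with $m\geq 2$ and $k\geq d$, let $0<\varepsilon\leq 1$, and set $$C=C(d,m,k,\varepsilon):=\exp^{(2d)}\Big(\frac{2^{8}\, m^{7k^d}}{\varepsilon^2}\Big),$$ where $\exp^{(\ell)}$ denotes the $\ell$-th iterated exponential. Let $n\geq C$ be an integer, let $\mathcal{X}$ be a set with $|\mathcal{X}|=m$, and let $\boldsymbol{X}=\langle X_s:s\in \binom{[n]}{d}\rangle$ be an $\mathcal{X}$-valued, $(1/C)$-spreadable, $d$-dimensional random array on $[n]$. Then there exists a Borel measurable function $f\colon [0,1]^{d+1}\to \mathcal{X}$ with the following property. Let $\boldsymbol{X}_f=\langle X^f_s:s\in \binom{\mathbb{N}}{d}\rangle$ be the $\mathcal{X}$-valued, spreadable, $d$-dimensional random array on $\mathbb{N}$ defined by setting, for every $s=\{ i_1<\cdots<i_d\}\in \binom{\mathbb{N}}{d}$, $$X^f_s= f(\zeta,\xi_{i_1},\dots, \xi_{i_d}),$$ where $(\zeta,\xi_1,\xi_2,\dots)$ are i.i.d. random variables uniformly distributed on $[0,1]$. Then, for every subset $L$ of $[n]$ with $|L|=k$, denoting by $P_L$ and $Q_L$ the laws of the subarrays of $\boldsymbol{X}$ and $\boldsymbol{X}_f$ determined by $L$ respectively, we have $\rho_{\mathrm{TV}}(P_L,Q_L)\leq \varepsilon$.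
   Context: Notation: $\mathbb{N}=\{1,2,\dots\}$, $[n]=\{1,\dots,n\}$, and $\binom{I}{d}$ is the set of all $d$-element subsets of $I$. $\rho_{\mathrm{TV}}$ is the total variation distance. $\exp^{(1)}(x)=\exp(x)$, $\exp^{(2)}(x)=\exp(\exp(x))$, etc. A $d$-dimensional random array on a set $I$ with $|I|\geq d$ is a stochastic process $\boldsymbol{X}=\langle X_s:s\in\binom{I}{d}\rangle$ indexed by $\binom{I}{d}$; it is $\mathcal{X}$-valued if all $X_s$ take values in $\mathcal{X}$. If $J\subseteq I$ with $|J|\geq d$, the subarray determined by $J$ is $\boldsymbol{X}_J=\langle X_s:s\in\binom{J}{d}\rangle$. For $I\subseteq\mathbb{N}$ and $\eta\geq 0$, $\boldsymbol{X}$ is $\eta$-spreadable if for all finite $J,K\subseteq I$ with $|J|=|K|\geq d$ the laws $P_J,P_K$ of $\boldsymbol{X}_J,\boldsymbol{X}_K$ (compared by identifying $J$ and $K$ via the unique increasing bijection) satisfy $\rho_{\mathrm{TV}}(P_J,P_K)\leq\eta$; it is spreadable if it is $0$-spreadable, that is, if these laws always coincide. *)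

theory Defs
  imports "HOL-Probability.Probability" "HOL-Library.Ramsey"
begin

text \<open>The set of all \<open>d\<close>-element subsets of \<open>I\<close> is \<^term>\<open>nsets I d\<close>, written
  \<open>[I]\<^bsup>d\<^esup>\<close>. Finite value sets \<open>S\<close> carry the discrete sigma-algebra.\<close>

definition random_array ::
  "'w measure \<Rightarrow> 'x set \<Rightarrow> nat \<Rightarrow> nat set \<Rightarrow> (nat set \<Rightarrow> 'w \<Rightarrow> 'x) \<Rightarrow> bool" where
  "random_array M S d I X \<longleftrightarrow>
     prob_space M \<and> (infinite I \<or> d \<le> card I) \<and>
     (\<forall>s\<in>[I]\<^bsup>d\<^esup>. X s \<in> measurable M (count_space S))"

definition subarray_law ::
  "'w measure \<Rightarrow> 'x set \<Rightarrow> nat \<Rightarrow> (nat set \<Rightarrow> 'w \<Rightarrow> 'x) \<Rightarrow> nat set \<Rightarrow> (nat set \<Rightarrow> 'x) measure" where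
  "subarray_law M S d X J =
     distr M (Pi\<^sub>M ([J]\<^bsup>d\<^esup>) (\<lambda>_. count_space S)) (\<lambda>w. \<lambda>s\<in>[J]\<^bsup>d\<^esup>. X s w)"

text \<open>Meant for two probability measures with the same measurable sets.\<close>

definition tv_dist :: "'a measure \<Rightarrow> 'a measure \<Rightarrow> real" where
  "tv_dist P Q = (SUP A\<in>sets P. \<bar>measure P A - measure Q A\<bar>)"

text \<open>On \<open>J\<close> there is exactly one increasing bijection \<open>\<phi>\<close> onto \<open>K\<close>; the law of the subarray on
  \<open>K\<close> is transported to \<open>J\<close> by reading off \<open>X (\<phi> ` s)\<close> at the index \<open>s\<close>.\<close>

definition approx_spreadable ::
  "real \<Rightarrow> 'w measure \<Rightarrow> 'x set \<Rightarrow> nat \<Rightarrow> nat set \<Rightarrow> (nat set \<Rightarrow> 'w \<Rightarrow> 'x) \<Rightarrow> bool" where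
  "approx_spreadable \<eta> M S d I X \<longleftrightarrow>
     (\<forall>J K \<phi>. finite J \<and> finite K \<and> J \<subseteq> I \<and> K \<subseteq> I \<and> card J = card K \<and> d \<le> card J \<and>
        strict_mono_on J \<phi> \<and> bij_betw \<phi> J K \<longrightarrow>
        tv_dist (subarray_law M S d X J) (subarray_law M S d (\<lambda>s. X (\<phi> ` s)) J) \<le> \<eta>)"

abbreviation spreadable ::
  "'w measure \<Rightarrow> 'x set \<Rightarrow> nat \<Rightarrow> nat set \<Rightarrow> (nat set \<Rightarrow> 'w \<Rightarrow> 'x) \<Rightarrow> bool" where
  "spreadable \<equiv> approx_spreadable 0"

definition unif01 :: "real measure" where
  "unif01 = restrict_space lborel {0..1}"

text \<open>A sample space for \<open>(\<zeta>, \<xi>\<^sub>1, \<xi>\<^sub>2, \<dots>)\<close>: coordinate \<open>0\<close> is \<open>\<zeta>\<close>, and coordinate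
  \<open>i \<ge> 1\<close> is \<open>\<xi>\<^sub>i\<close>.\<close>

definition iid_space :: "(nat \<Rightarrow> real) measure" where
  "iid_space = Pi\<^sub>M UNIV (\<lambda>_. unif01)"

lemma prob_space_unif01: "prob_space unif01"
  unfolding unif01_def by (rule prob_space_restrict_space) auto

lemma prob_space_iid_space: "prob_space iid_space"
  unfolding iid_space_def by (rule prob_space_PiM) (rule prob_space_unif01)

lemma iid_space_uniform: "distr iid_space unif01 (\<lambda>u. u i) = unif01"
  unfolding iid_space_def by (rule distr_PiM_component) (auto intro: prob_space_unif01)

lemma iid_space_indep: "prob_space.indep_vars iid_space (\<lambda>_. unif01) (\<lambda>i u. u i) UNIV"
proof -
  interpret prob_space iid_space by (rule prob_space_iid_space)
  have "distr iid_space (Pi\<^sub>M UNIV (\<lambda>_. unif01)) (\<lambda>u. \<lambda>i\<in>UNIV. u i) = iid_space"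
    by (simp add: iid_space_def restrict_UNIV)
  moreover have "(\<lambda>u. u i) \<in> measurable iid_space unif01" for i
    unfolding iid_space_def by measurable
  ultimately show ?thesis
    by (subst indep_vars_iff_distr_eq_PiM) (simp_all add: iid_space_uniform, simp add: iid_space_def)
qed

text \<open>Points of \<open>[0,1]\<^sup>d\<^sup>+\<^sup>1\<close> are extensional functions on \<open>{..d}\<close>; as the product is finite, its
  product sigma-algebra is the Borel one.\<close>

definition borel_cube :: "nat \<Rightarrow> (nat \<Rightarrow> real) measure" where
  "borel_cube d = Pi\<^sub>M {..d} (\<lambda>_. restrict_space borel {0..1})"

definition fn_array :: "nat \<Rightarrow> ((nat \<Rightarrow> real) \<Rightarrow> 'x) \<Rightarrow> nat set \<Rightarrow> (nat \<Rightarrow> real) \<Rightarrow> 'x" where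
  "fn_array d f s u =
     f (\<lambda>j\<in>{..d}. if j = 0 then u 0 else u (sorted_list_of_set s ! (j - 1)))"

definition spread_const :: "nat \<Rightarrow> nat \<Rightarrow> nat \<Rightarrow> real \<Rightarrow> real" where
  "spread_const d m k \<epsilon> = (exp ^^ (2 * d)) (2 ^ 8 * real m ^ (7 * k ^ d) / \<epsilon>\<^sup>2)"

end

theory Submission
  imports Defs
begin

text \<open>
  Suppose that \<open>f\<close> is constant on the cells of a grid with \<open>N\<close> intervals in each \<open>\<xi>\<close>-coordinate,
  and that \<open>\<zeta>\<close> only serves to choose this step function at random. Then \<open>f\<close> is a random function
  \<open>Y\<close> on the \<open>d\<close>-tuples over \<open>{..<N}\<close>, and on \<open>k\<close> points the array of \<open>f\<close> reads off \<open>Y\<close> on the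
  subsequences of length \<open>d\<close> of a random list \<open>\<sigma>\<close> of \<open>k\<close> cells. As \<open>\<sigma>\<close> is distinct up to probability
  \<open>k\<^sup>2 / N\<close>, it suffices to find, for every \<open>N\<close>, a random \<open>Y\<close> such that for each distinct \<open>\<sigma>\<close>
  the values of \<open>Y\<close> on the subsequences of \<open>\<sigma>\<close> have nearly the law of the given array on \<open>k\<close>
  points (\<open>extension_to_tuples\<close>). The difficulty is that \<open>\<sigma>\<close> comes in arbitrary order, whereas the
  given array only knows increasing tuples.

  The extension is built by induction on \<open>d\<close>. Cut the vertices into blocks of length \<open>b\<close>. Block \<open>0\<close>
  consists of auxiliary vertices; every later block starts with a distinguished vertex and goes on
  with auxiliary ones. The type of a set of \<open>d - 1\<close> later blocks is the pattern of the array on the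
  union of these blocks and block \<open>0\<close>. The types form a \<open>(d - 1)\<close>-dimensional array, and it is as
  spreadable as the original one, because each type is read off in the same way. The core of the
  proof is that, given the types, the entries at the distinguished vertices are nearly
  independent, and that each has nearly a law that depends only on the types of its \<open>d\<close> facets
  (\<open>resample_all\<close>). So a random function on \<open>d\<close>-tuples is obtained by extending the types to
  \<open>(d - 1)\<close>-tuples and drawing, independently for each \<open>d\<close>-tuple, a value from the law that belongs
  to the types of its facets. In dimension \<open>0\<close> there is no order to forget.

  Near independence comes from an increment argument. The quality of the best prediction of an
  entry from the types of its facets is a bounded quantity. Hence, among the block lengths
  \<open>(k + 1) ^ j\<close>, there is one for which passing to the next length gains almost nothing
  (\<open>stable_block_length\<close>). For this length, no information helps to predict the entry if
  it becomes part of the types once the blocks are enlarged. To enlarge them, each vertex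
  is put into the block of the last vertex of the entry that precedes it, or into block \<open>0\<close> (\<open>absorb\<close>).
  This turns every type, and every other entry that does not dominate the given one elementwise, into
  information of this kind (\<open>count_below_covers_imp_sum_less\<close>). Therefore the entries can be
  replaced by independent draws one at a time in the order of decreasing sum: when an entry is
  treated, those that dominate it have been replaced already (\<open>resample_entry\<close>).

  Each dimension costs two exponentials, one for the block length \<open>(k + 1) ^ J\<close> with \<open>J\<close> of the order
  \<open>m * k ^ (2 * d) / \<epsilon>\<^sup>2\<close>, the other for the number of types (\<open>induction_bound\<close>). This gives the
  tower of height \<open>2 * d\<close>.
\<close>

section \<open>Total variation distance of mass functions\<close>

lemma integrable_bounded_pmf:
  fixes F :: "'a \<Rightarrow> real"
  assumes "\<And>x. \<bar>F x\<bar> \<le> B"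
  shows "integrable (measure_pmf p) F"
  by (rule measure_pmf.integrable_const_bound[where B = B]) (auto simp: assms)

lemma expectation_bind_pmf:
  fixes F :: "'b \<Rightarrow> real"
  assumes "\<And>y. \<bar>F y\<bar> \<le> B"
  shows "measure_pmf.expectation (bind_pmf p K) F =
    measure_pmf.expectation p (\<lambda>x. measure_pmf.expectation (K x) F)"
  unfolding measure_pmf_bind
  by (rule integral_bind[where K = "count_space UNIV" and B = B and B' = 1])
    (use assms measurable_measure_pmf[of K] in
      \<open>auto intro: measure_pmf.finite_measure simp: measure_pmf.emeasure_space_1\<close>)

lemma abs_expectation_le:
  fixes F :: "'a \<Rightarrow> real"
  assumes "\<And>x. \<bar>F x\<bar> \<le> B"
  shows "\<bar>measure_pmf.expectation p F\<bar> \<le> B"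
proof -
  have "\<bar>measure_pmf.expectation p F\<bar> \<le> measure_pmf.expectation p (\<lambda>x. \<bar>F x\<bar>)"
    by (rule integral_abs_bound)
  also have "\<dots> \<le> measure_pmf.expectation p (\<lambda>x. B)"
    by (rule integral_mono) (use assms in \<open>auto intro!: integrable_bounded_pmf[where B = B]\<close>)
  finally show ?thesis by simp
qed

lemma expectation_eq_sum:
  fixes F :: "'a \<Rightarrow> real"
  assumes "finite A" "set_pmf p \<subseteq> A"
  shows "measure_pmf.expectation p F = (\<Sum>a\<in>A. pmf p a * F a)"
  by (subst integral_measure_pmf[OF assms(1)]) (use assms(2) in auto)

text \<open>Test functions with values in \<open>[0,1]\<close> give the same distance as events, and with them the bound is
  visibly inherited by the images under a common kernel.\<close>

definition tv_within :: "real \<Rightarrow> 'a pmf \<Rightarrow> 'a pmf \<Rightarrow> bool" where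
  "tv_within e p q \<longleftrightarrow> (\<forall>F. (\<forall>x. 0 \<le> F x \<and> F x \<le> 1) \<longrightarrow>
     measure_pmf.expectation p F \<le> measure_pmf.expectation q F + e)"

lemma tv_withinD:
  assumes "tv_within e p q" "\<And>x. 0 \<le> F x" "\<And>x. F x \<le> 1"
  shows "measure_pmf.expectation p F \<le> measure_pmf.expectation q F + e"
  using assms by (auto simp: tv_within_def)

lemma tv_within_prob:
  assumes "tv_within e p q"
  shows "measure_pmf.prob p A \<le> measure_pmf.prob q A + e"
  using tv_withinD[OF assms, of "indicator A"] by (simp add: indicator_def)

lemma tv_within_refl: "tv_within 0 p p"
  by (simp add: tv_within_def)

lemma tv_within_mono: "tv_within e p q \<Longrightarrow> e \<le> e' \<Longrightarrow> tv_within e' p q"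
  unfolding tv_within_def by (meson add_left_mono order_trans)

lemma tv_within_trans:
  assumes "tv_within e p q" "tv_within e' q r"
  shows "tv_within (e + e') p r"
  unfolding tv_within_def
proof (intro allI impI)
  fix F :: "'a \<Rightarrow> real" assume F: "\<forall>x. 0 \<le> F x \<and> F x \<le> 1"
  show "measure_pmf.expectation p F \<le> measure_pmf.expectation r F + (e + e')"
    using tv_withinD[OF assms(1), of F] tv_withinD[OF assms(2), of F] F by simp
qed

lemma tv_within_sym:
  assumes "tv_within e p q"
  shows "tv_within e q p"
  unfolding tv_within_def
proof (intro allI impI)
  fix F :: "'a \<Rightarrow> real" assume F: "\<forall>x. 0 \<le> F x \<and> F x \<le> 1"
  have i: "integrable (measure_pmf r) F" for r
    using F by (intro integrable_bounded_pmf[where B = 1]) auto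
  have "measure_pmf.expectation p (\<lambda>x. 1 - F x) \<le> measure_pmf.expectation q (\<lambda>x. 1 - F x) + e"
    using F by (intro tv_withinD[OF assms]) auto
  then show "measure_pmf.expectation q F \<le> measure_pmf.expectation p F + e"
    using i by simp
qed

lemma tv_within_map:
  assumes "tv_within e p q"
  shows "tv_within e (map_pmf f p) (map_pmf f q)"
  using assms by (auto simp: tv_within_def)

lemma tv_within_bind:
  assumes "tv_within e p q"
  shows "tv_within e (bind_pmf p K) (bind_pmf q K)"
  unfolding tv_within_def
proof (intro allI impI)
  fix F :: "'b \<Rightarrow> real" assume F: "\<forall>x. 0 \<le> F x \<and> F x \<le> 1"
  have b: "\<bar>F y\<bar> \<le> 1" for y using F by auto
  have K: "0 \<le> measure_pmf.expectation (K x) F" "measure_pmf.expectation (K x) F \<le> 1" for x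
    using abs_expectation_le[of F 1 "K x", OF b] F by (auto intro: integral_nonneg)
  show "measure_pmf.expectation (bind_pmf p K) F \<le> measure_pmf.expectation (bind_pmf q K) F + e"
    unfolding expectation_bind_pmf[of F 1, OF b] by (rule tv_withinD[OF assms]) (use K in auto)
qed

text \<open>The best test function is the indicator of the event on which \<open>p\<close> outweighs \<open>q\<close>.\<close>

lemma tv_withinI_events:
  assumes fin: "finite (set_pmf p)" "finite (set_pmf q)"
    and le: "\<And>A. measure_pmf.prob p A \<le> measure_pmf.prob q A + e"
  shows "tv_within e p q"
  unfolding tv_within_def
proof (intro allI impI)
  fix F :: "'a \<Rightarrow> real" assume F: "\<forall>x. 0 \<le> F x \<and> F x \<le> 1"
  define U where "U = set_pmf p \<union> set_pmf q"
  define A where "A = {x \<in> U. pmf q x \<le> pmf p x}"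
  have U: "finite U" "set_pmf p \<subseteq> U" "set_pmf q \<subseteq> U" using fin by (auto simp: U_def)
  have "measure_pmf.expectation p F - measure_pmf.expectation q F
      = (\<Sum>x\<in>U. (pmf p x - pmf q x) * F x)"
    by (simp add: expectation_eq_sum[OF U(1,2)] expectation_eq_sum[OF U(1,3)]
        sum_subtractf left_diff_distrib)
  also have "\<dots> \<le> (\<Sum>x\<in>U. if x \<in> A then pmf p x - pmf q x else 0)"
  proof (rule sum_mono)
    fix x assume "x \<in> U"
    show "(pmf p x - pmf q x) * F x \<le> (if x \<in> A then pmf p x - pmf q x else 0)"
      using F[rule_format, of x] \<open>x \<in> U\<close>
      by (auto simp: A_def mult_left_le mult_nonpos_nonneg)
  qed
  also have "\<dots> = (\<Sum>x\<in>A. pmf p x - pmf q x)"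
    using U(1) by (subst sum.inter_restrict[symmetric]) (auto simp: A_def intro: sum.cong)
  also have "\<dots> = measure_pmf.prob p A - measure_pmf.prob q A"
    using U(1) by (simp add: A_def measure_measure_pmf_finite sum_subtractf)
  finally show "measure_pmf.expectation p F \<le> measure_pmf.expectation q F + e"
    using le[of A] by simp
qed

section \<open>Prediction and the Brier score\<close>

text \<open>The conditional laws are wanted for every \<open>z\<close>, not only for those of positive probability, and all of
  them inside \<open>A\<close>: they are applied later to values that come from another distribution.\<close>

lemma pmf_disintegration:
  fixes r :: "('a \<times> 'z) pmf"
  assumes "fst ` set_pmf r \<subseteq> A" "A \<noteq> {}"
  obtains c where "\<And>z. set_pmf (c z) \<subseteq> A"
    and "r = bind_pmf (map_pmf snd r) (\<lambda>z. map_pmf (\<lambda>a. (a, z)) (c z))"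
proof -
  obtain a0 where a0: "a0 \<in> A" using assms(2) by blast
  define c where "c z = (if z \<in> snd ` set_pmf r then map_pmf fst (cond_pmf r {y. snd y = z})
    else return_pmf a0)" for z
  have ne: "set_pmf r \<inter> {y. snd y = z} \<noteq> {}" if "z \<in> snd ` set_pmf r" for z
    using that by auto
  have "set_pmf (c z) \<subseteq> A" for z
    using a0 assms(1) by (auto simp: c_def set_cond_pmf[OF ne] split: if_splits)
  moreover have "bind_pmf (map_pmf snd r) (\<lambda>z. map_pmf (\<lambda>a. (a, z)) (c z))
      = bind_pmf (map_pmf snd r) (\<lambda>z. cond_pmf r {y. snd y = z})"
  proof (rule bind_pmf_cong[OF refl])
    fix z assume "z \<in> set_pmf (map_pmf snd r)"
    then have z: "z \<in> snd ` set_pmf r" by simp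
    have "map_pmf (\<lambda>y. (fst y, z)) (cond_pmf r {y. snd y = z}) =
        map_pmf (\<lambda>y. y) (cond_pmf r {y. snd y = z})"
      by (rule map_pmf_cong[OF refl]) (auto simp: set_cond_pmf[OF ne[OF z]])
    then show "map_pmf (\<lambda>a. (a, z)) (c z) = cond_pmf r {y. snd y = z}"
      using z by (simp add: c_def pmf.map_comp o_def)
  qed
  moreover have "bind_pmf (map_pmf snd r) (\<lambda>z. cond_pmf r {y. snd y = z}) = r"
  proof (rule bind_cond_pmf_cancel)
    fix z y assume "z \<in> set_pmf (map_pmf snd r)" "y \<in> set_pmf r" "snd y = z"
    then show "measure_pmf.prob r {y. snd y = z} =
        measure_pmf.prob (map_pmf snd r) {x. snd y = x}"
      by (auto simp: vimage_def intro: arg_cong[where f = "measure_pmf.prob r"])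
  qed auto
  ultimately show ?thesis using that[of c] by simp
qed

text \<open>The quadratic loss of the forecast \<open>h\<close> when \<open>a\<close> occurs, without its constant term: the squared distance
  between \<open>h\<close> and the point mass at \<open>a\<close> is \<open>1 + brier A h a\<close>.\<close>

definition brier :: "'a set \<Rightarrow> 'a pmf \<Rightarrow> 'a \<Rightarrow> real" where
  "brier A h a = (\<Sum>b\<in>A. (pmf h b)\<^sup>2) - 2 * pmf h a"

lemma sum_pmf_sq_bounds:
  assumes "finite A"
  shows "0 \<le> (\<Sum>b\<in>A. (pmf h b)\<^sup>2)" "(\<Sum>b\<in>A. (pmf h b)\<^sup>2) \<le> 1"
proof -
  have "(\<Sum>b\<in>A. (pmf h b)\<^sup>2) \<le> (\<Sum>b\<in>A. pmf h b)"
    by (rule sum_mono) (simp add: power2_eq_square mult_left_le pmf_le_1)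
  also have "\<dots> = measure_pmf.prob h A" using assms by (simp add: measure_measure_pmf_finite)
  finally show "(\<Sum>b\<in>A. (pmf h b)\<^sup>2) \<le> 1"
    using measure_pmf.prob_le_1[of h A] by linarith
qed (auto intro: sum_nonneg)

lemma brier_bounds:
  assumes "finite A" "a \<in> A"
  shows "\<bar>brier A h a\<bar> \<le> 1"
proof -
  have "(pmf h a)\<^sup>2 \<le> (\<Sum>b\<in>A. (pmf h b)\<^sup>2)"
    using assms by (intro member_le_sum) auto
  moreover have "0 \<le> (1 - pmf h a)\<^sup>2" by simp
  ultimately have "- 1 \<le> brier A h a" by (simp add: brier_def power2_diff)
  then show ?thesis
    using sum_pmf_sq_bounds(2)[OF assms(1), of h] pmf_nonneg[of h a]
    unfolding brier_def by linarith
qed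

text \<open>The loss is proper: its mean is smallest when the forecast is the true law \<open>c\<close>, and the excess is a
  squared distance. This makes it possible to turn a statement about losses into one about laws.\<close>

lemma expectation_brier:
  assumes "finite A" "set_pmf c \<subseteq> A"
  shows "measure_pmf.expectation c (brier A h) =
    (\<Sum>a\<in>A. (pmf c a - pmf h a)\<^sup>2) - (\<Sum>a\<in>A. (pmf c a)\<^sup>2)"
proof -
  have "(\<Sum>a\<in>A. pmf c a) = 1" using assms by (rule sum_pmf_eq_1)
  then show ?thesis
    unfolding expectation_eq_sum[OF assms] brier_def
    by (simp add: right_diff_distrib sum_subtractf power2_diff sum.distrib
        flip: sum_distrib_right) (simp add: sum_distrib_left mult_ac)
qed


lemma abs_brier_le:
  assumes "finite A"
  shows "\<bar>brier A h a\<bar> \<le> 3"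
  using sum_pmf_sq_bounds[OF assms, of h] pmf_nonneg[of h a] pmf_le_1[of h a]
  unfolding brier_def by linarith

text \<open>The best forecast of \<open>X\<close> from \<open>g\<close> is the conditional law, by \<open>expectation_brier\<close> applied pointwise.\<close>

lemma best_predictor:
  fixes p :: "'w pmf" and X :: "'w \<Rightarrow> 'a" and g :: "'w \<Rightarrow> 'z"
  assumes A: "finite A" "A \<noteq> {}" and X: "\<And>x. x \<in> set_pmf p \<Longrightarrow> X x \<in> A"
  obtains c where "\<And>z. set_pmf (c z) \<subseteq> A"
    and "map_pmf (\<lambda>x. (X x, g x)) p = bind_pmf (map_pmf g p) (\<lambda>z. map_pmf (\<lambda>a. (a, z)) (c z))"
    and "\<And>h. measure_pmf.expectation p (\<lambda>x. brier A (h (g x)) (X x)) =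
      measure_pmf.expectation p (\<lambda>x. brier A (c (g x)) (X x)) +
      measure_pmf.expectation (map_pmf g p) (\<lambda>z. \<Sum>a\<in>A. (pmf (c z) a - pmf (h z) a)\<^sup>2)"
proof -
  let ?r = "map_pmf (\<lambda>x. (X x, g x)) p"
  obtain c where c: "\<And>z. set_pmf (c z) \<subseteq> A"
    and r: "?r = bind_pmf (map_pmf snd ?r) (\<lambda>z. map_pmf (\<lambda>a. (a, z)) (c z))"
    proof (rule pmf_disintegration)
    show "fst ` set_pmf ?r \<subseteq> A" using X by auto
  qed (use A(2) in auto)
  have r': "?r = bind_pmf (map_pmf g p) (\<lambda>z. map_pmf (\<lambda>a. (a, z)) (c z))"
    using r by (simp add: pmf.map_comp o_def)
  define Q where "Q z = (\<Sum>a\<in>A. (pmf (c z) a)\<^sup>2)" for z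
  define D where "D h z = (\<Sum>a\<in>A. (pmf (c z) a - pmf (h z) a)\<^sup>2)" for h :: "'z \<Rightarrow> 'a pmf" and z
  have D_bound: "\<bar>D h z\<bar> \<le> real (card A)" for h z
  proof -
    have "D h z \<le> (\<Sum>a\<in>A. 1)"
      unfolding D_def
    proof (rule sum_mono)
      fix a
      have "\<bar>pmf (c z) a - pmf (h z) a\<bar> \<le> 1"
        using pmf_nonneg[of "c z" a] pmf_nonneg[of "h z" a] pmf_le_1[of "c z" a] pmf_le_1[of "h z" a]
        by linarith
      then show "(pmf (c z) a - pmf (h z) a)\<^sup>2 \<le> 1" by (simp add: abs_square_le_1)
    qed
    moreover have "0 \<le> D h z" unfolding D_def by (auto intro: sum_nonneg)
    ultimately show ?thesis by simp
  qed
  have Q_bound: "\<bar>Q z\<bar> \<le> 1" for z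
    using sum_pmf_sq_bounds[OF A(1), of "c z"] by (simp add: Q_def)
  have score: "measure_pmf.expectation p (\<lambda>x. brier A (h (g x)) (X x)) =
      measure_pmf.expectation (map_pmf g p) (D h) - measure_pmf.expectation (map_pmf g p) Q" for h
  proof -
    have "measure_pmf.expectation p (\<lambda>x. brier A (h (g x)) (X x)) =
        measure_pmf.expectation ?r (\<lambda>(a, z). brier A (h z) a)"
      by simp
    also have "\<dots> = measure_pmf.expectation (map_pmf g p)
        (\<lambda>z. measure_pmf.expectation (map_pmf (\<lambda>a. (a, z)) (c z)) (\<lambda>(a, z). brier A (h z) a))"
      unfolding r' by (rule expectation_bind_pmf[where B = 3]) (auto intro: abs_brier_le[OF A(1)])
    also have "\<dots> = measure_pmf.expectation (map_pmf g p) (\<lambda>z. D h z - Q z)"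
    proof (rule Bochner_Integration.integral_cong[OF refl])
      fix z
      show "measure_pmf.expectation (map_pmf (\<lambda>a. (a, z)) (c z)) (\<lambda>(a, z). brier A (h z) a)
        = D h z - Q z"
        using expectation_brier[OF A(1) c, of z "h z"] by (simp add: D_def Q_def)
    qed
    also have "\<dots> = measure_pmf.expectation (map_pmf g p) (D h) - measure_pmf.expectation (map_pmf g p) Q"
      by (rule Bochner_Integration.integral_diff)
        (rule integrable_bounded_pmf, rule D_bound, rule integrable_bounded_pmf, rule Q_bound)
    finally show ?thesis .
  qed
  have "D c = (\<lambda>z. 0)" by (auto simp: D_def)
  then have "measure_pmf.expectation p (\<lambda>x. brier A (h (g x)) (X x)) =
      measure_pmf.expectation p (\<lambda>x. brier A (c (g x)) (X x)) +
      measure_pmf.expectation (map_pmf g p) (D h)" for h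
    unfolding score by simp
  then show ?thesis using that[OF c r'] unfolding D_def by blast
qed

text \<open>The loss of \<open>h\<close> exceeds the least possible loss by the mean squared distance between \<open>h\<close> and the
  conditional law. Cauchy--Schwarz over the \<open>card A\<close> values turns this into a distance in total variation;
  it is used in the form \<open>\<bar>t\<bar> \<le> m / (2 * \<tau>) * t\<^sup>2 + \<tau> / (2 * m)\<close>.\<close>

lemma tv_within_near_optimal_predictor:
  fixes p :: "'w pmf" and X :: "'w \<Rightarrow> 'a" and g :: "'w \<Rightarrow> 'z" and h :: "'z \<Rightarrow> 'a pmf"
  assumes A: "finite A" "A \<noteq> {}" and X: "\<And>x. x \<in> set_pmf p \<Longrightarrow> X x \<in> A"
    and h: "\<And>z. set_pmf (h z) \<subseteq> A"
    and low: "\<And>c. (\<And>z. set_pmf (c z) \<subseteq> A) \<Longrightarrow> V \<le> measure_pmf.expectation p (\<lambda>x. brier A (c (g x)) (X x))"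
    and near: "measure_pmf.expectation p (\<lambda>x. brier A (h (g x)) (X x)) \<le> V + \<delta>"
    and \<tau>: "0 < \<tau>" "\<delta> * real (card A) \<le> \<tau>\<^sup>2"
  shows "tv_within \<tau> (map_pmf (\<lambda>x. (X x, g x)) p)
    (bind_pmf (map_pmf g p) (\<lambda>z. map_pmf (\<lambda>a. (a, z)) (h z)))"
proof -
  obtain c where c: "\<And>z. set_pmf (c z) \<subseteq> A"
    and r: "map_pmf (\<lambda>x. (X x, g x)) p = bind_pmf (map_pmf g p) (\<lambda>z. map_pmf (\<lambda>a. (a, z)) (c z))"
    and pyth: "\<And>h. measure_pmf.expectation p (\<lambda>x. brier A (h (g x)) (X x)) =
      measure_pmf.expectation p (\<lambda>x. brier A (c (g x)) (X x)) +
      measure_pmf.expectation (map_pmf g p) (\<lambda>z. \<Sum>a\<in>A. (pmf (c z) a - pmf (h z) a)\<^sup>2)"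
    by (rule best_predictor[OF A X, where p = p and g = g]) auto
  define m where "m = real (card A)"
  have m: "1 \<le> m" using A by (simp add: m_def Suc_leI card_gt_0_iff)
  define D where "D z = (\<Sum>a\<in>A. (pmf (c z) a - pmf (h z) a)\<^sup>2)" for z
  have D: "measure_pmf.expectation (map_pmf g p) D \<le> \<delta>"
    using pyth[of h] near low[of c, OF c] unfolding D_def by linarith
  have sq: "\<bar>pmf (c z) a - pmf (h z) a\<bar> \<le> 1" for z a
    using pmf_nonneg[of "c z" a] pmf_nonneg[of "h z" a] pmf_le_1[of "c z" a] pmf_le_1[of "h z" a]
    by linarith
  have D_bound: "\<bar>D z\<bar> \<le> m" for z
  proof -
    have "D z \<le> (\<Sum>a\<in>A. 1)"
      unfolding D_def by (rule sum_mono) (simp add: abs_square_le_1 sq)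
    moreover have "0 \<le> D z" unfolding D_def by (auto intro: sum_nonneg)
    ultimately show ?thesis by (simp add: m_def)
  qed
  show ?thesis
    unfolding r tv_within_def
  proof (intro allI impI)
    fix F :: "'a \<times> 'z \<Rightarrow> real" assume F: "\<forall>x. 0 \<le> F x \<and> F x \<le> 1"
    define G where "G k z = measure_pmf.expectation (k z) (\<lambda>a. F (a, z))" for k :: "'z \<Rightarrow> 'a pmf" and z
    have bd: "\<bar>F y\<bar> \<le> 1" for y using F[rule_format, of y] by linarith
    have Gb: "\<bar>G k z\<bar> \<le> 1" for k z unfolding G_def by (rule abs_expectation_le) (rule bd)
    have expand: "measure_pmf.expectation (bind_pmf (map_pmf g p) (\<lambda>z. map_pmf (\<lambda>a. (a, z)) (k z))) F
        = measure_pmf.expectation (map_pmf g p) (G k)" for k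
      by (subst expectation_bind_pmf[of F 1, OF bd]) (simp add: G_def)
    have "G c z \<le> G h z + (m / (2 * \<tau>) * D z + \<tau> / 2)" for z
    proof -
      have "G c z - G h z = (\<Sum>a\<in>A. (pmf (c z) a - pmf (h z) a) * F (a, z))"
        unfolding G_def expectation_eq_sum[OF A(1) c] expectation_eq_sum[OF A(1) h]
        by (simp add: left_diff_distrib sum_subtractf)
      also have "\<dots> \<le> (\<Sum>a\<in>A. m / (2 * \<tau>) * (pmf (c z) a - pmf (h z) a)\<^sup>2 + \<tau> / (2 * m))"
      proof (rule sum_mono)
        fix a
        define t where "t = \<bar>pmf (c z) a - pmf (h z) a\<bar>"
        have "(pmf (c z) a - pmf (h z) a) * F (a, z) \<le> \<bar>(pmf (c z) a - pmf (h z) a) * F (a, z)\<bar>"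
          by simp
        also have "\<dots> \<le> t"
          unfolding t_def abs_mult using bd[of "(a, z)"] by (simp add: mult_left_le)
        also have "t \<le> m / (2 * \<tau>) * t\<^sup>2 + \<tau> / (2 * m)"
        proof -
          have "0 \<le> (m * t - \<tau>)\<^sup>2 / (2 * m * \<tau>)" using m \<tau> by simp
          also have "\<dots> = m / (2 * \<tau>) * t\<^sup>2 + \<tau> / (2 * m) - t"
            using m \<tau> by (simp add: power2_eq_square field_simps)
          finally show ?thesis by simp
        qed
        finally show "(pmf (c z) a - pmf (h z) a) * F (a, z) \<le>
            m / (2 * \<tau>) * (pmf (c z) a - pmf (h z) a)\<^sup>2 + \<tau> / (2 * m)"
          by (simp add: t_def)
      qed
      also have "\<dots> = m / (2 * \<tau>) * D z + \<tau> / 2"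
        using m unfolding D_def sum.distrib sum_distrib_left[symmetric] by (simp add: m_def)
      finally show ?thesis by simp
    qed
    then have "measure_pmf.expectation (map_pmf g p) (G c) \<le>
        measure_pmf.expectation (map_pmf g p) (\<lambda>z. G h z + (m / (2 * \<tau>) * D z + \<tau> / 2))"
      by (intro integral_mono integrable_bounded_pmf[OF Gb] Bochner_Integration.integrable_add
          integrable_mult_right integrable_bounded_pmf[OF D_bound]) auto
    also have "\<dots> = measure_pmf.expectation (map_pmf g p) (G h) +
        (m / (2 * \<tau>) * measure_pmf.expectation (map_pmf g p) D + \<tau> / 2)"
      using integrable_bounded_pmf[of "G h" 1 "map_pmf g p", OF Gb]
        integrable_bounded_pmf[of D m "map_pmf g p", OF D_bound]
      by (subst Bochner_Integration.integral_add) auto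
    also have "m / (2 * \<tau>) * measure_pmf.expectation (map_pmf g p) D \<le> m / (2 * \<tau>) * \<delta>"
      using D m \<tau> by (intro mult_left_mono) auto
    also have "m / (2 * \<tau>) * \<delta> \<le> \<tau> / 2"
      using \<tau> by (simp add: m_def field_simps power2_eq_square)
    finally show "measure_pmf.expectation (bind_pmf (map_pmf g p) (\<lambda>z. map_pmf (\<lambda>a. (a, z)) (c z))) F
        \<le> measure_pmf.expectation (bind_pmf (map_pmf g p) (\<lambda>z. map_pmf (\<lambda>a. (a, z)) (h z))) F + \<tau>"
      unfolding expand by simp
  qed
qed

section \<open>Blocks of vertices\<close>

definition nth_least :: "nat set \<Rightarrow> nat \<Rightarrow> nat" where
  "nth_least s a = sorted_list_of_set s ! a"

definition count_below :: "nat set \<Rightarrow> nat \<Rightarrow> nat" where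
  "count_below s j = card {i \<in> s. i < j}"

lemma nth_least_in: "finite s \<Longrightarrow> a < card s \<Longrightarrow> nth_least s a \<in> s"
  unfolding nth_least_def by (metis length_sorted_list_of_set nth_mem set_sorted_list_of_set)

lemma nth_least_less: "finite s \<Longrightarrow> a < a' \<Longrightarrow> a' < card s \<Longrightarrow> nth_least s a < nth_least s a'"
  unfolding nth_least_def
  by (rule sorted_wrt_nth_less[of "(<)"]) (auto simp: strict_sorted_list_of_set)

lemma strict_mono_on_nth_least: "finite s \<Longrightarrow> strict_mono_on {..<card s} (nth_least s)"
  by (auto intro!: strict_mono_onI nth_least_less)

lemma nth_least_image: "finite s \<Longrightarrow> nth_least s ` {..<card s} = s"
  unfolding nth_least_def
  by (metis atLeast_upt length_sorted_list_of_set list.set_map map_nth set_sorted_list_of_set)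

lemma sorted_list_of_set_image:
  assumes "finite s" "strict_mono_on s \<phi>"
  shows "sorted_list_of_set (\<phi> ` s) = map \<phi> (sorted_list_of_set s)"
proof -
  have "sorted_wrt (<) (map \<phi> (sorted_list_of_set s))"
    unfolding sorted_wrt_map
    by (rule sorted_wrt_mono_rel[OF _ strict_sorted_list_of_set])
      (use assms in \<open>auto dest: strict_mono_onD\<close>)
  moreover have "card (\<phi> ` s) = card s"
    using assms(2) by (intro card_image strict_mono_on_imp_inj_on)
  ultimately show ?thesis
    using assms(1) by (subst sorted_list_of_set_unique[symmetric]) auto
qed

lemma nth_least_image_mono:
  assumes "finite s" "strict_mono_on s \<phi>" "a < card s"
  shows "nth_least (\<phi> ` s) a = \<phi> (nth_least s a)"
  using assms by (simp add: nth_least_def sorted_list_of_set_image)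

lemma count_below_le: "finite s \<Longrightarrow> count_below s j \<le> card s"
  unfolding count_below_def by (rule card_mono) auto

lemma count_below_mono: "finite s \<Longrightarrow> j \<le> j' \<Longrightarrow> count_below s j \<le> count_below s j'"
  unfolding count_below_def by (rule card_mono) auto

lemma nth_least_less_iff_count_below:
  assumes "finite s" "a < card s"
  shows "nth_least s a < j \<longleftrightarrow> a < count_below s j"
proof -
  define U where "U = {a. a < card s \<and> nth_least s a < j}"
  have "{i \<in> s. i < j} = nth_least s ` U"
    using nth_least_image[OF assms(1)] by (auto simp: U_def)
  moreover have inj: "inj_on (nth_least s) U"
    by (rule inj_on_subset[OF strict_mono_on_imp_inj_on[OF strict_mono_on_nth_least[OF assms(1)]]])
      (auto simp: U_def)
  ultimately have c: "count_below s j = card U"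
    by (simp add: count_below_def card_image)
  have fin: "finite U" by (auto simp: U_def)
  have down: "a' \<in> U" if "a'' \<in> U" "a' \<le> a''" for a' a''
    using that nth_least_less[OF assms(1), of a' a''] by (cases "a' = a''") (auto simp: U_def)
  show ?thesis
  proof
    assume "nth_least s a < j"
    then have "a \<in> U" using assms by (auto simp: U_def)
    then have "{..a} \<subseteq> U" using down by auto
    then have "card {..a} \<le> card U" using fin by (rule card_mono[rotated])
    then show "a < count_below s j" by (simp add: c)
  next
    assume "a < count_below s j"
    show "nth_least s a < j"
    proof (rule ccontr)
      assume "\<not> nth_least s a < j"
      then have "a \<notin> U" by (auto simp: U_def)
      then have "U \<subseteq> {..<a}" using down by (meson lessThan_iff linorder_not_le subsetI)
      then have "card U \<le> card {..<a}" by (rule card_mono[rotated]) auto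
      then show False using \<open>a < count_below s j\<close> by (simp add: c)
    qed
  qed
qed

lemma count_below_Suc_nth_least:
  assumes "finite s" "a < card s"
  shows "count_below s (Suc (nth_least s a)) = Suc a"
proof -
  have "a < count_below s (Suc (nth_least s a))"
    using nth_least_less_iff_count_below[OF assms] by auto
  moreover have "\<not> Suc a < count_below s (Suc (nth_least s a))"
  proof
    assume l: "Suc a < count_below s (Suc (nth_least s a))"
    then have "Suc a < card s" using count_below_le[OF assms(1)] by (meson less_le_trans)
    then show False
      using nth_least_less_iff_count_below[OF assms(1), of "Suc a" "Suc (nth_least s a)"] l
        nth_least_less[OF assms(1), of a "Suc a"] by auto
  qed
  ultimately show ?thesis by linarith
qed

text \<open>The distinguished vertex of block \<open>i + 1\<close>; blocks have length \<open>b\<close> and block \<open>0\<close> has none.\<close>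

definition vertex :: "nat \<Rightarrow> nat \<Rightarrow> nat" where
  "vertex b i = b * Suc i"

text \<open>Moves block \<open>i + 1\<close> rigidly onto block \<open>\<phi> i + 1\<close> and fixes block \<open>0\<close>.\<close>

definition lift :: "nat \<Rightarrow> (nat \<Rightarrow> nat) \<Rightarrow> nat \<Rightarrow> nat" where
  "lift b \<phi> q = (if q < b then q else vertex b (\<phi> (q div b - 1)) + q mod b)"

lemma vertex_div: "0 < b \<Longrightarrow> vertex b i div b = Suc i"
  by (simp add: vertex_def)

lemma vertex_add_div: "r < b \<Longrightarrow> (vertex b i + r) div b = Suc i"
  using div_mult_self2[of b r "Suc i"] by (simp add: vertex_def add.commute)

lemma vertex_add_mod: "r < b \<Longrightarrow> (vertex b i + r) mod b = r"
  unfolding vertex_def by (subst add.commute, subst mod_mult_self2) simp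

lemma lift_div:
  assumes "0 < b"
  shows "lift b \<phi> q div b = (if q < b then 0 else Suc (\<phi> (q div b - 1)))"
  using assms by (simp add: lift_def vertex_add_div)

lemma lift_vertex: "0 < b \<Longrightarrow> lift b \<phi> (vertex b i) = vertex b (\<phi> i)"
  by (simp add: lift_def vertex_def)

lemma lift_comp: "0 < b \<Longrightarrow> lift b \<phi> \<circ> lift b \<psi> = lift b (\<phi> \<circ> \<psi>)"
proof (rule ext)
  fix q assume b: "0 < b"
  have "\<not> vertex b i + r < b" for i r by (simp add: vertex_def)
  then show "(lift b \<phi> \<circ> lift b \<psi>) q = lift b (\<phi> \<circ> \<psi>) q"
    using b by (simp add: lift_def vertex_add_div vertex_add_mod)
qed

lemma lift_cong:
  assumes "q < Suc n * b" "0 < b" "\<And>i. i < n \<Longrightarrow> \<phi> i = \<psi> i"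
  shows "lift b \<phi> q = lift b \<psi> q"
proof (cases "q < b")
  case False
  have "q div b < Suc n" using assms(1,2) by (simp add: less_mult_imp_div_less)
  moreover have "0 < q div b" using False assms(2) by (simp add: div_greater_zero_iff)
  ultimately have "q div b - 1 < n" by linarith
  then show ?thesis by (simp add: lift_def assms(3))
qed (simp add: lift_def)

lemma lift_strict_mono:
  assumes "0 < b" "strict_mono_on J \<phi>"
  shows "strict_mono_on {q. q < b \<or> q div b - 1 \<in> J} (lift b \<phi>)"
proof (rule strict_mono_onI)
  fix q q' assume q: "q \<in> {q. q < b \<or> q div b - 1 \<in> J}" "q' \<in> {q. q < b \<or> q div b - 1 \<in> J}"
    and "q < q'"
  have div: "q div b \<le> q' div b" using \<open>q < q'\<close> by (simp add: div_le_mono)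
  show "lift b \<phi> q < lift b \<phi> q'"
  proof (cases "q div b = q' div b")
    case True
    then have "(q < b) = (q' < b)" using assms(1) by (metis div_eq_0_iff less_not_refl)
    moreover have "q mod b < q' mod b"
      using True \<open>q < q'\<close> by (metis div_mult_mod_eq nat_add_left_cancel_less)
    ultimately show ?thesis using True \<open>q < q'\<close> by (simp add: lift_def)
  next
    case False
    then have lt: "q div b < q' div b" using div by simp
    have "lift b \<phi> q div b < lift b \<phi> q' div b"
    proof (cases "q < b")
      case True
      have "\<not> q' < b" using lt True by auto
      then show ?thesis using True by (simp add: lift_div[OF assms(1)])
    next
      case nb: False
      then have "0 < q div b" using assms(1) by (simp add: div_greater_zero_iff)
      moreover have nb': "\<not> q' < b" using nb \<open>q < q'\<close> by simp
      ultimately have "q div b - 1 < q' div b - 1" using lt by linarith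
      then have "\<phi> (q div b - 1) < \<phi> (q' div b - 1)"
        using q nb nb' by (intro strict_mono_onD[OF assms(2)]) auto
      then show ?thesis using nb nb' by (simp add: lift_div[OF assms(1)])
    qed
    then show ?thesis by (metis div_le_mono linorder_not_le)
  qed
qed

lemma lift_bound:
  assumes "0 < b" "q < b \<or> \<phi> (q div b - 1) < n"
  shows "lift b \<phi> q < Suc n * b"
proof -
  have "lift b \<phi> q div b < Suc n" using assms by (auto simp: lift_div)
  then show ?thesis using assms(1) by (simp add: div_less_iff_less_mult)
qed

lemma blocks_lessThan:
  assumes "0 < b"
  shows "{q. q < b \<or> q div b - 1 \<in> {..<n}} = {..<Suc n * b}"
proof -
  have "(q < b \<or> q div b - 1 < n) \<longleftrightarrow> q div b < Suc n" for q
  proof (cases "q < b")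
    case False
    then have "0 < q div b" using assms by (simp add: div_greater_zero_iff)
    then show ?thesis using False by linarith
  qed simp
  then show ?thesis using assms by (auto simp: div_less_iff_less_mult)
qed

lemma lift_nth_least_strict_mono:
  assumes "0 < b" "finite t"
  shows "strict_mono_on {..<Suc (card t) * b} (lift b (nth_least t))"
  using lift_strict_mono[OF assms(1) strict_mono_on_nth_least[OF assms(2)]]
  unfolding blocks_lessThan[OF assms(1)] .

lemma lift_nth_least_bound:
  assumes "0 < b" "t \<subseteq> {..<n}" "q < Suc (card t) * b"
  shows "lift b (nth_least t) q < Suc n * b"
proof (rule lift_bound[OF assms(1)])
  have "finite t" using assms(2) finite_subset by blast
  have "q < b \<or> q div b - 1 \<in> {..<card t}"
    using assms(3) blocks_lessThan[OF assms(1), of "card t"] by blast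
  then show "q < b \<or> nth_least t (q div b - 1) < n"
    using nth_least_in[OF \<open>finite t\<close>] assms(2) by auto
qed

text \<open>Enlarges the blocks around the distinguished vertices of \<open>s\<close>: a vertex goes to the block of the last
  such vertex at or before it, at the same distance, and to block \<open>0\<close> if there is none.\<close>

definition absorb :: "nat \<Rightarrow> nat \<Rightarrow> nat set \<Rightarrow> nat \<Rightarrow> nat" where
  "absorb b b' s q = (let c = count_below s (q div b)
     in c * b' + (q - (if c = 0 then 0 else vertex b (nth_least s (c - 1)))))"

lemma absorb_base_le:
  assumes "finite s" "0 < b" "0 < count_below s (q div b)"
  shows "vertex b (nth_least s (count_below s (q div b) - 1)) \<le> q"
proof -
  have "nth_least s (count_below s (q div b) - 1) < q div b"
    using assms count_below_le[OF assms(1), of "q div b"] by (subst nth_least_less_iff_count_below) auto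
  then have "vertex b (nth_least s (count_below s (q div b) - 1)) \<le> b * (q div b)"
    unfolding vertex_def by (intro mult_left_mono) auto
  also have "\<dots> \<le> q" by simp
  finally show ?thesis .
qed

lemma absorb_div:
  assumes "q < b'"
  shows "absorb b b' s q div b' = count_below s (q div b)"
proof -
  define c where "c = count_below s (q div b)"
  define v where "v = q - (if c = 0 then 0 else vertex b (nth_least s (c - 1)))"
  have "v < b'" using assms by (auto simp: v_def)
  then have "(c * b' + v) div b' = c" by simp
  moreover have "absorb b b' s q = c * b' + v" unfolding absorb_def Let_def c_def v_def ..
  ultimately show ?thesis by (simp add: c_def)
qed

lemma absorb_bound:
  assumes "finite s" "q < b'"
  shows "absorb b b' s q < Suc (card s) * b'"
proof -
  have "absorb b b' s q div b' < Suc (card s)"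
    using absorb_div[OF assms(2)] count_below_le[OF assms(1)] by (simp add: le_imp_less_Suc)
  then show ?thesis using assms(2) by (simp add: div_less_iff_less_mult)
qed

lemma absorb_strict_mono:
  assumes "finite s" "0 < b"
  shows "strict_mono_on {..<b'} (absorb b b' s)"
proof (rule strict_mono_onI)
  fix q q' assume q: "q \<in> {..<b'}" "q' \<in> {..<b'}" "q < q'"
  have mono: "count_below s (q div b) \<le> count_below s (q' div b)"
    using q(3) by (intro count_below_mono assms div_le_mono) auto
  show "absorb b b' s q < absorb b b' s q'"
  proof (cases "count_below s (q div b) = count_below s (q' div b)")
    case True
    show ?thesis
    proof (cases "count_below s (q' div b) = 0")
      case False
      then have "vertex b (nth_least s (count_below s (q div b) - 1)) \<le> q"
        using True by (intro absorb_base_le assms) auto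
      then show ?thesis using True q(3) False by (simp add: absorb_def Let_def)
    qed (use True q(3) in \<open>simp add: absorb_def Let_def\<close>)
  next
    case False
    then have "absorb b b' s q div b' < absorb b b' s q' div b'"
      using mono q by (simp add: absorb_div)
    then show ?thesis by (metis div_le_mono linorder_not_le)
  qed
qed

lemma absorb_vertex:
  assumes "finite s" "0 < b" "a < card s"
  shows "absorb b b' s (vertex b (nth_least s a)) = vertex b' a"
  by (simp add: absorb_def vertex_div[OF assms(2)] count_below_Suc_nth_least[OF assms(1,3)])
    (simp add: vertex_def)

text \<open>If the elements of \<open>s'\<close> fall into all blocks of \<open>s\<close>, then there is one in each of them, so \<open>s'\<close>
  dominates \<open>s\<close> elementwise.\<close>

lemma count_below_covers_imp_sum_less:
  assumes "finite s" "finite s'" "card s' = card s" "s' \<noteq> s"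
    and cover: "{1..card s} \<subseteq> (\<lambda>j. count_below s (Suc j)) ` s'"
  shows "\<Sum>s < \<Sum>s'"
proof -
  define f where "f j = count_below s (Suc j)" for j
  define \<beta> where "\<beta> j = nth_least s (f j - 1)" for j
  have im: "f ` s' = {1..card s}"
  proof (rule card_subset_eq[symmetric])
    show "{1..card s} \<subseteq> f ` s'" using cover by (simp add: f_def)
    then show "card {1..card s} = card (f ` s')"
      using assms(2,3) card_image_le[OF assms(2), of f] card_mono[of "f ` s'" "{1..card s}"] by simp
  qed (use assms(2) in simp)
  have \<beta>_le: "\<beta> j \<le> j" if "j \<in> s'" for j
  proof -
    have "f j \<in> {1..card s}" using im that by blast
    then have "nth_least s (f j - 1) < Suc j"
      by (subst nth_least_less_iff_count_below[OF assms(1)]) (auto simp: f_def)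
    then show ?thesis by (simp add: \<beta>_def)
  qed
  have "\<beta> ` s' = (\<lambda>c. nth_least s (c - 1)) ` (f ` s')" by (simp add: image_image \<beta>_def)
  also have "\<dots> = nth_least s ` {..<card s}"
    unfolding im by (force simp: image_iff intro: bexI[of _ "Suc _"])
  also have "\<dots> = s" by (rule nth_least_image[OF assms(1)])
  finally have \<beta>_im: "\<beta> ` s' = s" .
  then have \<beta>_inj: "inj_on \<beta> s'"
    using assms(2,3) by (intro eq_card_imp_inj_on) auto
  have "\<exists>j\<in>s'. \<beta> j < j"
  proof (rule ccontr)
    assume "\<not> (\<exists>j\<in>s'. \<beta> j < j)"
    then have "\<forall>j\<in>s'. \<beta> j = j" using \<beta>_le le_neq_implies_less by blast
    then have "s' = s" using \<beta>_im by auto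
    then show False using assms(4) by simp
  qed
  then have "sum \<beta> s' < \<Sum>s'"
    using \<beta>_le assms(2) by (intro sum_strict_mono_ex1) auto
  moreover have "sum \<beta> s' = \<Sum>s"
    using sum.reindex[OF \<beta>_inj, of "\<lambda>x. x"] by (simp add: \<beta>_im o_def)
  ultimately show ?thesis by simp
qed

section \<open>Spreadable configurations and their types\<close>

text \<open>A realisation of an array with vertices \<open>{..<n}\<close>. The values are natural numbers, because the type of
  the values changes in the induction on the dimension.\<close>

type_synonym config = "nat set \<Rightarrow> nat"

definition pull :: "(nat \<Rightarrow> nat) \<Rightarrow> config \<Rightarrow> config" where
  "pull \<phi> x = (\<lambda>s. x (\<phi> ` s))"

lemma pull_comp: "pull \<phi> (pull \<psi> x) = pull (\<psi> \<circ> \<phi>) x"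
  by (simp add: pull_def image_comp o_def)

lemma pull_less: "(\<And>s. x s < m) \<Longrightarrow> pull \<phi> x s < m"
  by (simp add: pull_def)

definition spreadable_pmf :: "real \<Rightarrow> nat \<Rightarrow> nat \<Rightarrow> config pmf \<Rightarrow> bool" where
  "spreadable_pmf \<eta> n d p \<longleftrightarrow>
     (\<forall>J \<phi>. J \<subseteq> {..<n} \<and> strict_mono_on J \<phi> \<and> \<phi> ` J \<subseteq> {..<n} \<longrightarrow>
        tv_within \<eta> (map_pmf (\<lambda>x. restrict x ([J]\<^bsup>d\<^esup>)) p)
          (map_pmf (\<lambda>x. restrict (pull \<phi> x) ([J]\<^bsup>d\<^esup>)) p))"

text \<open>Spreadability compares the laws of two subarrays. Everything that is computed from the subarrays
  inherits the comparison, and this is the only form in which spreadability is used.\<close>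

lemma spreadable_pmf_transport:
  assumes spr: "spreadable_pmf \<eta> n d p"
    and J: "J \<subseteq> {..<n}" "strict_mono_on J \<phi>" "\<phi> ` J \<subseteq> {..<n}"
    and det: "\<And>x y. (\<And>s. s \<in> [J]\<^bsup>d\<^esup> \<Longrightarrow> x s = y s) \<Longrightarrow> g x = g y"
  shows "tv_within \<eta> (map_pmf g p) (map_pmf (\<lambda>x. g (pull \<phi> x)) p)"
proof -
  have g: "g (restrict x ([J]\<^bsup>d\<^esup>)) = g x" for x by (rule det) simp
  have "tv_within \<eta> (map_pmf (\<lambda>x. restrict x ([J]\<^bsup>d\<^esup>)) p)
      (map_pmf (\<lambda>x. restrict (pull \<phi> x) ([J]\<^bsup>d\<^esup>)) p)"
    using spr J by (auto simp: spreadable_pmf_def)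
  from tv_within_map[OF this, of g] show ?thesis
    by (simp add: pmf.map_comp o_def g)
qed

lemma image_in_nsets:
  fixes \<phi> :: "nat \<Rightarrow> nat"
  assumes "r \<in> [J]\<^bsup>d\<^esup>" "strict_mono_on J \<phi>" "\<phi> ` J \<subseteq> K"
  shows "\<phi> ` r \<in> [K]\<^bsup>d\<^esup>"
proof -
  have "inj_on \<phi> r"
    by (rule inj_on_subset[OF strict_mono_on_imp_inj_on[OF assms(2)]])
      (use assms(1) in \<open>simp add: nsets_def\<close>)
  then show ?thesis using assms by (auto simp: nsets_def card_image)
qed

lemma strict_mono_on_compose:
  assumes "strict_mono_on A f" "strict_mono_on B g" "f ` A \<subseteq> B"
  shows "strict_mono_on A (g \<circ> f)"
  using assms unfolding strict_mono_on_def by (simp add: image_subset_iff)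

text \<open>For \<open>t\<close> with \<open>e\<close> elements, \<open>{..<Suc e * b}\<close> is mapped onto block \<open>0\<close> and the blocks of \<open>t\<close>. So the
  pattern is read off in the same way for every \<open>t\<close>.\<close>

definition block_type :: "(config \<Rightarrow> nat) \<Rightarrow> nat \<Rightarrow> nat \<Rightarrow> nat set \<Rightarrow> config \<Rightarrow> nat" where
  "block_type enc b e t x =
     enc (restrict (pull (lift b (nth_least t)) x) ([{..<Suc e * b}]\<^bsup>Suc e\<^esup>))"

text \<open>Moving \<open>t\<close> by \<open>\<phi>\<close> has the same effect on the type as moving the blocks. This is why types are as
  spreadable as the configuration.\<close>

lemma block_type_pull:
  assumes "0 < b" "finite t" "card t = e" "strict_mono_on t \<phi>"
  shows "block_type enc b e (\<phi> ` t) x = block_type enc b e t (pull (lift b \<phi>) x)"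
proof -
  have "lift b (nth_least (\<phi> ` t)) ` r = (lift b \<phi> \<circ> lift b (nth_least t)) ` r"
    if "r \<in> [{..<Suc e * b}]\<^bsup>Suc e\<^esup>" for r
  proof (rule image_cong[OF refl])
    fix q assume "q \<in> r"
    then have "q < Suc e * b" using that by (auto simp: nsets_def)
    then show "lift b (nth_least (\<phi> ` t)) q = (lift b \<phi> \<circ> lift b (nth_least t)) q"
      unfolding lift_comp[OF assms(1)]
      by (rule lift_cong) (use assms nth_least_image_mono[OF assms(2,4)] in auto)
  qed
  then have "restrict (pull (lift b (nth_least (\<phi> ` t))) x) ([{..<Suc e * b}]\<^bsup>Suc e\<^esup>) =
      restrict (pull (lift b (nth_least t)) (pull (lift b \<phi>) x)) ([{..<Suc e * b}]\<^bsup>Suc e\<^esup>)"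
    unfolding pull_comp by (intro restrict_ext) (simp add: pull_def)
  then show ?thesis unfolding block_type_def by simp
qed

lemma block_type_cong:
  assumes "0 < b" "finite t" "card t = e"
    and "\<And>r. r \<in> [lift b (nth_least t) ` {..<Suc e * b}]\<^bsup>Suc e\<^esup> \<Longrightarrow> x r = y r"
  shows "block_type enc b e t x = block_type enc b e t y"
proof -
  have "restrict (pull (lift b (nth_least t)) x) ([{..<Suc e * b}]\<^bsup>Suc e\<^esup>) =
      restrict (pull (lift b (nth_least t)) y) ([{..<Suc e * b}]\<^bsup>Suc e\<^esup>)"
  proof (rule restrict_ext)
    fix r assume "r \<in> [{..<Suc e * b}]\<^bsup>Suc e\<^esup>"
    then have "lift b (nth_least t) ` r \<in> [lift b (nth_least t) ` {..<Suc e * b}]\<^bsup>Suc e\<^esup>"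
      using lift_nth_least_strict_mono[OF assms(1,2)] assms(3) by (intro image_in_nsets) auto
    then show "pull (lift b (nth_least t)) x r = pull (lift b (nth_least t)) y r"
      by (simp add: pull_def assms(4))
  qed
  then show ?thesis by (simp add: block_type_def)
qed

text \<open>The index sets that miss one of the blocks \<open>1, \<dots>, Suc e\<close>. They are those covered by the types
  of the facets of \<open>{..<Suc e}\<close>.\<close>

definition nontransversal :: "nat \<Rightarrow> nat \<Rightarrow> nat set set" where
  "nontransversal e b =
     {r \<in> [{..<Suc (Suc e) * b}]\<^bsup>Suc e\<^esup>. \<not> {1..Suc e} \<subseteq> (\<lambda>q. q div b) ` r}"

definition past :: "nat \<Rightarrow> nat \<Rightarrow> config \<Rightarrow> config" where
  "past e b x = restrict x (nontransversal e b)"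

definition top_entry :: "nat \<Rightarrow> nat \<Rightarrow> config \<Rightarrow> nat" where
  "top_entry e b x = x (vertex b ` {..<Suc e})"

text \<open>The loss when the entry at the distinguished vertices of the first \<open>Suc e\<close> blocks is forecast by \<open>h\<close>
  from the entries that the types of its facets determine.\<close>

definition score :: "config pmf \<Rightarrow> nat \<Rightarrow> nat \<Rightarrow> nat \<Rightarrow> (config \<Rightarrow> nat pmf) \<Rightarrow> real" where
  "score p m e b h = measure_pmf.expectation p (\<lambda>x. brier {..<m} (h (past e b x)) (top_entry e b x))"

lemma brier_bounds_supported:
  assumes "finite A" "set_pmf h \<subseteq> A"
  shows "\<bar>brier A h a\<bar> \<le> 1"
proof (cases "a \<in> A")
  case False
  then have "pmf h a = 0" using assms(2) by (meson set_pmf_iff subsetD)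
  then show ?thesis using sum_pmf_sq_bounds[OF assms(1), of h] by (simp add: brier_def)
qed (rule brier_bounds[OF assms(1)])

text \<open>The optimal losses for the block lengths \<open>K ^ j\<close> lie in \<open>[-1,1]\<close>, so they cannot drop by more than
  \<open>2 / N\<close> in each of \<open>N\<close> successive steps.\<close>

lemma stable_block_length:
  assumes m: "0 < m" and val: "\<And>x s. x \<in> set_pmf p \<Longrightarrow> x s < m" and N: "0 < (N :: nat)"
  obtains j c where "j < N" "\<And>z. set_pmf (c z) \<subseteq> {..<m}"
    "\<And>h. score p m e (K ^ j) c \<le> score p m e (K ^ Suc j) h + 2 / real N"
proof -
  have "\<exists>c. (\<forall>z. set_pmf (c z) \<subseteq> {..<m}) \<and> (\<forall>h. score p m e b c \<le> score p m e b h)" for b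
  proof (rule best_predictor[of "{..<m}" p "top_entry e b" "past e b"])
    show "finite {..<m}" "{..<m} \<noteq> {}" using m by auto
    show "top_entry e b x \<in> {..<m}" if "x \<in> set_pmf p" for x
      using val[OF that] by (simp add: top_entry_def)
    fix c :: "config \<Rightarrow> nat pmf"
    assume c: "\<And>z. set_pmf (c z) \<subseteq> {..<m}"
      and pyth: "\<And>h. measure_pmf.expectation p (\<lambda>x. brier {..<m} (h (past e b x)) (top_entry e b x)) =
        measure_pmf.expectation p (\<lambda>x. brier {..<m} (c (past e b x)) (top_entry e b x)) +
        measure_pmf.expectation (map_pmf (past e b) p)
          (\<lambda>z. \<Sum>a<m. (pmf (c z) a - pmf (h z) a)\<^sup>2)"
    have "score p m e b c \<le> score p m e b h" for h
    proof -
      have "0 \<le> measure_pmf.expectation (map_pmf (past e b) p)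
          (\<lambda>z. \<Sum>a<m. (pmf (c z) a - pmf (h z) a)\<^sup>2)"
        by (rule Bochner_Integration.integral_nonneg) (rule sum_nonneg, rule zero_le_power2)
      then show ?thesis unfolding score_def pyth[of h] by linarith
    qed
    then show ?thesis using c by blast
  qed
  then have "\<exists>c. \<forall>b. (\<forall>z. set_pmf (c b z) \<subseteq> {..<m}) \<and> (\<forall>h. score p m e b (c b) \<le> score p m e b h)"
    by (rule choice[OF allI])
  then obtain c where c: "\<And>b z. set_pmf (c b z) \<subseteq> {..<m}"
    and opt: "\<And>b h. score p m e b (c b) \<le> score p m e b h"
    by blast
  define V where "V j = score p m e (K ^ j) (c (K ^ j))" for j
  have V: "\<bar>V j\<bar> \<le> 1" for j
    unfolding V_def score_def by (intro abs_expectation_le brier_bounds_supported c) auto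
  have "\<exists>j<N. V j - V (Suc j) \<le> 2 / real N"
  proof (rule ccontr)
    assume "\<not> (\<exists>j<N. V j - V (Suc j) \<le> 2 / real N)"
    then have "(\<Sum>j<N. 2 / real N) < (\<Sum>j<N. V j - V (Suc j))"
      using N by (intro sum_strict_mono) auto
    also have "\<dots> = V 0 - V N" by (rule sum_lessThan_telescope')
    finally show False using V[of 0] V[of N] N by simp
  qed
  then obtain j where j: "j < N" "V j - V (Suc j) \<le> 2 / real N" by blast
  have "score p m e (K ^ j) (c (K ^ j)) \<le> score p m e (K ^ Suc j) h + 2 / real N" for h
    using j(2) opt[of "K ^ Suc j" h] unfolding V_def by linarith
  then show ?thesis using that[OF j(1), of "c (K ^ j)"] c by blast
qed

text \<open>By spreadability the configuration may be moved by \<open>absorb b b' s\<close>. Then the entry is the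
  distinguished one for the larger block length \<open>b'\<close>, and \<open>G\<close> becomes a function of the past for
  \<open>b'\<close>. By the stability of the loss, \<open>G\<close> predicts the entry hardly better than \<open>c\<close> does from
  the types of the facets of \<open>s\<close>. So the entry can be redrawn from \<open>c\<close> without changing much
  its joint law with \<open>G\<close>.\<close>

lemma resample_entry:
  fixes p :: "config pmf" and G :: "config \<Rightarrow> 'z" and H :: "'z \<Rightarrow> nat pmf"
  assumes m: "0 < m" and val: "\<And>x s. x \<in> set_pmf p \<Longrightarrow> x s < m"
    and spr: "spreadable_pmf \<eta> n (Suc e) p"
    and b: "0 < b" "b' = Suc k * b" "Suc (Suc e) * b' \<le> n"
    and s: "s \<in> [{..<k}]\<^bsup>Suc e\<^esup>"
    and c: "\<And>z. set_pmf (c z) \<subseteq> {..<m}"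
    and stable: "\<And>h. score p m e b c \<le> score p m e b' h + \<delta>"
    and G: "\<And>x y. (\<And>r. r \<in> [{..<b'}]\<^bsup>Suc e\<^esup> \<Longrightarrow>
        \<not> {1..Suc e} \<subseteq> (\<lambda>q. count_below s (q div b)) ` r \<Longrightarrow> x r = y r) \<Longrightarrow> G x = G y"
    and H: "\<And>z. set_pmf (H z) \<subseteq> {..<m}"
    and HG: "\<And>x. (\<And>r. x r < m) \<Longrightarrow> H (G x) = c (past e b (pull (lift b (nth_least s)) x))"
    and \<tau>: "0 < \<tau>" "(\<delta> + 2 * \<eta>) * real m \<le> \<tau>\<^sup>2"
  shows "tv_within (\<tau> + 2 * \<eta>) (map_pmf (\<lambda>x. (x (vertex b ` s), G x)) p)
    (bind_pmf (map_pmf G p) (\<lambda>z. map_pmf (\<lambda>a. (a, z)) (H z)))"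
proof -
  have fs: "finite s" and cs: "card s = Suc e" and sk: "s \<subseteq> {..<k}"
    using s by (auto simp: nsets_def)
  define \<psi> where "\<psi> = absorb b b' s"
  define \<theta> where "\<theta> = lift b (nth_least s)"
  have b'n: "b' \<le> n" using b(3) by simp
  have \<psi>_mono: "strict_mono_on {..<b'} \<psi>"
    unfolding \<psi>_def by (rule absorb_strict_mono[OF fs b(1)])
  have \<psi>_range: "\<psi> ` {..<b'} \<subseteq> {..<Suc (Suc e) * b'}"
    using absorb_bound[OF fs, of _ b' b] cs by (auto simp: \<psi>_def)
  have \<psi>_n: "\<psi> ` {..<b'} \<subseteq> {..<n}" using \<psi>_range b(3) by force
  have \<theta>_mono: "strict_mono_on {..<Suc (Suc e) * b} \<theta>"
    using lift_nth_least_strict_mono[OF b(1) fs] by (simp add: \<theta>_def cs)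
  have \<theta>_range: "\<theta> ` {..<Suc (Suc e) * b} \<subseteq> {..<b'}"
    using lift_nth_least_bound[OF b(1) sk] by (auto simp: \<theta>_def cs b(2))
  have vs: "vertex b ` s \<in> [{..<b'}]\<^bsup>Suc e\<^esup>"
  proof -
    have "inj_on (vertex b) s" using b(1) by (auto simp: inj_on_def vertex_def)
    moreover have "vertex b i < b'" if "i \<in> s" for i
    proof -
      have "b * Suc i < b * Suc k" using that sk b(1) by auto
      then show ?thesis by (simp add: vertex_def b(2) mult.commute)
    qed
    ultimately show ?thesis using fs cs by (auto simp: nsets_def card_image)
  qed
  have \<psi>_vertex: "\<psi> ` vertex b ` s = vertex b' ` {..<Suc e}"
  proof -
    have "\<psi> ` vertex b ` s = (\<lambda>a. \<psi> (vertex b (nth_least s a))) ` {..<card s}"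
      by (subst (1) nth_least_image[OF fs, symmetric]) (simp add: image_image)
    also have "\<dots> = vertex b' ` {..<Suc e}"
      by (rule image_cong) (auto simp: cs \<psi>_def absorb_vertex[OF fs b(1)])
    finally show ?thesis .
  qed
  have \<theta>_vertex: "\<theta> ` vertex b ` {..<Suc e} = vertex b ` s"
  proof -
    have "\<theta> ` vertex b ` {..<Suc e} = vertex b ` nth_least s ` {..<card s}"
      by (simp add: image_image \<theta>_def lift_vertex[OF b(1)] cs)
    then show ?thesis by (simp add: nth_least_image[OF fs])
  qed
  have nt_small: "nontransversal e b \<subseteq> [{..<Suc (Suc e) * b}]\<^bsup>Suc e\<^esup>"
    by (auto simp: nontransversal_def)
  have top_small: "vertex b ` {..<Suc e} \<in> [{..<Suc (Suc e) * b}]\<^bsup>Suc e\<^esup>"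
  proof -
    have "inj_on (vertex b) {..<Suc e}" using b(1) by (auto simp: inj_on_def vertex_def)
    moreover have "vertex b i < Suc (Suc e) * b" if "i < Suc e" for i
    proof -
      have "b * Suc i < b * Suc (Suc e)" by (rule mult_less_mono2) (use that b(1) in auto)
      then show ?thesis by (simp add: vertex_def mult.commute)
    qed
    ultimately show ?thesis by (auto simp: nsets_def card_image)
  qed
  \<comment> \<open>After the move, everything that \<open>G\<close> looks at misses one of the enlarged blocks.\<close>
  have absorbed: "G (pull \<psi> x) = G (pull \<psi> (past e b' x))" for x
  proof (rule G)
    fix r assume r: "r \<in> [{..<b'}]\<^bsup>Suc e\<^esup>"
      and nt: "\<not> {1..Suc e} \<subseteq> (\<lambda>q. count_below s (q div b)) ` r"
    have "(\<lambda>q. q div b') ` \<psi> ` r = (\<lambda>q. count_below s (q div b)) ` r"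
      unfolding image_image \<psi>_def
      by (rule image_cong) (use r in \<open>auto simp: nsets_def absorb_div\<close>)
    moreover have "\<psi> ` r \<in> [{..<Suc (Suc e) * b'}]\<^bsup>Suc e\<^esup>"
      by (rule image_in_nsets[OF r \<psi>_mono \<psi>_range])
    ultimately have "\<psi> ` r \<in> nontransversal e b'"
      using nt by (simp add: nontransversal_def)
    then show "pull \<psi> x r = pull \<psi> (past e b' x) r" by (simp add: pull_def past_def)
  qed
  define X where "X = top_entry e b'"
  have X: "X x = pull \<psi> x (vertex b ` s)" for x
    by (simp add: X_def top_entry_def pull_def \<psi>_vertex)
  have gdet: "G x = G y" if "\<And>r. r \<in> [{..<b'}]\<^bsup>Suc e\<^esup> \<Longrightarrow> x r = y r" for x y
    by (rule G) (use that in auto)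
  have J: "{..<b'} \<subseteq> {..<n}" using b'n by auto
  have pdet: "(x (vertex b ` s), G x) = (y (vertex b ` s), G y)"
    if "\<And>r. r \<in> [{..<b'}]\<^bsup>Suc e\<^esup> \<Longrightarrow> x r = y r" for x y
    using that[OF vs] gdet[OF that] by simp
  have step1: "tv_within \<eta> (map_pmf (\<lambda>x. (x (vertex b ` s), G x)) p)
      (map_pmf (\<lambda>x. (X x, G (pull \<psi> x))) p)"
    unfolding X
    by (rule spreadable_pmf_transport[OF spr J \<psi>_mono \<psi>_n, where g = "\<lambda>x. (x (vertex b ` s), G x)"])
      (rule pdet)
  have step2: "tv_within \<tau> (map_pmf (\<lambda>x. (X x, G (pull \<psi> x))) p)
      (bind_pmf (map_pmf (\<lambda>x. G (pull \<psi> x)) p) (\<lambda>z. map_pmf (\<lambda>a. (a, z)) (H z)))"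
  proof (rule tv_within_near_optimal_predictor)
    show "finite {..<m}" "{..<m} \<noteq> {}" using m by auto
    show "X x \<in> {..<m}" if "x \<in> set_pmf p" for x
      using val[OF that] by (simp add: X_def top_entry_def)
    show "set_pmf (H z) \<subseteq> {..<m}" for z by (rule H)
    show "score p m e b c - \<delta> \<le>
        measure_pmf.expectation p (\<lambda>x. brier {..<m} (c' (G (pull \<psi> x))) (X x))" for c'
      using stable[of "\<lambda>z. c' (G (pull \<psi> z))"]
      by (simp add: score_def X_def flip: absorbed)
    \<comment> \<open>The forecast \<open>c\<close> was chosen for the first \<open>Suc e\<close> blocks. Its loss is nearly the same at the
      place where it is used here, the image under \<open>\<psi>\<close> of the blocks of \<open>s\<close>.\<close>
    have "tv_within \<eta> (map_pmf (\<lambda>x. (past e b x, top_entry e b x)) p)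
        (map_pmf (\<lambda>x. (past e b (pull (\<psi> \<circ> \<theta>) x), top_entry e b (pull (\<psi> \<circ> \<theta>) x))) p)"
    proof (rule spreadable_pmf_transport[OF spr])
      show "{..<Suc (Suc e) * b} \<subseteq> {..<n}"
      proof -
        have "Suc (Suc e) * b \<le> Suc (Suc e) * b'" using b(1,2) by (intro mult_le_mono2) simp
        then show ?thesis using b(3) by auto
      qed
      show "strict_mono_on {..<Suc (Suc e) * b} (\<psi> \<circ> \<theta>)"
        by (rule strict_mono_on_compose[OF \<theta>_mono \<psi>_mono \<theta>_range])
      show "(\<psi> \<circ> \<theta>) ` {..<Suc (Suc e) * b} \<subseteq> {..<n}"
        using \<theta>_range \<psi>_n by (auto simp: image_comp[symmetric])
      show "(past e b x, top_entry e b x) = (past e b y, top_entry e b y)"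
        if "\<And>r. r \<in> [{..<Suc (Suc e) * b}]\<^bsup>Suc e\<^esup> \<Longrightarrow> x r = y r" for x y
        using that nt_small top_small by (auto simp: past_def top_entry_def intro!: restrict_ext)
    qed
    from tv_within_sym[OF this]
    have "measure_pmf.expectation
          (map_pmf (\<lambda>x. (past e b (pull (\<psi> \<circ> \<theta>) x), top_entry e b (pull (\<psi> \<circ> \<theta>) x))) p)
          (\<lambda>(z, a). (1 + brier {..<m} (c z) a) / 2) \<le>
        measure_pmf.expectation (map_pmf (\<lambda>x. (past e b x, top_entry e b x)) p)
          (\<lambda>(z, a). (1 + brier {..<m} (c z) a) / 2) + \<eta>"
    proof (rule tv_withinD)
      fix y :: "config \<times> nat"
      have "\<bar>brier {..<m} (c (fst y)) (snd y)\<bar> \<le> 1"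
        by (rule brier_bounds_supported) (use c in auto)
      then show "0 \<le> (case y of (z, a) \<Rightarrow> (1 + brier {..<m} (c z) a) / 2)"
        "(case y of (z, a) \<Rightarrow> (1 + brier {..<m} (c z) a) / 2) \<le> 1"
        by (auto simp: case_prod_beta)
    qed
    moreover have "integrable p (\<lambda>x. brier {..<m} (c (f x)) (g x))" for f g
      by (rule integrable_bounded_pmf[where B = 1], rule brier_bounds_supported) (use c in auto)
    ultimately have "measure_pmf.expectation p
        (\<lambda>x. brier {..<m} (c (past e b (pull (\<psi> \<circ> \<theta>) x))) (top_entry e b (pull (\<psi> \<circ> \<theta>) x)))
        \<le> score p m e b c + 2 * \<eta>"
      by (simp add: score_def add_divide_distrib)
    moreover have "measure_pmf.expectation p (\<lambda>x. brier {..<m} (H (G (pull \<psi> x))) (X x)) =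
      measure_pmf.expectation p
        (\<lambda>x. brier {..<m} (c (past e b (pull (\<psi> \<circ> \<theta>) x))) (top_entry e b (pull (\<psi> \<circ> \<theta>) x)))"
    proof (rule integral_cong_AE)
      show "AE x in measure_pmf p. brier {..<m} (H (G (pull \<psi> x))) (X x) =
        brier {..<m} (c (past e b (pull (\<psi> \<circ> \<theta>) x))) (top_entry e b (pull (\<psi> \<circ> \<theta>) x))"
      proof (rule AE_pmfI)
        fix x assume "x \<in> set_pmf p"
        then have "H (G (pull \<psi> x)) = c (past e b (pull \<theta> (pull \<psi> x)))"
          using HG[of "pull \<psi> x"] val by (simp add: pull_less \<theta>_def)
        moreover have "X x = top_entry e b (pull (\<psi> \<circ> \<theta>) x)"
        proof -
          have "(\<psi> \<circ> \<theta>) ` vertex b ` {..<Suc e} = \<psi> ` (\<theta> ` vertex b ` {..<Suc e})"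
            by (simp add: image_image)
          then show ?thesis
            by (simp only: X top_entry_def pull_def \<theta>_vertex)
        qed
        ultimately show "brier {..<m} (H (G (pull \<psi> x))) (X x) =
          brier {..<m} (c (past e b (pull (\<psi> \<circ> \<theta>) x))) (top_entry e b (pull (\<psi> \<circ> \<theta>) x))"
          by (simp add: pull_comp)
      qed
    qed auto
    ultimately show "measure_pmf.expectation p (\<lambda>x. brier {..<m} (H (G (pull \<psi> x))) (X x))
        \<le> (score p m e b c - \<delta>) + (\<delta> + 2 * \<eta>)"
      by linarith
    show "0 < \<tau>" "(\<delta> + 2 * \<eta>) * real (card {..<m}) \<le> \<tau>\<^sup>2" using \<tau> by auto
  qed
  have step3: "tv_within \<eta> (map_pmf (\<lambda>x. G (pull \<psi> x)) p) (map_pmf G p)"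
    by (rule tv_within_sym, rule spreadable_pmf_transport[OF spr J \<psi>_mono \<psi>_n, where g = G])
      (rule gdet)
  have "tv_within (\<eta> + (\<tau> + \<eta>)) (map_pmf (\<lambda>x. (x (vertex b ` s), G x)) p)
    (bind_pmf (map_pmf G p) (\<lambda>z. map_pmf (\<lambda>a. (a, z)) (H z)))"
    by (rule tv_within_trans[OF step1 tv_within_trans[OF step2 tv_within_bind[OF step3]]])
  then show ?thesis by (rule tv_within_mono) simp
qed

section \<open>Entries are nearly independent given the types\<close>

definition entries :: "nat \<Rightarrow> nat \<Rightarrow> nat \<Rightarrow> config \<Rightarrow> config" where
  "entries k e b x = (\<lambda>s\<in>[{..<k}]\<^bsup>Suc e\<^esup>. x (vertex b ` s))"

definition types :: "(config \<Rightarrow> nat) \<Rightarrow> nat \<Rightarrow> nat \<Rightarrow> nat \<Rightarrow> config \<Rightarrow> config" where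
  "types enc k e b x = (\<lambda>t\<in>[{..<k}]\<^bsup>e\<^esup>. block_type enc b e t x)"

lemma vertex_image_in_nsets:
  assumes "0 < b" "s \<in> [{..<k}]\<^bsup>d\<^esup>"
  shows "vertex b ` s \<in> [{..<Suc k * b}]\<^bsup>d\<^esup>"
proof (rule image_in_nsets[OF assms(2)])
  show "strict_mono_on {..<k} (vertex b)"
    using assms(1) by (intro strict_mono_onI) (simp add: vertex_def)
  have "b * Suc i < b * Suc k" if "i < k" for i
    by (rule mult_less_mono2) (use that assms(1) in auto)
  then show "vertex b ` {..<k} \<subseteq> {..<Suc k * b}"
    by (auto simp: vertex_def mult.commute)
qed

text \<open>Redraw the entries one after the other, those with larger sum first. The set \<open>D\<close> of entries that
  have been redrawn is closed under passing to larger sums. When \<open>s\<close> is next, an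
  entry \<open>s'\<close> outside \<open>D\<close> other than \<open>s\<close> has no larger sum than \<open>s\<close>, so it does not meet all
  enlarged blocks of \<open>s\<close>. Neither does an index set that a type looks at, since apart from block \<open>0\<close> a type
  involves only \<open>e\<close> blocks. Hence
  \<open>resample_entry\<close> applies with all types and all remaining entries as \<open>G\<close>. The entries in \<open>D\<close>
  are functions of the types and independent noise, so they can be added afterwards.\<close>

lemma resample_all:
  fixes p :: "config pmf" and H :: "nat set \<Rightarrow> config \<Rightarrow> nat pmf"
  assumes m: "0 < m" and val: "\<And>x s. x \<in> set_pmf p \<Longrightarrow> x s < m"
    and spr: "spreadable_pmf \<eta> n (Suc e) p"
    and b: "0 < b" "b' = Suc k * b" "Suc (Suc e) * b' \<le> n"
    and c: "\<And>z. set_pmf (c z) \<subseteq> {..<m}"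
    and stable: "\<And>h. score p m e b c \<le> score p m e b' h + \<delta>"
    and H: "\<And>s z. set_pmf (H s z) \<subseteq> {..<m}"
    and Hc: "\<And>s x. s \<in> [{..<k}]\<^bsup>Suc e\<^esup> \<Longrightarrow> (\<And>r. x r < m) \<Longrightarrow>
      H s (types enc k e b x) = c (past e b (pull (lift b (nth_least s)) x))"
    and \<tau>: "0 < \<tau>" "(\<delta> + 2 * \<eta>) * real m \<le> \<tau>\<^sup>2"
  shows "tv_within (real (k choose Suc e) * (\<tau> + 2 * \<eta>)) (map_pmf (entries k e b) p)
    (bind_pmf (map_pmf (types enc k e b) p) (\<lambda>z. map_pmf (\<lambda>y. restrict y ([{..<k}]\<^bsup>Suc e\<^esup>))
      (Pi_pmf ([{..<k}]\<^bsup>Suc e\<^esup>) 0 (\<lambda>s. H s z))))"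
proof -
  define All where "All = [{..<k}]\<^bsup>Suc e\<^esup>"
  have finAll: "finite All" unfolding All_def by (rule finite_imp_finite_nsets) simp
  define Z where "Z = types enc k e b"
  define P where "P D = bind_pmf p (\<lambda>x. map_pmf (\<lambda>y. \<lambda>s\<in>All. if s \<in> D then y s else x (vertex b ` s))
      (Pi_pmf D 0 (\<lambda>s. H s (Z x))))" for D
  have main: "tv_within (real (card D) * (\<tau> + 2 * \<eta>)) (P {}) (P D)"
    if "D \<subseteq> All" "\<And>s s'. s \<in> D \<Longrightarrow> s' \<in> All \<Longrightarrow> \<Sum>s < \<Sum>s' \<Longrightarrow> s' \<in> D" for D
    using that
  proof (induction "card D" arbitrary: D)
    case 0
    then have "D = {}" using finAll finite_subset by fastforce
    then show ?case by (simp add: tv_within_refl)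
  next
    case (Suc N)
    have finD: "finite D" using Suc.prems(1) finAll finite_subset by blast
    have "D \<noteq> {}" using Suc.hyps(2) by auto
    \<comment> \<open>The last entry to be redrawn.\<close>
    then obtain s where s: "s \<in> D" "\<And>s'. s' \<in> D \<Longrightarrow> \<Sum>s \<le> \<Sum>s'"
      using finD by (metis arg_min_if_finite(1,2) linorder_not_le)
    define D0 where "D0 = D - {s}"
    have D: "D = insert s D0" "s \<notin> D0" "finite D0" using s(1) finD by (auto simp: D0_def)
    have N: "N = card D0" using Suc.hyps(2) D by simp
    have sAll: "s \<in> All" using s(1) Suc.prems(1) by blast
    have IH: "tv_within (real (card D0) * (\<tau> + 2 * \<eta>)) (P {}) (P D0)"
    proof (rule Suc.hyps(1)[OF N])
      show "D0 \<subseteq> All" using Suc.prems(1) by (auto simp: D0_def)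
      fix r r' assume r: "r \<in> D0" "r' \<in> All" "\<Sum>r < \<Sum>r'"
      then have "r' \<in> D" using Suc.prems(2)[of r r'] by (auto simp: D0_def)
      moreover have "r' \<noteq> s" using r s(2)[of r] by (auto simp: D0_def)
      ultimately show "r' \<in> D0" by (simp add: D0_def)
    qed
    have fs: "finite s" "card s = Suc e" using sAll by (auto simp: All_def nsets_def)
    define G where "G x = (Z x, \<lambda>s'\<in>All - D. x (vertex b ` s'))" for x :: config
    define K where "K = (\<lambda>(a, z, xr). map_pmf (\<lambda>y. \<lambda>s'\<in>All. if s' = s then a
        else if s' \<in> D0 then y s' else xr s') (Pi_pmf D0 0 (\<lambda>s'. H s' z)))"
    have Gdet: "G x = G y"
      if eq: "\<And>r. r \<in> [{..<b'}]\<^bsup>Suc e\<^esup> \<Longrightarrow>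
        \<not> {1..Suc e} \<subseteq> (\<lambda>q. count_below s (q div b)) ` r \<Longrightarrow> x r = y r" for x y
    proof -
      have "Z x = Z y"
        unfolding Z_def types_def
      proof (rule restrict_ext)
        fix t assume t: "t \<in> [{..<k}]\<^bsup>e\<^esup>"
        then have ft: "finite t" "card t = e" "t \<subseteq> {..<k}" by (auto simp: nsets_def)
        show "block_type enc b e t x = block_type enc b e t y"
        proof (rule block_type_cong[OF b(1) ft(1,2)])
          fix r assume r: "r \<in> [lift b (nth_least t) ` {..<Suc e * b}]\<^bsup>Suc e\<^esup>"
          show "x r = y r"
          proof (rule eq)
            show "r \<in> [{..<b'}]\<^bsup>Suc e\<^esup>"
              using r lift_nth_least_bound[OF b(1) ft(3)] ft(2) by (auto simp: nsets_def b(2))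
            show "\<not> {1..Suc e} \<subseteq> (\<lambda>q. count_below s (q div b)) ` r"
            proof
              assume sub: "{1..Suc e} \<subseteq> (\<lambda>q. count_below s (q div b)) ` r"
              have "{1..Suc e} \<subseteq> (\<lambda>j. count_below s (Suc j)) ` t"
              proof
                fix a assume a: "a \<in> {1..Suc e}"
                then obtain q' where "q' \<in> r" "a = count_below s (q' div b)"
                  using sub by blast
                moreover have "r \<subseteq> lift b (nth_least t) ` {..<Suc e * b}"
                  using r by (simp add: nsets_def)
                ultimately obtain q where q: "q < Suc e * b"
                  and aq: "a = count_below s (lift b (nth_least t) q div b)"
                  by blast
                have "\<not> q < b" using a aq by (auto simp: lift_div[OF b(1)] count_below_def)
                then have "a = count_below s (Suc (nth_least t (q div b - 1)))"
                  using aq by (simp add: lift_div[OF b(1)])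
                moreover have "nth_least t (q div b - 1) \<in> t"
                proof (rule nth_least_in[OF ft(1)])
                  show "q div b - 1 < card t"
                    using q \<open>\<not> q < b\<close> blocks_lessThan[OF b(1), of e] ft(2) by auto
                qed
                ultimately show "a \<in> (\<lambda>j. count_below s (Suc j)) ` t" by blast
              qed
              then have "card {1..Suc e} \<le> card ((\<lambda>j. count_below s (Suc j)) ` t)"
                by (rule card_mono[rotated]) (use ft in auto)
              also have "\<dots> \<le> e" using card_image_le[OF ft(1)] ft(2) by auto
              finally show False by simp
            qed
          qed
        qed
      qed
      moreover have "x (vertex b ` s') = y (vertex b ` s')" if s': "s' \<in> All - D" for s'
      proof (rule eq)
        show "vertex b ` s' \<in> [{..<b'}]\<^bsup>Suc e\<^esup>"
          using vertex_image_in_nsets[OF b(1)] s' unfolding All_def b(2) by blast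
        have "\<not> \<Sum>s < \<Sum>s'" using Suc.prems(2)[OF s(1), of s'] s' by blast
        moreover have "finite s'" "card s' = card s" using s' fs by (auto simp: All_def nsets_def)
        moreover have "s' \<noteq> s" using s' s(1) by blast
        ultimately have "\<not> {1..Suc e} \<subseteq> (\<lambda>j. count_below s (Suc j)) ` s'"
          using count_below_covers_imp_sum_less[OF fs(1), of s'] fs(2) by metis
        then show "\<not> {1..Suc e} \<subseteq> (\<lambda>q. count_below s (q div b)) ` vertex b ` s'"
          by (simp add: image_image vertex_div[OF b(1)])
      qed
      then have "(\<lambda>s'\<in>All - D. x (vertex b ` s')) = (\<lambda>s'\<in>All - D. y (vertex b ` s'))"
        by (intro restrict_ext) auto
      ultimately show ?thesis by (simp add: G_def)
    qed
    have step: "tv_within (\<tau> + 2 * \<eta>) (map_pmf (\<lambda>x. (x (vertex b ` s), G x)) p)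
        (bind_pmf (map_pmf G p) (\<lambda>z. map_pmf (\<lambda>a. (a, z)) (H s (fst z))))"
    proof (rule resample_entry[where m = m and n = n and e = e and b = b and b' = b' and k = k
          and c = c and \<delta> = \<delta> and H = "\<lambda>z. H s (fst z)"])
      show sk: "s \<in> [{..<k}]\<^bsup>Suc e\<^esup>" using sAll by (simp add: All_def)
      show "H s (fst (G x)) = c (past e b (pull (lift b (nth_least s)) x))"
        if "\<And>r. x r < m" for x
        using Hc[OF sk that] by (simp add: G_def Z_def)
      show "x s < m" if "x \<in> set_pmf p" for x s using val[OF that] .
      show "score p m e b c \<le> score p m e b' h + \<delta>" for h by (rule stable)
      show "set_pmf (c z) \<subseteq> {..<m}" for z by (rule c)
      show "set_pmf (H s (fst z)) \<subseteq> {..<m}" for z :: "config \<times> config" by (rule H)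
    qed (fact m spr b \<tau> Gdet)+
    have PD0: "P D0 = bind_pmf (map_pmf (\<lambda>x. (x (vertex b ` s), G x)) p) K"
      unfolding P_def bind_map_pmf
    proof (rule bind_pmf_cong[OF refl])
      fix x :: config
      have "(\<lambda>s'\<in>All. if s' \<in> D0 then y s' else x (vertex b ` s')) =
        (\<lambda>s'\<in>All. if s' = s then x (vertex b ` s) else if s' \<in> D0 then y s'
            else (\<lambda>s'\<in>All - D. x (vertex b ` s')) s')" for y
        by (rule restrict_ext) (use D in auto)
      then show "map_pmf (\<lambda>y. \<lambda>s\<in>All. if s \<in> D0 then y s else x (vertex b ` s))
          (Pi_pmf D0 0 (\<lambda>s. H s (Z x))) = K (x (vertex b ` s), G x)"
        by (simp add: K_def G_def)
    qed
    have PD: "P D = bind_pmf (bind_pmf (map_pmf G p) (\<lambda>z. map_pmf (\<lambda>a. (a, z)) (H s (fst z)))) K"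
      unfolding P_def bind_assoc_pmf bind_map_pmf
    proof (rule bind_pmf_cong[OF refl])
      fix x :: config
      have eq: "(\<lambda>s'\<in>All. if s' \<in> D then (y(s := a)) s' else x (vertex b ` s')) =
        (\<lambda>s'\<in>All. if s' = s then a else if s' \<in> D0 then y s'
            else (\<lambda>s'\<in>All - D. x (vertex b ` s')) s')" for y a
        by (rule restrict_ext) (use D in auto)
      have "map_pmf (\<lambda>y. \<lambda>s\<in>All. if s \<in> D then y s else x (vertex b ` s))
          (Pi_pmf D 0 (\<lambda>s. H s (Z x))) =
        map_pmf (\<lambda>(a, y). \<lambda>s'\<in>All. if s' \<in> D then (y(s := a)) s' else x (vertex b ` s'))
          (pair_pmf (H s (Z x)) (Pi_pmf D0 0 (\<lambda>s. H s (Z x))))"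
        by (subst (2) D(1), subst Pi_pmf_insert[OF D(3,2)])
          (simp only: pmf.map_comp, rule map_pmf_cong[OF refl], auto split: prod.splits)
      also have "\<dots> = bind_pmf (H s (Z x)) (\<lambda>a. K (a, G x))"
        unfolding eq by (simp add: pair_pmf_def map_bind_pmf K_def G_def map_pmf_def[symmetric]
            pmf.map_comp o_def)
      finally show "map_pmf (\<lambda>y. \<lambda>s\<in>All. if s \<in> D then y s else x (vertex b ` s))
          (Pi_pmf D 0 (\<lambda>s. H s (Z x))) = bind_pmf (H s (fst (G x))) (\<lambda>a. K (a, G x))"
        by (simp add: G_def)
    qed
    have "tv_within (\<tau> + 2 * \<eta>) (P D0) (P D)"
      unfolding PD0 PD by (rule tv_within_bind[OF step])
    from tv_within_trans[OF IH this] show ?case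
      by (simp add: Suc.hyps(2)[symmetric] N algebra_simps)
  qed
  have "P {} = map_pmf (entries k e b) p"
    by (simp add: P_def entries_def All_def map_pmf_def cong: restrict_cong)
  moreover have "P All = bind_pmf (map_pmf Z p) (\<lambda>z. map_pmf (\<lambda>y. restrict y All)
      (Pi_pmf All 0 (\<lambda>s. H s z)))"
    unfolding P_def bind_map_pmf
    by (intro bind_pmf_cong[OF refl] map_pmf_cong[OF refl] restrict_ext) simp
  moreover have "card All = k choose Suc e" by (simp add: All_def)
  ultimately show ?thesis using main[of All] by (simp add: Z_def All_def)
qed

section \<open>The tower of exponentials\<close>

lemma le_exp: "x \<le> exp (x :: real)"
  using exp_ge_add_one_self[of x] by linarith

lemma exp_iter_ge: "y \<le> (exp ^^ l) (y :: real)"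
proof (induction l)
  case (Suc l)
  then show ?case using le_exp[of "(exp ^^ l) y"] by simp
qed simp

text \<open>A gap of the size needed in the induction survives further exponentials.\<close>

lemma exp_iter_gap:
  fixes x y B :: real
  assumes "0 \<le> x" "1 \<le> B" "(x + 2) * B \<le> y"
  shows "((exp ^^ l) x + 2) * B \<le> (exp ^^ l) y"
proof (induction l)
  case (Suc l)
  define u where "u = (exp ^^ l) x"
  define v where "v = (exp ^^ l) y"
  have u0: "0 \<le> u" using exp_iter_ge[of x l] assms(1) by (simp add: u_def)
  have "(1 + B) * (1 + B) \<le> exp B * exp B"
    using exp_ge_add_one_self[of B] assms(2) by (intro mult_mono) auto
  moreover have "exp B * exp B = exp (2 * B)" by (simp flip: exp_add)
  moreover have "1 * B \<le> B * B" using assms(2) by (intro mult_right_mono) auto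
  ultimately have "3 * B \<le> exp (2 * B)" by (simp add: algebra_simps)
  then have "exp u * (3 * B) \<le> exp u * exp (2 * B)" by (intro mult_left_mono) auto
  then have "(3 * exp u) * B \<le> exp u * exp (2 * B)" by (simp only: mult_ac)
  moreover have "exp u + 2 \<le> 3 * exp u" using u0 by simp
  then have "(exp u + 2) * B \<le> (3 * exp u) * B" using assms(2) by (intro mult_right_mono) auto
  moreover have "u + 2 * B \<le> v"
  proof -
    have "u * 1 \<le> u * B" using u0 assms(2) by (intro mult_left_mono) auto
    then show ?thesis using Suc by (simp add: u_def v_def algebra_simps)
  qed
  then have "exp u * exp (2 * B) \<le> exp v" by (simp flip: exp_add)
  ultimately have "(exp u + 2) * B \<le> exp v" by linarith
  then show ?case by (simp add: u_def v_def)
qed (use assms in simp)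

lemma power_le_exp_mult:
  fixes m :: real
  assumes "0 < m"
  shows "m ^ n \<le> exp (m * real n)"
proof -
  have "m ^ n \<le> exp m ^ n"
    using assms le_exp[of m] by (intro power_mono) auto
  then show ?thesis by (simp add: exp_of_nat_mult[symmetric] mult.commute)
qed

lemma two_power_six_ge: "1 \<le> X \<Longrightarrow> 4 * real X ^ 4 \<le> 2 ^ (6 * X)"
proof -
  assume X: "1 \<le> X"
  have le: "real X \<le> 2 ^ X" using of_nat_less_two_power[of X, where 'a = real] by simp
  have "4 * real X ^ 4 \<le> (2 ^ X) ^ 2 * (2 ^ X) ^ 4"
  proof (rule mult_mono)
    have "(2 :: real) ^ 1 \<le> 2 ^ X" using X by (intro power_increasing) auto
    then have "(2 :: real) ^ 2 \<le> (2 ^ X) ^ 2" by (intro power_mono) auto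
    then show "(4 :: real) \<le> (2 ^ X) ^ 2" by simp
    show "real X ^ 4 \<le> (2 ^ X) ^ 4" using le by (intro power_mono) auto
  qed auto
  also have "\<dots> = 2 ^ (6 * X)" by (simp flip: power_add power_mult)
  finally show ?thesis .
qed

text \<open>With \<open>X = k ^ Suc e\<close> and \<open>u = 1 / \<epsilon>\<^sup>2\<close>, the logarithm of the left-hand side is at most
  \<open>18 * (u * m * X\<^sup>2) * B ^ Suc e\<close>, and \<open>B ^ Suc e\<close> is at most the exponential of \<open>65 * m * X ^ 4 * u\<close>. What
  remains is \<open>83 * m * X ^ 4 \<le> 64 * m ^ (7 * X)\<close>, with room to spare.\<close>

lemma induction_bound:
  fixes m k e J :: nat and \<epsilon> :: real
  assumes m: "2 \<le> m" and k: "Suc e \<le> k" and \<epsilon>: "0 < \<epsilon>" "\<epsilon> \<le> 1"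
    and J: "1 \<le> J" "real J \<le> 64 * real m * (real k ^ Suc e)\<^sup>2 / \<epsilon>\<^sup>2 + 1"
    and B: "B = Suc k ^ J" and m': "m' = m ^ ((Suc e * B) ^ Suc e)"
  shows "(2 ^ 6 * real m' ^ (7 * k ^ e) / (\<epsilon> / 2)\<^sup>2 + 2) * real B
    \<le> exp (exp (2 ^ 6 * real m ^ (7 * k ^ Suc e) / \<epsilon>\<^sup>2))"
proof -
  define D where "D = Suc e"
  define X where "X = k ^ D"
  define x where "x = real X"
  define u where "u = 1 / \<epsilon>\<^sup>2"
  define E where "E = (D * B) ^ D * (7 * k ^ e)"
  have D: "1 \<le> D" "D \<le> k" and k1: "1 \<le> k" using k by (auto simp: D_def)
  have kX: "k \<le> X" unfolding X_def using k1 D(1) by (intro self_le_power) auto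
  then have X1: "1 \<le> X" using k1 by linarith
  then have x1: "1 \<le> x" by (simp add: x_def)
  have u1: "1 \<le> u"
    using \<epsilon> by (simp add: u_def power_le_one)
  have B1: "1 \<le> B" by (simp add: B)
  have J': "real J \<le> 65 * real m * x\<^sup>2 * u"
  proof -
    have "1 \<le> real m * x\<^sup>2 * u"
      using m x1 u1 by (intro mult_ge1_I) (auto simp: one_le_power)
    moreover have "64 * real m * (real k ^ Suc e)\<^sup>2 / \<epsilon>\<^sup>2 = 64 * real m * x\<^sup>2 * u"
      by (simp add: x_def X_def D_def u_def)
    ultimately show ?thesis using J(2) by linarith
  qed
  have BD: "real B ^ D \<le> exp (x\<^sup>2 * real J)"
  proof -
    have "real (Suc k) \<le> exp (real k)" using exp_ge_add_one_self[of "real k"] by simp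
    then have "real B \<le> exp (real k) ^ J" unfolding B of_nat_power by (intro power_mono) auto
    then have "real B ^ D \<le> (exp (real k) ^ J) ^ D" by (intro power_mono) auto
    also have "\<dots> = exp (real (J * D) * real k)"
      by (simp add: power_mult[symmetric] exp_of_nat_mult[symmetric])
    also have "\<dots> \<le> exp (x\<^sup>2 * real J)"
    proof -
      have "real D * real k \<le> x * x"
        using D kX by (intro mult_mono) (auto simp: x_def)
      then have "real J * (real D * real k) \<le> real J * (x * x)" by (intro mult_left_mono) auto
      then show ?thesis by (simp add: power2_eq_square mult_ac)
    qed
    finally show ?thesis .
  qed
  have BD1: "real B \<le> real B ^ D" using B1 D(1) by (intro self_le_power) auto
  have E: "real E \<le> 7 * x\<^sup>2 * real B ^ D"
  proof -
    have "D ^ D \<le> X" unfolding X_def using D by (intro power_mono) auto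
    moreover have "k ^ e \<le> X" unfolding X_def D_def using k1 by (intro power_increasing) auto
    ultimately have "D ^ D * k ^ e \<le> X * X" by (rule mult_mono) auto
    then have "real (D ^ D * k ^ e) \<le> x * x" unfolding x_def by (metis of_nat_le_iff of_nat_mult)
    then have "7 * real B ^ D * real (D ^ D * k ^ e) \<le> 7 * real B ^ D * (x * x)"
      by (intro mult_left_mono) auto
    then show ?thesis by (simp add: E_def power_mult_distrib power2_eq_square mult_ac)
  qed
  have lhs: "2 ^ 6 * real m' ^ (7 * k ^ e) / (\<epsilon> / 2)\<^sup>2 = 256 * u * real m ^ E"
    by (simp add: m' E_def D_def u_def power_mult power_divide)
  have mE: "1 \<le> real m ^ E" using m by (intro one_le_power) auto
  have e9: "512 \<le> exp (9 :: real)"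
  proof -
    have "(2 :: real) ^ 9 \<le> exp 1 ^ 9" using exp_ge_add_one_self[of "1 :: real"] by (intro power_mono) auto
    then show ?thesis by (simp add: exp_of_nat_mult[symmetric])
  qed
  have "1 \<le> u * real m ^ E" using u1 mE by (intro mult_ge1_I) auto
  then have "(256 * u * real m ^ E + 2) * real B \<le> 512 * (u * real m ^ E) * real B"
    by (intro mult_right_mono) auto
  also have "\<dots> = 512 * u * real m ^ E * real B" by simp
  also have "\<dots> \<le> exp 9 * exp u * exp (real m * real E) * exp (real B)"
    using e9 u1 m by (intro mult_mono power_le_exp_mult le_exp) auto
  also have "\<dots> = exp (9 + u + real m * real E + real B)" by (simp add: exp_add)
  also have "9 + u + real m * real E + real B \<le> exp (2 ^ 6 * real m ^ (7 * k ^ Suc e) / \<epsilon>\<^sup>2)"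
  proof -
    define w where "w = u * real m * x\<^sup>2"
    have x2: "1 \<le> x\<^sup>2" using x1 by (simp add: one_le_power)
    have m1: "1 \<le> real m" using m by simp
    have w1: "1 \<le> w" unfolding w_def using u1 m1 x2 by (intro mult_ge1_I) auto
    have uw: "u \<le> w"
      using mult_ge1_I[OF m1 x2] u1 mult_left_mono[of 1 "real m * x\<^sup>2" u] by (simp add: w_def mult_ac)
    have mw: "real m * x\<^sup>2 \<le> w"
      using mult_right_mono[of 1 u "real m * x\<^sup>2"] u1 by (simp add: w_def mult_ac)
    have P1: "1 \<le> real B ^ D" using B1 by (intro one_le_power) auto
    have wP: "w \<le> w * real B ^ D" using mult_left_mono[OF P1, of w] w1 by simp
    have "real m * real E \<le> real m * (7 * x\<^sup>2 * real B ^ D)" by (intro mult_left_mono E) auto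
    also have "\<dots> = 7 * (real m * x\<^sup>2) * real B ^ D" by simp
    also have "\<dots> \<le> 7 * w * real B ^ D" using mw P1 by (intro mult_right_mono) auto
    finally have 1: "real m * real E \<le> 7 * w * real B ^ D" .
    have "9 \<le> 9 * (w * real B ^ D)" using mult_ge1_I[OF w1 P1] by simp
    moreover have "u \<le> w * real B ^ D" using uw wP by linarith
    moreover have "real B \<le> w * real B ^ D"
      using order_trans[OF BD1, of "w * real B ^ D"] mult_right_mono[OF w1, of "real B ^ D"] by simp
    ultimately have "9 + u + real m * real E + real B \<le> 18 * w * real B ^ D"
      using 1 by (simp add: algebra_simps)
    also have "\<dots> \<le> exp (18 * w) * exp (x\<^sup>2 * real J)"
      using w1 BD by (intro mult_mono le_exp) auto
    also have "\<dots> = exp (18 * w + x\<^sup>2 * real J)" by (simp add: exp_add)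
    also have "18 * w + x\<^sup>2 * real J \<le> 83 * (x\<^sup>2 * w)"
    proof -
      have "x\<^sup>2 * real J \<le> x\<^sup>2 * (65 * real m * x\<^sup>2 * u)" by (intro mult_left_mono J') auto
      moreover have "w \<le> x\<^sup>2 * w" using mult_right_mono[OF x2, of w] w1 by simp
      ultimately show ?thesis by (simp add: w_def algebra_simps)
    qed
    also have "83 * (x\<^sup>2 * w) = 83 * (u * (real m * x ^ 4))"
      by (simp add: w_def power2_eq_square power4_eq_xxxx)
    also have "83 * (u * (real m * x ^ 4)) \<le> 64 * (u * real m ^ (7 * X))"
    proof -
      have "4 * (real m * x ^ 4) \<le> real m ^ (7 * X)"
      proof -
        have "4 * x ^ 4 \<le> real m ^ (6 * X)"
          using order_trans[OF two_power_six_ge[OF X1] power_mono[of 2 "real m" "6 * X"]] m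
          by (simp add: x_def)
        moreover have "real m \<le> real m ^ X" using m X1 by (intro self_le_power) auto
        ultimately have "real m * (4 * x ^ 4) \<le> real m ^ X * real m ^ (6 * X)"
          by (intro mult_mono) auto
        then show ?thesis by (simp flip: power_add)
      qed
      then have "u * (4 * (real m * x ^ 4)) \<le> u * real m ^ (7 * X)"
        using u1 by (intro mult_left_mono) auto
      moreover have "0 \<le> u * (real m * x ^ 4)" using u1 by simp
      ultimately show ?thesis by linarith
    qed
    finally show ?thesis by (simp add: X_def D_def u_def)
  qed
  finally show ?thesis unfolding lhs by simp
qed

section \<open>Types of facets\<close>

lemma Pi_pmf_reindex:
  assumes "finite A" "inj_on g A"
  shows "Pi_pmf A dflt (\<lambda>s. K (g s)) =
    map_pmf (\<lambda>y s. if s \<in> A then y (g s) else dflt) (Pi_pmf (g ` A) dflt K)"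
  using assms
proof (induction A rule: finite_induct)
  case (insert a A)
  have ga: "g a \<notin> g ` A" using insert.hyps insert.prems by (auto simp: inj_on_def)
  then have ga': "g s \<noteq> g a" if "s \<in> A" for s using that by (metis imageI)
  have "Pi_pmf (insert a A) dflt (\<lambda>s. K (g s)) =
      map_pmf (\<lambda>(y, f). f(a := y)) (pair_pmf (K (g a)) (Pi_pmf A dflt (\<lambda>s. K (g s))))"
    by (rule Pi_pmf_insert[OF insert.hyps])
  also have "\<dots> = map_pmf (\<lambda>(y, f). (\<lambda>s. if s \<in> A then f (g s) else dflt)(a := y))
      (pair_pmf (K (g a)) (Pi_pmf (g ` A) dflt K))"
    using insert by (simp add: pair_map_pmf2 pmf.map_comp o_def case_prod_beta')
  also have "\<dots> = map_pmf (\<lambda>y s. if s \<in> insert a A then y (g s) else dflt)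
      (Pi_pmf (g ` insert a A) dflt K)"
    unfolding image_insert
    by (subst Pi_pmf_insert[OF _ ga])
      (use insert ga ga' in \<open>auto simp: pmf.map_comp o_def fun_eq_iff intro!: map_pmf_cong\<close>)
  finally show ?case .
qed simp

text \<open>Distinct index sets read off distinct tuples, and the values at distinct tuples are drawn independently.\<close>

lemma Pi_pmf_restrict_reindex:
  assumes "finite A" "inj_on g A" "finite L" "g ` A \<subseteq> L"
  shows "map_pmf (\<lambda>y. \<lambda>s\<in>A. y (g s)) (Pi_pmf L dflt K) =
    map_pmf (\<lambda>y. restrict y A) (Pi_pmf A dflt (\<lambda>s. K (g s)))"
  unfolding Pi_pmf_reindex[OF assms(1,2)] Pi_pmf_subset[OF assms(3,4)] pmf.map_comp o_def
  by (rule map_pmf_cong[OF refl]) (auto simp: fun_eq_iff)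

definition types_below :: "(config \<Rightarrow> nat) \<Rightarrow> nat \<Rightarrow> nat \<Rightarrow> config \<Rightarrow> nat \<Rightarrow> nat" where
  "types_below enc e b x = (\<lambda>i\<in>{..<Suc e}. block_type enc b e ({..<Suc e} - {i}) x)"

text \<open>A set that misses block \<open>i + 1\<close> lies in block \<open>0\<close> and the blocks of the facet without \<open>i\<close>, so its
  entry is part of the type of this facet.\<close>

lemma types_below_determine_past:
  assumes b: "0 < b"
    and enc: "inj_on enc (PiE ([{..<Suc e * b}]\<^bsup>Suc e\<^esup>) (\<lambda>_. {..<m}))"
    and x: "\<And>s. x s < m" and y: "\<And>s. y s < m"
    and eq: "types_below enc e b x = types_below enc e b y"
  shows "past e b x = past e b y"
  unfolding past_def
proof (rule restrict_ext)
  fix r assume "r \<in> nontransversal e b"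
  then have r: "r \<subseteq> {..<Suc (Suc e) * b}" "finite r" "card r = Suc e"
    and nt: "\<not> {1..Suc e} \<subseteq> (\<lambda>q. q div b) ` r"
    by (auto simp: nontransversal_def nsets_def)
  obtain a where a: "a \<in> {1..Suc e}" "a \<notin> (\<lambda>q. q div b) ` r" using nt by blast
  define i where "i = a - 1"
  have i: "i < Suc e" and Si: "Suc i \<notin> (\<lambda>q. q div b) ` r" using a by (auto simp: i_def)
  define t where "t = {..<Suc e} - {i}"
  have t: "finite t" "card t = e" using i by (auto simp: t_def)
  define \<theta> where "\<theta> = lift b (nth_least t)"
  have mono: "strict_mono_on {..<Suc e * b} \<theta>"
    using lift_nth_least_strict_mono[OF b t(1)] by (simp add: t(2) \<theta>_def)
  have cover: "r \<subseteq> \<theta> ` {..<Suc e * b}"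
  proof
    fix q assume q: "q \<in> r"
    show "q \<in> \<theta> ` {..<Suc e * b}"
    proof (cases "q < b")
      case True
      then have "\<theta> q = q" "q < Suc e * b" by (auto simp: \<theta>_def lift_def)
      then show ?thesis by (metis imageI lessThan_iff)
    next
      case False
      define j where "j = q div b - 1"
      have "q div b < Suc (Suc e)" using q r(1) b by (auto simp: div_less_iff_less_mult)
      moreover have "0 < q div b" using False b by (simp add: div_greater_zero_iff)
      ultimately have j: "Suc j = q div b" "j < Suc e" by (auto simp: j_def)
      have "j \<noteq> i" using Si q j(1) by blast
      then have "j \<in> t" using j(2) by (simp add: t_def)
      then obtain c where c: "c < e" "j = nth_least t c"
        using nth_least_image[OF t(1)] t(2) by auto
      define q' where "q' = vertex b c + q mod b"
      have "q' div b = Suc c" "q' mod b = q mod b"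
        using b by (auto simp: q'_def vertex_add_div vertex_add_mod)
      then have "\<theta> q' = vertex b j + q mod b"
        using c(2) by (auto simp: \<theta>_def lift_def q'_def vertex_def)
      also have "\<dots> = q"
        unfolding vertex_def j(1) by simp
      finally have "\<theta> q' = q" .
      moreover have "q' < Suc e * b"
        using \<open>q' div b = Suc c\<close> c(1) b by (simp add: div_less_iff_less_mult[symmetric] del: mult_Suc)
      ultimately show ?thesis by (metis imageI lessThan_iff)
    qed
  qed
  define r' where "r' = {q \<in> {..<Suc e * b}. \<theta> q \<in> r}"
  have r'_im: "\<theta> ` r' = r" using cover by (auto simp: r'_def)
  have inj: "inj_on \<theta> r'"
    by (rule inj_on_subset[OF strict_mono_on_imp_inj_on[OF mono]]) (auto simp: r'_def)
  have r': "r' \<in> [{..<Suc e * b}]\<^bsup>Suc e\<^esup>"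
  proof -
    have "card r' = Suc e" using card_image[OF inj] r'_im r(3) by simp
    moreover have "r' \<subseteq> {..<Suc e * b}" by (auto simp: r'_def)
    ultimately show ?thesis using finite_subset by (auto simp: nsets_def)
  qed
  have "block_type enc b e t x = block_type enc b e t y"
    using fun_cong[OF eq, of i] i by (simp add: types_below_def t_def)
  then have "restrict (pull \<theta> x) ([{..<Suc e * b}]\<^bsup>Suc e\<^esup>) = restrict (pull \<theta> y) ([{..<Suc e * b}]\<^bsup>Suc e\<^esup>)"
    unfolding block_type_def \<theta>_def[symmetric]
    by (rule inj_onD[OF enc]) (auto simp: x y pull_less)
  from fun_cong[OF this, of r'] show "x r = y r"
    using r' by (simp add: pull_def r'_im)
qed

lemma types_below_pull:
  assumes "0 < b" "s \<in> [{..<k}]\<^bsup>Suc e\<^esup>"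
  shows "types_below enc e b (pull (lift b (nth_least s)) x) =
    (\<lambda>i\<in>{..<Suc e}. types enc k e b x (s - {nth_least s i}))"
  unfolding types_below_def
proof (rule restrict_ext)
  fix i assume i: "i \<in> {..<Suc e}"
  have s: "finite s" "card s = Suc e" "s \<subseteq> {..<k}" using assms(2) by (auto simp: nsets_def)
  have mono: "strict_mono_on {..<Suc e} (nth_least s)"
    using strict_mono_on_nth_least[OF s(1)] s(2) by simp
  have im: "nth_least s ` ({..<Suc e} - {i}) = s - {nth_least s i}"
    using inj_on_image_set_diff[OF strict_mono_on_imp_inj_on[OF mono], of "{..<Suc e}" "{i}"]
      nth_least_image[OF s(1)] i s(2) by simp
  have mono': "strict_mono_on ({..<Suc e} - {i}) (nth_least s)"
    using mono by (auto simp: strict_mono_on_def)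
  have "nth_least s i \<in> s" using i s by (intro nth_least_in) auto
  then have "s - {nth_least s i} \<in> [{..<k}]\<^bsup>e\<^esup>" using s by (auto simp: nsets_def)
  moreover have "block_type enc b e (nth_least s ` ({..<Suc e} - {i})) x =
      block_type enc b e ({..<Suc e} - {i}) (pull (lift b (nth_least s)) x)"
    by (rule block_type_pull[OF assms(1) _ _ mono']) (use i in auto)
  ultimately show "block_type enc b e ({..<Suc e} - {i}) (pull (lift b (nth_least s)) x) =
      types enc k e b x (s - {nth_least s i})"
    by (simp add: types_def im)
qed

text \<open>An increasing map of the index set lifts to the blocks, and by \<open>block_type_pull\<close> the lifted map acts on
  the configuration as the original one does on the types.\<close>

lemma spreadable_pmf_block_types:
  assumes spr: "spreadable_pmf \<eta> n (Suc e) p"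
    and b: "0 < b" and n': "Suc n' * b \<le> n"
  shows "spreadable_pmf \<eta> n' e (map_pmf (\<lambda>x t. block_type enc b e t x) p)"
  unfolding spreadable_pmf_def
proof (intro allI impI, elim conjE)
  fix J \<phi> assume J: "J \<subseteq> {..<n'}" and \<phi>: "strict_mono_on J \<phi>" "\<phi> ` J \<subseteq> {..<n'}"
  define J' where "J' = {q. q < b \<or> q div b - 1 \<in> J}"
  define g where "g x = (\<lambda>t\<in>[J]\<^bsup>e\<^esup>. block_type enc b e t x)" for x
  have finJ: "finite J" using J finite_subset by blast
  have "J' \<subseteq> {..<Suc n' * b}" using J unfolding J'_def blocks_lessThan[OF b, symmetric] by auto
  then have J'n: "J' \<subseteq> {..<n}" using n' by (meson lessThan_subset_iff order_trans)
  have "lift b \<phi> ` J' \<subseteq> {..<Suc n' * b}"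
    using lift_bound[OF b, of _ \<phi> n'] \<phi>(2) by (auto simp: J'_def simp del: mult_Suc)
  then have im: "lift b \<phi> ` J' \<subseteq> {..<n}" using n' by (meson lessThan_subset_iff order_trans)
  have "tv_within \<eta> (map_pmf g p) (map_pmf (\<lambda>x. g (pull (lift b \<phi>) x)) p)"
  proof (rule spreadable_pmf_transport[OF spr J'n _ im])
    show "strict_mono_on J' (lift b \<phi>)" unfolding J'_def by (rule lift_strict_mono[OF b \<phi>(1)])
    fix x y :: config assume xy: "\<And>r. r \<in> [J']\<^bsup>Suc e\<^esup> \<Longrightarrow> x r = y r"
    show "g x = g y"
      unfolding g_def
    proof (rule restrict_ext)
      fix t assume "t \<in> [J]\<^bsup>e\<^esup>"
      then have t: "finite t" "card t = e" "t \<subseteq> J" by (auto simp: nsets_def)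
      show "block_type enc b e t x = block_type enc b e t y"
      proof (rule block_type_cong[OF b t(1,2)], rule xy)
        fix r assume r: "r \<in> [lift b (nth_least t) ` {..<Suc e * b}]\<^bsup>Suc e\<^esup>"
        have "lift b (nth_least t) q \<in> J'" if q: "q < Suc e * b" for q
        proof (cases "q < b")
          case False
          have "q div b - 1 < card t" using q False blocks_lessThan[OF b, of e] t(2) by auto
          then have "nth_least t (q div b - 1) \<in> J" using nth_least_in[OF t(1)] t(3) by blast
          then show ?thesis using False by (simp add: J'_def lift_div[OF b])
        qed (simp add: J'_def lift_def)
        then show "r \<in> [J']\<^bsup>Suc e\<^esup>" using r by (auto simp: nsets_def)
      qed
    qed
  qed
  moreover have "g (pull (lift b \<phi>) x) = (\<lambda>t\<in>[J]\<^bsup>e\<^esup>. pull \<phi> (\<lambda>t. block_type enc b e t x) t)" for x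
    unfolding g_def pull_def
  proof (rule restrict_ext)
    fix t assume "t \<in> [J]\<^bsup>e\<^esup>"
    then have t: "finite t" "card t = e" "t \<subseteq> J" by (auto simp: nsets_def)
    have "strict_mono_on t \<phi>" using \<phi>(1) t(3) by (auto simp: strict_mono_on_def)
    from block_type_pull[OF b t(1,2) this, of enc x]
    show "block_type enc b e t (\<lambda>s. x (lift b \<phi> ` s)) = block_type enc b e (\<phi> ` t) x"
      by (simp add: pull_def)
  qed
  ultimately show "tv_within \<eta> (map_pmf (\<lambda>x. restrict x ([J]\<^bsup>e\<^esup>)) (map_pmf (\<lambda>x t. block_type enc b e t x) p))
     (map_pmf (\<lambda>x. restrict (pull \<phi> x) ([J]\<^bsup>e\<^esup>)) (map_pmf (\<lambda>x t. block_type enc b e t x) p))"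
    by (simp add: pmf.map_comp o_def g_def[abs_def])
qed

lemma card_below_nth:
  assumes "finite s" "i < card s"
  shows "card {j \<in> s. j < nth_least s i} = i"
proof -
  have "count_below s (nth_least s i) = i"
  proof (rule antisym)
    show "count_below s (nth_least s i) \<le> i"
      using nth_least_less_iff_count_below[OF assms, of "nth_least s i"] by simp
    show "i \<le> count_below s (nth_least s i)"
    proof (cases i)
      case (Suc i')
      then have "nth_least s i' < nth_least s i" using assms by (intro nth_least_less) auto
      then show ?thesis
        using nth_least_less_iff_count_below[OF assms(1), of i' "nth_least s i"] assms(2) Suc by simp
    qed simp
  qed
  then show ?thesis by (simp add: count_below_def)
qed

text \<open>The facets of the tuple \<open>nths \<sigma> s\<close> are the tuples that belong to the facets of \<open>s\<close>.\<close>

lemma nths_nths_delete: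
  assumes "finite s" "i < card s"
  shows "nths (nths \<sigma> s) (- {i}) = nths \<sigma> (s - {nth_least s i})"
proof -
  have "{j \<in> s. \<exists>c\<in>- {i}. card {j' \<in> s. j' < j} = c} = s - {nth_least s i}"
  proof -
    have "card {j' \<in> s. j' < j} = i \<longleftrightarrow> j = nth_least s i" if "j \<in> s" for j
    proof -
      have "j \<in> nth_least s ` {..<card s}" unfolding nth_least_image[OF assms(1)] by (rule that)
      then obtain a where a: "a < card s" "j = nth_least s a" by auto
      have "card {j' \<in> s. j' < j} = a" using card_below_nth[OF assms(1) a(1)] a(2) by simp
      moreover have "a = i \<longleftrightarrow> nth_least s a = nth_least s i"
        using strict_mono_on_imp_inj_on[OF strict_mono_on_nth_least[OF assms(1)]] a(1) assms(2)
        by (auto simp: inj_on_def)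
      ultimately show ?thesis using a(2) by simp
    qed
    then show ?thesis by auto
  qed
  then show ?thesis by (simp add: nths_nths)
qed

lemma inj_on_nths:
  assumes "distinct \<sigma>" "k \<le> length \<sigma>"
  shows "inj_on (nths \<sigma>) ([{..<k}]\<^bsup>d\<^esup>)"
proof (rule inj_onI)
  fix s s' assume s: "s \<in> [{..<k}]\<^bsup>d\<^esup>" "s' \<in> [{..<k}]\<^bsup>d\<^esup>" and eq: "nths \<sigma> s = nths \<sigma> s'"
  have "(!) \<sigma> ` r = set (nths \<sigma> r)" if "r \<in> [{..<k}]\<^bsup>d\<^esup>" for r
  proof -
    have "r = {i. i < length \<sigma> \<and> i \<in> r}" using that assms(2) by (auto simp: nsets_def)
    then show ?thesis unfolding set_nths by blast
  qed
  then have "(!) \<sigma> ` s = (!) \<sigma> ` s'" using s eq by metis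
  moreover have "inj_on ((!) \<sigma>) {..<k}" using assms by (intro inj_on_nth) auto
  ultimately show "s = s'"
    using s inj_on_image_eq_iff[of "(!) \<sigma>" "{..<k}" s s'] by (simp add: nsets_def)
qed

lemma nths_in_lists:
  assumes "length \<sigma> = k" "set \<sigma> \<subseteq> A" "s \<in> [{..<k}]\<^bsup>d\<^esup>"
  shows "set (nths \<sigma> s) \<subseteq> A" "length (nths \<sigma> s) = d"
proof -
  show "set (nths \<sigma> s) \<subseteq> A" using assms(2) set_nths_subset by fastforce
  have "{i. i < length \<sigma> \<and> i \<in> s} = s" using assms by (auto simp: nsets_def)
  then show "length (nths \<sigma> s) = d" using assms(3) by (simp add: length_nths nsets_def)
qed

section \<open>Extension to tuples in arbitrary order\<close>

definition threshold :: "nat \<Rightarrow> nat \<Rightarrow> nat \<Rightarrow> real \<Rightarrow> real" where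
  "threshold d m k \<epsilon> = (exp ^^ (2 * d)) (2 ^ 6 * real m ^ (7 * k ^ d) / \<epsilon>\<^sup>2)"

text \<open>The list \<open>\<sigma>\<close> may come in any order; this is what is gained over spreadability.\<close>

definition extends_to_tuples :: "real \<Rightarrow> nat \<Rightarrow> nat \<Rightarrow> nat \<Rightarrow> config pmf \<Rightarrow> (nat list \<Rightarrow> nat) pmf \<Rightarrow> bool" where
  "extends_to_tuples \<epsilon> N d k p q \<longleftrightarrow>
     (\<forall>\<sigma>. distinct \<sigma> \<and> length \<sigma> = k \<and> set \<sigma> \<subseteq> {..<N} \<longrightarrow>
        tv_within \<epsilon> (map_pmf (\<lambda>x. restrict x ([{..<k}]\<^bsup>d\<^esup>)) p)
          (map_pmf (\<lambda>Y. \<lambda>s\<in>[{..<k}]\<^bsup>d\<^esup>. Y (nths \<sigma> s)) q))"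

lemma exists_encoding:
  assumes "finite A" "card A \<le> M"
  obtains enc :: "'a \<Rightarrow> nat" where "inj_on enc A" "\<And>a. a \<in> A \<Longrightarrow> enc a < M"
proof -
  obtain h where "bij_betw h A {0..<card A}" using ex_bij_betw_finite_nat[OF assms(1)] by blast
  then have "inj_on h A" "\<And>a. a \<in> A \<Longrightarrow> h a < M"
    using assms(2) bij_betwE by (fastforce simp: bij_betw_def)+
  then show ?thesis by (rule that)
qed

text \<open>Choose the types of all \<open>e\<close>-tuples from \<open>q'\<close> and draw the value of each \<open>Suc e\<close>-tuple independently,
  with the law \<open>c\<close> at the past that the types of its facets determine. Along \<open>\<sigma>\<close> this imitates the redrawn
  array of \<open>resample_all\<close>, with the true types replaced by those from \<open>q'\<close>.\<close>

lemma extension_step: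
  fixes p :: "config pmf"
  assumes k: "Suc e \<le> k" and m: "2 \<le> m"
    and val: "\<And>x s. x \<in> set_pmf p \<Longrightarrow> x s < m"
    and spr: "spreadable_pmf \<eta> n (Suc e) p" and \<eta>: "0 \<le> \<eta>"
    and b: "0 < b" "b' = Suc k * b" "Suc (Suc e) * b' \<le> n"
    and c: "\<And>z. set_pmf (c z) \<subseteq> {..<m}"
    and stable: "\<And>h. score p m e b c \<le> score p m e b' h + \<delta>"
    and \<tau>: "0 < \<tau>" "(\<delta> + 2 * \<eta>) * real m \<le> \<tau>\<^sup>2"
    and enc: "inj_on enc (PiE ([{..<Suc e * b}]\<^bsup>Suc e\<^esup>) (\<lambda>_. {..<m}))"
    and q': "extends_to_tuples \<epsilon>' N e k (map_pmf (\<lambda>x t. block_type enc b e t x) p) q'"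
    and \<epsilon>: "\<eta> + (real (k ^ Suc e) * (\<tau> + 2 * \<eta>) + \<epsilon>') \<le> \<epsilon>"
  shows "\<exists>q. (\<forall>Y\<in>set_pmf q. \<forall>l. Y l < m) \<and> extends_to_tuples \<epsilon> N (Suc e) k p q"
proof -
  define All where "All = [{..<k}]\<^bsup>Suc e\<^esup>"
  have finAll: "finite All" unfolding All_def by (rule finite_imp_finite_nsets) simp
  have b'n: "b' \<le> n" using b(3) by simp
  \<comment> \<open>Recovers the past from the types of the facets; it is arbitrary on families of types that do not
    occur together.\<close>
  define rec where "rec f = past e b (SOME y. (\<forall>s. y s < m) \<and> types_below enc e b y = f)" for f
  have rec: "rec (types_below enc e b y) = past e b y" if y: "\<And>s. y s < m" for y
  proof -
    define y' where "y' = (SOME y'. (\<forall>s. y' s < m) \<and> types_below enc e b y' = types_below enc e b y)"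
    have "(\<forall>s. y' s < m) \<and> types_below enc e b y' = types_below enc e b y"
      unfolding y'_def by (rule someI[of _ y]) (use y in auto)
    then have "past e b y' = past e b y"
      by (intro types_below_determine_past[OF b(1) enc]) (use y in auto)
    then show ?thesis by (simp add: rec_def y'_def)
  qed
  define H where "H s z = c (rec (\<lambda>i\<in>{..<Suc e}. z (s - {nth_least s i})))" for s and z :: config
  have H: "set_pmf (H s z) \<subseteq> {..<m}" for s z unfolding H_def by (rule c)
  define Kern where "Kern z = map_pmf (\<lambda>y. restrict y All) (Pi_pmf All 0 (\<lambda>s. H s z))" for z
  have m0: "0 < m" using m by simp
  have resample: "tv_within (real (k choose Suc e) * (\<tau> + 2 * \<eta>)) (map_pmf (entries k e b) p)
      (bind_pmf (map_pmf (types enc k e b) p) Kern)"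
    unfolding Kern_def All_def
  proof (rule resample_all[where m = m and n = n and b' = b' and c = c and \<delta> = \<delta>])
    show "x s < m" if "x \<in> set_pmf p" for x s using val[OF that] .
    show "score p m e b c \<le> score p m e b' h + \<delta>" for h by (rule stable)
    show "H s (types enc k e b x) = c (past e b (pull (lift b (nth_least s)) x))"
      if "s \<in> [{..<k}]\<^bsup>Suc e\<^esup>" "\<And>r. x r < m" for s x
      unfolding H_def types_below_pull[OF b(1) that(1), symmetric]
      by (subst rec) (auto intro: pull_less that(2))
  qed (fact m0 spr b c H \<tau>)+
  define L where "L = {l :: nat list. set l \<subseteq> {..<N} \<and> length l = Suc e}"
  have finL: "finite L" unfolding L_def by (rule finite_lists_length_eq) simp
  define KL where "KL Y' l = c (rec (\<lambda>i\<in>{..<Suc e}. Y' (nths l (- {i}))))" for Y' :: "nat list \<Rightarrow> nat" and l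
  define q where "q = bind_pmf q' (\<lambda>Y'. Pi_pmf L 0 (KL Y'))"
  have "Y l < m" if Y: "Y \<in> set_pmf q" for Y l
  proof -
    obtain Y' where "Y \<in> set_pmf (Pi_pmf L 0 (KL Y'))" using Y by (auto simp: q_def)
    then have "Y \<in> PiE_dflt L 0 (\<lambda>l. set_pmf (KL Y' l))" by (simp add: set_Pi_pmf[OF finL] o_def)
    then have "Y l \<in> set_pmf (KL Y' l) \<or> Y l = 0" by (cases "l \<in> L") (auto simp: PiE_dflt_def)
    then show ?thesis using c m by (auto simp: KL_def)
  qed
  moreover have "extends_to_tuples \<epsilon> N (Suc e) k p q"
    unfolding extends_to_tuples_def
  proof (intro allI impI, elim conjE)
    fix \<sigma> :: "nat list" assume \<sigma>: "distinct \<sigma>" "length \<sigma> = k" "set \<sigma> \<subseteq> {..<N}"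
    have entries: "entries k e b x = restrict (pull (vertex b) x) ([{..<k}]\<^bsup>Suc e\<^esup>)" for x
      by (simp add: entries_def pull_def cong: restrict_cong)
    have "Suc k * b \<le> n" using b'n b(2) by simp
    moreover have "k \<le> Suc k * b" using b(1) by (cases b) auto
    ultimately have kn: "{..<k} \<subseteq> {..<n}" by auto
    have "vertex b i < n" if "i < k" for i
    proof -
      have "b * Suc i < b * Suc k" by (rule mult_less_mono2) (use that b(1) in auto)
      also have "\<dots> \<le> n" using \<open>Suc k * b \<le> n\<close> by (simp only: mult.commute)
      finally show ?thesis by (simp only: vertex_def)
    qed
    then have vn: "vertex b ` {..<k} \<subseteq> {..<n}" by auto
    have vm: "strict_mono_on {..<k} (vertex b)"
      using b(1) by (intro strict_mono_onI) (simp add: vertex_def)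
    \<comment> \<open>From the first \<open>k\<close> vertices to the distinguished vertices of the first \<open>k\<close> blocks.\<close>
    have first: "tv_within \<eta> (map_pmf (\<lambda>x. restrict x All) p) (map_pmf (entries k e b) p)"
      unfolding entries All_def
      by (rule spreadable_pmf_transport[OF spr kn vm vn]) (auto intro: restrict_ext)
    have "map_pmf (types enc k e b) p =
        map_pmf (\<lambda>z. restrict z ([{..<k}]\<^bsup>e\<^esup>)) (map_pmf (\<lambda>x t. block_type enc b e t x) p)"
      by (simp add: pmf.map_comp o_def types_def[abs_def])
    then have last: "tv_within \<epsilon>' (bind_pmf (map_pmf (types enc k e b) p) Kern)
        (bind_pmf (map_pmf (\<lambda>Y. \<lambda>t\<in>[{..<k}]\<^bsup>e\<^esup>. Y (nths \<sigma> t)) q') Kern)"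
      using q' \<sigma> by (intro tv_within_bind) (auto simp: extends_to_tuples_def)
    have target: "map_pmf (\<lambda>Y. \<lambda>s\<in>All. Y (nths \<sigma> s)) q =
        bind_pmf (map_pmf (\<lambda>Y. \<lambda>t\<in>[{..<k}]\<^bsup>e\<^esup>. Y (nths \<sigma> t)) q') Kern"
      unfolding q_def map_bind_pmf bind_map_pmf
    proof (rule bind_pmf_cong[OF refl])
      fix Y' :: "nat list \<Rightarrow> nat"
      have inj: "inj_on (nths \<sigma>) All" unfolding All_def by (rule inj_on_nths) (use \<sigma> in auto)
      have sub: "nths \<sigma> ` All \<subseteq> L" using nths_in_lists[OF \<sigma>(2,3)] by (auto simp: All_def L_def)
      have "KL Y' (nths \<sigma> s) = H s (\<lambda>t\<in>[{..<k}]\<^bsup>e\<^esup>. Y' (nths \<sigma> t))" if "s \<in> All" for s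
      proof -
        have s: "finite s" "card s = Suc e" "s \<subseteq> {..<k}" using that by (auto simp: All_def nsets_def)
        have "(\<lambda>i\<in>{..<Suc e}. Y' (nths (nths \<sigma> s) (- {i}))) =
            (\<lambda>i\<in>{..<Suc e}. (\<lambda>t\<in>[{..<k}]\<^bsup>e\<^esup>. Y' (nths \<sigma> t)) (s - {nth_least s i}))"
        proof (rule restrict_ext)
          fix i assume i: "i \<in> {..<Suc e}"
          then have "nth_least s i \<in> s" using s by (intro nth_least_in) auto
          then have "s - {nth_least s i} \<in> [{..<k}]\<^bsup>e\<^esup>" using s by (auto simp: nsets_def)
          then show "Y' (nths (nths \<sigma> s) (- {i})) = (\<lambda>t\<in>[{..<k}]\<^bsup>e\<^esup>. Y' (nths \<sigma> t)) (s - {nth_least s i})"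
            using nths_nths_delete[OF s(1), of i \<sigma>] i s(2) by simp
        qed
        then show ?thesis by (simp add: KL_def H_def)
      qed
      then show "map_pmf (\<lambda>Y. \<lambda>s\<in>All. Y (nths \<sigma> s)) (Pi_pmf L 0 (KL Y')) =
          Kern (\<lambda>t\<in>[{..<k}]\<^bsup>e\<^esup>. Y' (nths \<sigma> t))"
        unfolding Pi_pmf_restrict_reindex[OF finAll inj finL sub] Kern_def
        by (intro arg_cong[where f = "map_pmf _"] Pi_pmf_cong) auto
    qed
    have "tv_within (\<eta> + (real (k choose Suc e) * (\<tau> + 2 * \<eta>) + \<epsilon>'))
        (map_pmf (\<lambda>x. restrict x All) p) (map_pmf (\<lambda>Y. \<lambda>s\<in>All. Y (nths \<sigma> s)) q)"
      unfolding target by (rule tv_within_trans[OF first tv_within_trans[OF resample last]])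
    moreover have "\<eta> + (real (k choose Suc e) * (\<tau> + 2 * \<eta>) + \<epsilon>') \<le> \<epsilon>"
    proof -
      have "real (k choose Suc e) \<le> real (k ^ Suc e)"
        unfolding of_nat_le_iff by (rule binomial_le_pow[OF k])
      then have "real (k choose Suc e) * (\<tau> + 2 * \<eta>) \<le> real (k ^ Suc e) * (\<tau> + 2 * \<eta>)"
        using \<tau>(1) \<eta> by (intro mult_right_mono) auto
      then show ?thesis using \<epsilon> by linarith
    qed
    ultimately show "tv_within \<epsilon> (map_pmf (\<lambda>x. restrict x ([{..<k}]\<^bsup>Suc e\<^esup>)) p)
          (map_pmf (\<lambda>Y. \<lambda>s\<in>[{..<k}]\<^bsup>Suc e\<^esup>. Y (nths \<sigma> s)) q)"
      unfolding All_def by (rule tv_within_mono)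
  qed
  ultimately show ?thesis by blast
qed

text \<open>The error \<open>\<epsilon>\<close> is split into \<open>\<epsilon> / 2\<close> for the types, \<open>\<epsilon> / 4\<close> for redrawing at most \<open>x = k ^ Suc e\<close>
  entries with error \<open>\<tau>\<close> each, and the rest for the defect \<open>\<eta>\<close> of spreadability. Redrawing with error
  \<open>\<tau>\<close> requires a step in which the loss drops by at most about \<open>\<tau>\<^sup>2 / m\<close>, which explains the
  number \<open>J\<close> of steps. The longest possible block length is \<open>B\<close>, and \<open>m'\<close> bounds the number of types.\<close>

theorem extension_to_tuples:
  fixes p :: "config pmf"
  assumes "d \<le> k" "1 \<le> k" "2 \<le> m" "0 < \<epsilon>" "\<epsilon> \<le> 1"
    and "\<And>x s. x \<in> set_pmf p \<Longrightarrow> x s < m"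
    and "spreadable_pmf \<eta> n d p"
    and "threshold d m k \<epsilon> \<le> real n" "0 \<le> \<eta>" "\<eta> * threshold d m k \<epsilon> \<le> 1"
  shows "\<exists>q. (\<forall>Y\<in>set_pmf q. \<forall>l. Y l < m) \<and> extends_to_tuples \<epsilon> N d k p q"
  using assms
proof (induction d arbitrary: m p \<epsilon> n \<eta>)
  case 0
  have "extends_to_tuples \<epsilon> N 0 k p (map_pmf (\<lambda>x l. x {}) p)"
    unfolding extends_to_tuples_def
  proof (intro allI impI)
    fix \<sigma> :: "nat list"
    have "map_pmf (\<lambda>Y. \<lambda>s\<in>[{..<k}]\<^bsup>0\<^esup>. Y (nths \<sigma> s)) (map_pmf (\<lambda>x l. x {}) p) =
        map_pmf (\<lambda>x. restrict x ([{..<k}]\<^bsup>0\<^esup>)) p"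
      unfolding pmf.map_comp o_def by (intro map_pmf_cong[OF refl] restrict_ext) auto
    then show "tv_within \<epsilon> (map_pmf (\<lambda>x. restrict x ([{..<k}]\<^bsup>0\<^esup>)) p)
          (map_pmf (\<lambda>Y. \<lambda>s\<in>[{..<k}]\<^bsup>0\<^esup>. Y (nths \<sigma> s)) (map_pmf (\<lambda>x l. x {}) p))"
      using \<open>0 < \<epsilon>\<close> by (simp only:) (rule tv_within_mono[OF tv_within_refl], simp)
  qed
  then show ?case using "0.prems"(6) by (intro exI[of _ "map_pmf (\<lambda>x l. x {}) p"]) auto
next
  case (Suc e)
  note m = \<open>2 \<le> m\<close> and k = \<open>Suc e \<le> k\<close> and \<epsilon> = \<open>0 < \<epsilon>\<close> \<open>\<epsilon> \<le> 1\<close> and \<eta>0 = \<open>0 \<le> \<eta>\<close>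
  define x where "x = real k ^ Suc e"
  define \<tau> where "\<tau> = \<epsilon> / (4 * x)"
  define J where "J = nat \<lceil>64 * real m * x\<^sup>2 / \<epsilon>\<^sup>2\<rceil>"
  define B where "B = Suc k ^ J"
  define m' where "m' = m ^ ((Suc e * B) ^ Suc e)"
  define a where "a = 2 ^ 6 * real m ^ (7 * k ^ Suc e) / \<epsilon>\<^sup>2"
  define a' where "a' = 2 ^ 6 * real m' ^ (7 * k ^ e) / (\<epsilon> / 2)\<^sup>2"
  define C where "C = threshold (Suc e) m k \<epsilon>"
  define C' where "C' = threshold e m' k (\<epsilon> / 2)"
  have x1: "1 \<le> x" unfolding x_def using \<open>1 \<le> k\<close> by (intro one_le_power) auto
  have \<tau>: "0 < \<tau>" using \<epsilon> x1 by (simp add: \<tau>_def)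
  have "1 \<le> real m * x\<^sup>2 / \<epsilon>\<^sup>2"
  proof -
    have "1 \<le> real m * x\<^sup>2" using m x1 by (intro mult_ge1_I) (auto simp: one_le_power)
    moreover have "\<epsilon>\<^sup>2 \<le> 1" using \<epsilon> by (simp add: power_le_one)
    ultimately show ?thesis using \<epsilon> by (simp add: le_divide_eq)
  qed
  then have Jr: "64 * real m * x\<^sup>2 / \<epsilon>\<^sup>2 \<le> real J" "real J \<le> 64 * real m * x\<^sup>2 / \<epsilon>\<^sup>2 + 1" "1 \<le> J"
    unfolding J_def by (linarith | simp add: field_simps le_nat_iff)+
  have B1: "1 \<le> B" by (simp add: B_def)
  have gap: "(a' + 2) * real B \<le> exp (exp a)"
    unfolding a_def a'_def
    by (rule induction_bound[OF m k \<epsilon> Jr(3) Jr(2)[unfolded x_def] B_def m'_def])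
  have a'0: "0 \<le> a'" by (simp add: a'_def)
  have C_def': "C = (exp ^^ (2 * e)) (exp (exp a))"
    by (simp add: C_def threshold_def a_def funpow_swap1)
  have C'_def': "C' = (exp ^^ (2 * e)) a'" by (simp add: C'_def threshold_def a'_def)
  have CC': "(C' + 2) * real B \<le> C"
    unfolding C_def' C'_def' by (rule exp_iter_gap[OF a'0 _ gap]) (use B1 in simp)
  have C'a': "a' \<le> C'" unfolding C'_def' by (rule exp_iter_ge)
  have m'2: "2 \<le> m'"
  proof -
    have "m ^ 1 \<le> m'" unfolding m'_def using m B1 by (intro power_increasing) auto
    then show ?thesis using m by simp
  qed
  have e_a': "real e \<le> a'"
  proof -
    have "Suc e * 1 \<le> Suc e * B" using B1 by (rule mult_le_mono2)
    also have "\<dots> \<le> (Suc e * B) ^ Suc e"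
      by (rule self_le_power) (use B1 in \<open>auto simp: Suc_le_eq\<close>)
    also have "\<dots> < 2 ^ ((Suc e * B) ^ Suc e)" by (rule less_exp)
    also have "\<dots> \<le> m'" unfolding m'_def using m by (intro power_mono) auto
    also have "m' \<le> m' ^ (7 * k ^ e)" using m'2 \<open>1 \<le> k\<close> by (intro self_le_power) auto
    finally have "e \<le> m' ^ (7 * k ^ e)" by simp
    then have "real e \<le> real (m' ^ (7 * k ^ e))" by (simp only: of_nat_le_iff)
    also have "\<dots> \<le> 2 ^ 8 * real (m' ^ (7 * k ^ e))" by simp
    also have "\<dots> \<le> a'"
    proof -
      have "\<epsilon>\<^sup>2 \<le> 1" using \<epsilon> by (simp add: power_le_one)
      then show ?thesis using \<epsilon> by (simp add: a'_def power_divide le_divide_eq mult_left_le)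
    qed
    finally show ?thesis .
  qed
  have C'0: "0 \<le> C'" using a'0 C'a' by simp
  have B_le: "(C' + 2) * real b \<le> (C' + 2) * real B" if "b \<le> B" for b
    using that C'0 by (intro mult_left_mono) auto
  have nC: "C \<le> real n" and \<eta>C: "\<eta> * C \<le> 1" using Suc.prems by (auto simp: C_def)
  have "J < 2 ^ J" by (rule less_exp)
  also have "(2::nat) ^ J \<le> B" unfolding B_def using \<open>1 \<le> k\<close> by (intro power_mono) auto
  finally have JB: "real J \<le> real B" by simp
  have BC: "2 * real B \<le> C"
  proof -
    have "2 * real B \<le> (C' + 2) * real B" using C'0 by (intro mult_right_mono) auto
    then show ?thesis using CC' by linarith
  qed
  have C0: "0 < C" using BC B1 by simp
  have \<eta>J: "2 * \<eta> \<le> 1 / real J"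
  proof -
    have "\<eta> * (2 * real J) \<le> \<eta> * C" using JB BC \<eta>0 by (intro mult_left_mono) auto
    then show ?thesis using \<eta>C Jr(3) by (simp add: field_simps)
  qed
  have Jinv: "1 / real J \<le> \<epsilon>\<^sup>2 / (64 * real m * x\<^sup>2)"
  proof -
    have "0 < 64 * real m * x\<^sup>2" using m x1 by simp
    moreover have "0 < \<epsilon>\<^sup>2" using \<epsilon> by simp
    ultimately show ?thesis using Jr(1,3) by (simp add: field_simps)
  qed
  obtain j c where jc: "j < J" "\<And>z. set_pmf (c z) \<subseteq> {..<m}"
    "\<And>h. score p m e (Suc k ^ j) c \<le> score p m e (Suc k ^ Suc j) h + 2 / real J"
  proof (rule stable_block_length[of m p J e "Suc k"])
    show "0 < m" "0 < J" using m Jr(3) by auto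
    show "x s < m" if "x \<in> set_pmf p" for x s using Suc.prems(6)[OF that] .
  qed (rule that)
  define b where "b = Suc k ^ j"
  define b' where "b' = Suc k * b"
  have b0: "0 < b" by (simp add: b_def)
  have bB: "b \<le> B" "b' \<le> B"
    unfolding b_def b'_def B_def power_Suc[symmetric] using jc(1) by (intro power_increasing; simp)+
  have b'n: "Suc (Suc e) * b' \<le> n"
  proof -
    have "real (Suc (Suc e) * b') \<le> (C' + 2) * real B"
      unfolding of_nat_mult using e_a' C'a' bB by (intro mult_mono) auto
    also have "\<dots> \<le> real n" using CC' nC by simp
    finally show ?thesis by (simp only: of_nat_le_iff)
  qed
  define n' where "n' = nat \<lceil>C'\<rceil>"
  have n': "C' \<le> real n'" "real n' \<le> C' + 1" using C'0 unfolding n'_def by linarith+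
  have n'n: "Suc n' * b \<le> n"
  proof -
    have "real (Suc n' * b) \<le> (C' + 2) * real b"
      unfolding of_nat_mult using n' by (intro mult_right_mono) auto
    also have "\<dots> \<le> real n" using B_le[OF bB(1)] CC' nC by linarith
    finally show ?thesis by (simp only: of_nat_le_iff)
  qed
  define A where "A = PiE ([{..<Suc e * b}]\<^bsup>Suc e\<^esup>) (\<lambda>_. {..<m})"
  have fin: "finite ([{..<Suc e * b}]\<^bsup>Suc e\<^esup>)" by (rule finite_imp_finite_nsets) simp
  have "card A = m ^ ((Suc e * b) choose Suc e)" unfolding A_def card_PiE[OF fin] by simp
  also have "\<dots> \<le> m'"
  proof -
    have "(Suc e * b) choose Suc e \<le> (Suc e * b) ^ Suc e"
      using b0 mult_le_mono2[of 1 b "Suc e"] by (intro binomial_le_pow) simp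
    also have "\<dots> \<le> (Suc e * B) ^ Suc e" using bB by (intro power_mono mult_le_mono2) auto
    finally show ?thesis unfolding m'_def using m by (intro power_increasing) auto
  qed
  finally obtain enc where enc: "inj_on enc A" "\<And>f. f \<in> A \<Longrightarrow> enc f < m'"
    using exists_encoding[of A m'] fin unfolding A_def by (metis finite_PiE finite_lessThan)
  define p' where "p' = map_pmf (\<lambda>x t. block_type enc b e t x) p"
  have "\<exists>q'. (\<forall>Y\<in>set_pmf q'. \<forall>l. Y l < m') \<and> extends_to_tuples (\<epsilon> / 2) N e k p' q'"
  proof (rule Suc.IH[of m' "\<epsilon> / 2" p' \<eta> n'])
    show "spreadable_pmf \<eta> n' e p'"
      unfolding p'_def by (rule spreadable_pmf_block_types[OF _ b0 n'n]) (rule Suc.prems)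
    show "z s < m'" if z: "z \<in> set_pmf p'" for z s
    proof -
      obtain x where x: "x \<in> set_pmf p" "z = (\<lambda>t. block_type enc b e t x)"
        using z by (auto simp: p'_def)
      have "restrict (pull (lift b (nth_least s)) x) ([{..<Suc e * b}]\<^bsup>Suc e\<^esup>) \<in> A"
        using Suc.prems(6)[OF x(1)] by (auto simp: A_def pull_def)
      then show ?thesis using enc(2) x(2) by (simp add: block_type_def)
    qed
    show "threshold e m' k (\<epsilon> / 2) \<le> real n'" using n'(1) by (simp add: C'_def)
    have "C' \<le> C"
    proof -
      have "C' * 1 \<le> (C' + 2) * real B" using C'0 B1 by (intro mult_mono) auto
      then show ?thesis using CC' by linarith
    qed
    then have "\<eta> * C' \<le> \<eta> * C" using \<eta>0 by (intro mult_left_mono) auto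
    then show "\<eta> * threshold e m' k (\<epsilon> / 2) \<le> 1" using \<eta>C by (simp add: C'_def)
  qed (use k \<open>1 \<le> k\<close> m'2 \<epsilon> \<eta>0 in auto)
  then obtain q' where q': "extends_to_tuples (\<epsilon> / 2) N e k p' q'" by blast
  show ?case
  proof (rule extension_step[where b = b and b' = b' and c = c and \<delta> = "2 / real J" and \<tau> = \<tau>
        and enc = enc and q' = q' and \<epsilon>' = "\<epsilon> / 2" and \<eta> = \<eta> and n = n])
    show "x s < m" if "x \<in> set_pmf p" for x s using Suc.prems(6)[OF that] .
    show "spreadable_pmf \<eta> n (Suc e) p" by (rule Suc.prems)
    show "score p m e b c \<le> score p m e b' h + 2 / real J" for h
      using jc(3)[of h] by (simp add: b_def b'_def)
    have "(2 / real J + 2 * \<eta>) * real m \<le> 3 * (1 / real J) * real m"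
      using \<eta>J by (intro mult_right_mono) auto
    also have "\<dots> \<le> 3 * (\<epsilon>\<^sup>2 / (64 * real m * x\<^sup>2)) * real m"
      using Jinv by (intro mult_right_mono mult_left_mono) auto
    also have "\<dots> \<le> \<tau>\<^sup>2"
      using m x1 by (simp add: \<tau>_def power_divide power_mult_distrib field_simps)
    finally show "(2 / real J + 2 * \<eta>) * real m \<le> \<tau>\<^sup>2" .
    show "inj_on enc (PiE ([{..<Suc e * b}]\<^bsup>Suc e\<^esup>) (\<lambda>_. {..<m}))" using enc(1) by (simp add: A_def)
    show "extends_to_tuples (\<epsilon> / 2) N e k (map_pmf (\<lambda>x t. block_type enc b e t x) p) q'"
      using q' by (simp add: p'_def)
    have "2 * \<eta> \<le> \<epsilon> / (6 * x)"
    proof -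
      have "\<epsilon>\<^sup>2 / (64 * real m * x\<^sup>2) \<le> \<epsilon> / (6 * x)"
      proof -
        have "1 * 3 \<le> x * (real m * 32)" using x1 m by (intro mult_mono) auto
        then have "\<epsilon> * 3 \<le> x * (real m * 32)" using \<epsilon> by linarith
        then have "\<epsilon> * (\<epsilon> * 3) \<le> \<epsilon> * (x * (real m * 32))"
          using \<epsilon> by (intro mult_left_mono) auto
        then show ?thesis using m x1 by (simp add: field_simps power2_eq_square)
      qed
      then show ?thesis using \<eta>J Jinv by linarith
    qed
    then have "x * (2 * \<eta>) \<le> x * (\<epsilon> / (6 * x))" using x1 by (intro mult_left_mono) auto
    then have x\<eta>: "x * (2 * \<eta>) \<le> \<epsilon> / 6" using x1 by simp
    moreover have "1 * (2 * \<eta>) \<le> x * (2 * \<eta>)" using x1 \<eta>0 by (intro mult_right_mono) auto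
    moreover have "x * \<tau> = \<epsilon> / 4" using x1 by (simp add: \<tau>_def)
    moreover have "real (k ^ Suc e) = x" by (simp add: x_def)
    ultimately show "\<eta> + (real (k ^ Suc e) * (\<tau> + 2 * \<eta>) + \<epsilon> / 2) \<le> \<epsilon>"
      using \<epsilon> by (simp only: distrib_left)
  qed (fact k m \<eta>0 b0 b'_def b'n jc(2) \<tau>)+
qed

section \<open>Sampling with uniform random variables\<close>

lemma pmf_of_finite_random_variable:
  assumes "prob_space M" "G \<in> measurable M (count_space R)" "finite R"
  obtains p where "set_pmf p \<subseteq> R"
    "\<And>A. measure_pmf.prob p A = measure M {w \<in> space M. G w \<in> A}"
proof -
  interpret prob_space M by fact
  define D where "D = distr M (count_space UNIV) G"
  have G: "G \<in> measurable M (count_space UNIV)"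
    using measurable_comp[OF assms(2) measurable_count_space[of id]] by simp
  interpret D: prob_space D unfolding D_def by (rule prob_space_distr[OF G])
  have D: "measure D A = measure M {w \<in> space M. G w \<in> A}" for A
    unfolding D_def by (subst measure_distr[OF G]) (auto intro: arg_cong[where f = "measure M"])
  have "{w \<in> space M. G w \<in> R} = space M" using measurable_space[OF assms(2)] by auto
  then have "measure D R = 1" unfolding D by (simp add: prob_space)
  then have inR: "AE x in D. x \<in> R" by (rule D.AE_prob_1)
  have "AE x in D. \<forall>r\<in>R. x = r \<longrightarrow> measure D {x} \<noteq> 0"
  proof (rule AE_finite_allI[OF assms(3)])
    fix r
    show "AE x in D. x = r \<longrightarrow> measure D {x} \<noteq> 0"
    proof (cases "measure D {r} = 0")
      case True
      then have "{r} \<in> null_sets D"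
        by (intro null_setsI) (auto simp: D.emeasure_eq_measure, simp add: D_def)
      from AE_not_in[OF this] show ?thesis by eventually_elim auto
    qed auto
  qed
  with inR have ae: "AE x in D. measure D {x} \<noteq> 0" by eventually_elim auto
  define p where "p = Abs_pmf D"
  have p: "measure_pmf p = D"
  proof -
    have "sets D = UNIV" by (simp add: D_def)
    then show ?thesis
      unfolding p_def by (intro Abs_pmf_inverse) (simp add: D.prob_space_axioms ae)
  qed
  have "set_pmf p \<subseteq> R"
  proof
    fix x assume "x \<in> set_pmf p"
    then have "measure D {x} \<noteq> 0" by (simp add: set_pmf.rep_eq p)
    moreover have "measure D {x} = 0" if "x \<notin> R"
    proof -
      have "{w \<in> space M. G w \<in> {x}} = {}" using measurable_space[OF assms(2)] that by auto
      then show ?thesis unfolding D by (simp only: measure_empty)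
    qed
    ultimately show "x \<in> R" by blast
  qed
  then show ?thesis by (rule that) (simp add: p D)
qed

text \<open>Enumerate the support and compose with the quantile function.\<close>

lemma exists_sampler:
  fixes q :: "'a pmf"
  obtains g where "g \<in> measurable (restrict_space borel {0..1 :: real}) (count_space (set_pmf q))"
    "\<And>A. measure unif01 {x \<in> {0..1}. g x \<in> A} = measure_pmf.prob q A"
proof -
  define S where "S = set_pmf q"
  have S: "countable S" "S \<noteq> {}" by (auto simp: S_def set_pmf_not_empty)
  define c where "c y = real (to_nat_on S y)" for y
  define N where "N = distr (measure_pmf q) borel c"
  interpret N: real_distribution N
    unfolding N_def by (rule prob_space.real_distribution_distr[OF prob_space_measure_pmf]) simp
  interpret N: cdf_distribution N ..
  define dec where "dec v = from_nat_into S (nat \<lfloor>v\<rfloor>)" for v :: real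
  have dec: "dec \<in> measurable borel (count_space S)"
  proof -
    have "(\<lambda>i. from_nat_into S (nat i)) \<in> measurable (count_space UNIV) (count_space S)"
      using from_nat_into[OF S(2)] by simp
    from measurable_compose[OF measurable_real_floor this] show ?thesis
      unfolding dec_def[abs_def] .
  qed
  define I where "I x = indicator {0<..<1} x *\<^sub>R N.I x" for x
  have I: "I \<in> borel_measurable borel"
    unfolding I_def[abs_def]
    by (subst borel_measurable_restrict_space_iff[symmetric]) (auto intro: N.measurable_CI)
  define g where "g x = dec (I x)" for x
  have gm: "g \<in> measurable borel (count_space S)"
    unfolding g_def[abs_def] by (rule measurable_compose[OF I dec])
  have g01: "g \<in> measurable (restrict_space borel {0..1}) (count_space (set_pmf q))"
    using measurable_restrict_space1[OF gm] by (simp add: S_def)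
  have "measure unif01 {x \<in> {0..1}. g x \<in> A} = measure_pmf.prob q A" for A
  proof -
    have gA: "g -` (A \<inter> S) \<in> sets borel" using measurable_sets[OF gm, of "A \<inter> S"] by simp
    have gS: "g x \<in> S" for x using measurable_space[OF gm, of x] by simp
    have decA: "dec -` (A \<inter> S) \<in> sets borel" using measurable_sets[OF dec, of "A \<inter> S"] by simp
    have decS: "dec x \<in> S" for x using measurable_space[OF dec, of x] by simp
    have "measure unif01 {x \<in> {0..1}. g x \<in> A} = measure lborel {x \<in> {0..1}. g x \<in> A}"
      unfolding unif01_def by (rule measure_restrict_space) auto
    also have "\<dots> = measure lborel {x \<in> {0<..<1}. dec (N.I x) \<in> A}"
    proof (rule measure_eq_AE)
      have "AE x in lborel. x \<noteq> (0 :: real)" "AE x in lborel. x \<noteq> (1 :: real)"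
        by (rule AE_lborel_singleton)+
      then show "AE x in lborel. x \<in> {x \<in> {0..1}. g x \<in> A} \<longleftrightarrow> x \<in> {x \<in> {0<..<1}. dec (N.I x) \<in> A}"
        by eventually_elim (auto simp: g_def I_def)
      have "{x \<in> {0..1}. g x \<in> A} = {0..1} \<inter> g -` (A \<inter> S)" using gS by auto
      then show "{x \<in> {0..1}. g x \<in> A} \<in> sets lborel" using gA by simp
      have "{x \<in> {0<..<1}. dec (N.I x) \<in> A} = {0<..<1} \<inter> g -` (A \<inter> S)"
        using decS by (auto simp: g_def I_def)
      then show "{x \<in> {0<..<1}. dec (N.I x) \<in> A} \<in> sets lborel" using gA by simp
    qed
    also have "\<dots> = measure (restrict_space lborel {0<..<1}) {x \<in> {0<..<1}. dec (N.I x) \<in> A}"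
      by (rule measure_restrict_space[symmetric]) auto
    also have "\<dots> = measure (distr (restrict_space lborel {0<..<1}) borel N.I) (dec -` (A \<inter> S))"
    proof -
      have m: "N.I \<in> measurable (restrict_space lborel {0<..<1}) borel"
        using N.measurable_CI by (simp add: measurable_def sets_restrict_space space_restrict_space)
      have "N.I -` (dec -` (A \<inter> S)) \<inter> space (restrict_space lborel {0<..<1}) =
          {x \<in> {0<..<1}. dec (N.I x) \<in> A}"
        using decS by (auto simp: space_restrict_space)
      then show ?thesis unfolding measure_distr[OF m decA] by simp
    qed
    also have "\<dots> = measure N (dec -` (A \<inter> S))" unfolding N.distr_I_eq_M ..
    also have "\<dots> = measure_pmf.prob q (c -` (dec -` (A \<inter> S)))"
      unfolding N_def by (subst measure_distr[OF _ decA]) auto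
    also have "\<dots> = measure_pmf.prob q A"
    proof (rule measure_pmf.finite_measure_eq_AE)
      show "AE y in measure_pmf q. y \<in> c -` (dec -` (A \<inter> S)) \<longleftrightarrow> y \<in> A"
        using from_nat_into_to_nat_on[OF S(1)] by (auto simp: AE_measure_pmf_iff c_def dec_def S_def)
    qed auto
    finally show ?thesis .
  qed
  then show ?thesis using that[OF g01] by blast
qed

definition cell :: "nat \<Rightarrow> real \<Rightarrow> nat" where
  "cell N x = nat \<lfloor>real N * x\<rfloor>"

lemma cell_measurable: "cell N \<in> measurable borel (count_space UNIV)"
  unfolding cell_def[abs_def] by measurable

lemma cell_prob:
  assumes "c < N"
  shows "measure unif01 {x \<in> {0..1}. cell N x = c} = 1 / real N"
proof -
  have N: "0 < real N" using assms by simp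
  have "{x \<in> {0..1}. cell N x = c} = {real c / real N..<(real c + 1) / real N}"
  proof (intro set_eqI iffI)
    fix x assume "x \<in> {x \<in> {0..1}. cell N x = c}"
    then have x: "0 \<le> x" "nat \<lfloor>real N * x\<rfloor> = c" by (auto simp: cell_def)
    then have "\<lfloor>real N * x\<rfloor> = int c" using N by (simp add: nat_eq_iff)
    then have "real c \<le> real N * x" "real N * x < real c + 1" by linarith+
    then show "x \<in> {real c / real N..<(real c + 1) / real N}" using N by (simp add: field_simps)
  next
    fix x assume "x \<in> {real c / real N..<(real c + 1) / real N}"
    then have x: "real c \<le> real N * x" "real N * x < real c + 1" using N by (simp_all add: field_simps)
    then have "\<lfloor>real N * x\<rfloor> = int c" by linarith
    moreover have "0 \<le> real N * x" using x(1) by linarith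
    then have "0 \<le> x" using N by (simp add: zero_le_mult_iff)
    moreover have "real N * x \<le> real N * 1" using x(2) assms by linarith
    then have "x \<le> 1" using N by (simp only: mult_le_cancel_left_pos)
    ultimately show "x \<in> {x \<in> {0..1}. cell N x = c}" by (simp add: cell_def)
  qed
  then have "measure unif01 {x \<in> {0..1}. cell N x = c} =
      measure lborel {real c / real N..<(real c + 1) / real N}"
    unfolding unif01_def by (subst measure_restrict_space) auto
  also have "\<dots> = 1 / real N" using N by (subst measure_lborel_Ico) (auto simp: field_simps)
  finally show ?thesis .
qed

lemma space_unif01: "space unif01 = {0..1}"
  by (simp add: unif01_def space_restrict_space)

lemma sets_unif01: "sets unif01 = sets (restrict_space borel {0..1})"
  by (simp add: unif01_def sets_restrict_space)

lemma space_iid_space: "u \<in> space iid_space \<longleftrightarrow> (\<forall>i. u i \<in> {0..1})"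
  by (auto simp: iid_space_def space_PiM space_unif01 PiE_def Pi_def)

lemma iid_cylinder_prob:
  assumes A: "A \<in> sets unif01" and L: "finite L" "0 \<notin> L" and c: "\<And>i. i \<in> L \<Longrightarrow> c i < N"
  shows "{u \<in> space iid_space. u 0 \<in> A \<and> (\<forall>i\<in>L. cell N (u i) = c i)} \<in> sets iid_space"
    and "measure iid_space {u \<in> space iid_space. u 0 \<in> A \<and> (\<forall>i\<in>L. cell N (u i) = c i)} =
      measure unif01 A * (1 / real N) ^ card L"
proof -
  interpret prob_space iid_space by (rule prob_space_iid_space)
  define B where "B i = (if i = 0 then A else {x \<in> {0..1}. cell N x = c i})" for i
  have coord: "(\<lambda>u. u i) \<in> measurable iid_space unif01" for i
    unfolding iid_space_def by measurable
  have B: "B i \<in> sets unif01" for i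
  proof (cases "i = 0")
    case False
    have "cell N -` {c i} \<inter> {0..1} \<in> sets (restrict_space borel {0..1})"
      using measurable_sets[OF cell_measurable, of "{c i}" N]
      by (auto simp: sets_restrict_space)
    moreover have "B i = cell N -` {c i} \<inter> {0..1}" using False by (auto simp: B_def)
    ultimately show ?thesis by (simp add: sets_unif01)
  qed (simp add: B_def A)
  have prob_B: "prob ((\<lambda>u. u i) -` B i \<inter> space iid_space) = measure unif01 (B i)" for i
    using measure_distr[OF coord B, of i i] by (simp add: iid_space_uniform)
  have B0: "B 0 = A" by (simp add: B_def)
  have BL: "B i = {x \<in> {0..1}. cell N x = c i}" if "i \<in> L" for i
    using L(2) that by (auto simp: B_def)
  have eq: "{u \<in> space iid_space. u 0 \<in> A \<and> (\<forall>i\<in>L. cell N (u i) = c i)} =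
      (\<Inter>i\<in>insert 0 L. (\<lambda>u. u i) -` B i \<inter> space iid_space)"
    by (auto simp: B0 BL space_iid_space)
  show "{u \<in> space iid_space. u 0 \<in> A \<and> (\<forall>i\<in>L. cell N (u i) = c i)} \<in> sets iid_space"
    unfolding eq using L(1) by (intro sets.finite_INT measurable_sets[OF coord B]) auto
  have "prob (\<Inter>i\<in>insert 0 L. (\<lambda>u. u i) -` B i \<inter> space iid_space) =
      (\<Prod>i\<in>insert 0 L. prob ((\<lambda>u. u i) -` B i \<inter> space iid_space))"
    by (rule indep_varsD[OF iid_space_indep]) (use L B in auto)
  also have "\<dots> = measure unif01 (B 0) * (\<Prod>i\<in>L. measure unif01 (B i))"
    unfolding prob_B using L by simp
  also have "(\<Prod>i\<in>L. measure unif01 (B i)) = (\<Prod>i\<in>L. 1 / real N)"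
    by (rule prod.cong[OF refl]) (simp only: BL cell_prob[OF c])
  finally show "measure iid_space {u \<in> space iid_space. u 0 \<in> A \<and> (\<forall>i\<in>L. cell N (u i) = c i)} =
      measure unif01 A * (1 / real N) ^ card L"
    unfolding eq by (simp add: B_def)
qed

text \<open>There are at least \<open>(N - k) ^ k\<close> distinct lists, and Bernoulli's inequality bounds their share.\<close>

lemma card_distinct_lists_ge:
  assumes "k < N"
  shows "(1 - real k ^ 2 / real N) * real N ^ k \<le>
    real (card {\<sigma>. length \<sigma> = k \<and> distinct \<sigma> \<and> set \<sigma> \<subseteq> {..<N}})"
proof -
  have N: "0 < real N" using assms by simp
  have "(1 - real k ^ 2 / real N) = 1 + real k * (- (real k / real N))"
    by (simp add: power2_eq_square)
  also have "\<dots> \<le> (1 + - (real k / real N)) ^ k"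
    by (rule Bernoulli_inequality) (use assms in \<open>simp add: field_simps\<close>)
  finally have "(1 - real k ^ 2 / real N) * real N ^ k \<le> (1 + - (real k / real N)) ^ k * real N ^ k"
    by (rule mult_right_mono) simp
  also have "\<dots> = real ((N - k) ^ k)"
    using N assms by (simp add: power_mult_distrib[symmetric] field_simps of_nat_diff)
  also have "(N - k) ^ k \<le> \<Prod>{N - k + 1..N}"
  proof -
    have "(\<Prod>i\<in>{N - k + 1..N}. N - k) \<le> (\<Prod>i\<in>{N - k + 1..N}. i)"
      by (rule prod_mono) auto
    then show ?thesis using assms by simp
  qed
  also have "\<Prod>{N - k + 1..N} = card {\<sigma>. length \<sigma> = k \<and> distinct \<sigma> \<and> set \<sigma> \<subseteq> {..<N}}"
    using card_lists_distinct_length_eq[of "{..<N}" k] assms by simp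
  finally show ?thesis by simp
qed

text \<open>The cells are independent, uniform and independent of \<open>u 0\<close>. Sum over the distinct lists of cells; the
  others have total probability at most \<open>k\<^sup>2 / N\<close>.\<close>

lemma sampled_prob_ge:
  fixes E :: "nat list \<Rightarrow> (nat list \<Rightarrow> nat) set"
  assumes g: "g \<in> measurable (restrict_space borel {0..1}) (count_space (set_pmf q))"
    and gq: "\<And>A. measure unif01 {x \<in> {0..1}. g x \<in> A} = measure_pmf.prob q A"
    and L: "finite L" "0 \<notin> L" "card L = k" and N: "k < N"
    and t: "t \<le> 1" "\<And>\<sigma>. distinct \<sigma> \<Longrightarrow> length \<sigma> = k \<Longrightarrow> set \<sigma> \<subseteq> {..<N} \<Longrightarrow> t \<le> measure_pmf.prob q (E \<sigma>)"
    and U: "{u \<in> space iid_space. g (u 0) \<in> E (map (\<lambda>i. cell N (u i)) (sorted_list_of_set L))} \<in> sets iid_space"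
  shows "t - real k ^ 2 / real N \<le>
    measure iid_space {u \<in> space iid_space. g (u 0) \<in> E (map (\<lambda>i. cell N (u i)) (sorted_list_of_set L))}"
    (is "_ \<le> measure iid_space ?U")
proof (cases "t \<le> 0")
  case True
  have "0 \<le> real k ^ 2 / real N" by (rule divide_nonneg_nonneg) auto
  then have "t - real k ^ 2 / real N \<le> 0" using True by linarith
  then show ?thesis using measure_nonneg[of iid_space ?U] by linarith
next
  case False
  interpret prob_space iid_space by (rule prob_space_iid_space)
  define T where "T = {\<sigma>. length \<sigma> = k \<and> distinct \<sigma> \<and> set \<sigma> \<subseteq> {..<N}}"
  have finT: "finite T"
    by (rule finite_subset[OF _ finite_lists_length_eq[of "{..<N}" k]]) (auto simp: T_def)
  define l where "l = sorted_list_of_set L"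
  have l: "distinct l" "set l = L" "length l = k" using L by (auto simp: l_def)
  define W where "W \<sigma> = {u \<in> space iid_space. g (u 0) \<in> E \<sigma> \<and> map (\<lambda>i. cell N (u i)) l = \<sigma>}" for \<sigma>
  have W: "W \<sigma> \<in> sets iid_space" "prob (W \<sigma>) = measure_pmf.prob q (E \<sigma>) * (1 / real N) ^ k"
    if \<sigma>: "\<sigma> \<in> T" for \<sigma>
  proof -
    define c where "c i = the (map_of (zip l \<sigma>) i)" for i
    have len: "length l = length \<sigma>" using \<sigma> l by (simp add: T_def)
    have map_c: "map c l = \<sigma>"
      by (rule nth_equalityI) (use len in \<open>auto simp: c_def map_of_zip_nth l(1)\<close>)
    have cN: "c i < N" if "i \<in> L" for i
    proof -
      have "c i \<in> set (map c l)" using that l(2) by simp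
      then show ?thesis unfolding map_c using \<sigma> by (auto simp: T_def)
    qed
    define A where "A = {x \<in> {0..1}. g x \<in> E \<sigma>}"
    have "A = g -` (E \<sigma> \<inter> set_pmf q) \<inter> space (restrict_space borel {0..1})"
      using measurable_space[OF g] by (auto simp: A_def space_restrict_space)
    then have A: "A \<in> sets unif01"
      unfolding sets_unif01 using measurable_sets[OF g, of "E \<sigma> \<inter> set_pmf q"] by simp
    have "W \<sigma> = {u \<in> space iid_space. u 0 \<in> A \<and> (\<forall>i\<in>L. cell N (u i) = c i)}"
    proof -
      have "map (\<lambda>i. cell N (u i)) l = \<sigma> \<longleftrightarrow> (\<forall>i\<in>L. cell N (u i) = c i)" for u
        using map_eq_conv[of "\<lambda>i. cell N (u i)" l c] by (simp add: map_c l(2))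
      then show ?thesis by (auto simp: W_def A_def space_iid_space)
    qed
    then show "W \<sigma> \<in> sets iid_space" "prob (W \<sigma>) = measure_pmf.prob q (E \<sigma>) * (1 / real N) ^ k"
      using iid_cylinder_prob[OF A L(1,2) cN] gq[of "E \<sigma>"] L(3) by (auto simp: A_def)
  qed
  have N0: "0 < real N" using N by simp
  have "t - real k ^ 2 / real N \<le> (1 - real k ^ 2 / real N) * t"
    using t(1) mult_left_mono[of t 1 "real k ^ 2 / real N"] by (simp add: algebra_simps)
  also have "\<dots> \<le> (real (card T) * (1 / real N) ^ k) * t"
  proof (rule mult_right_mono)
    show "1 - real k ^ 2 / real N \<le> real (card T) * (1 / real N) ^ k"
      using card_distinct_lists_ge[OF N] N0 unfolding T_def by (simp add: power_one_over field_simps)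
  qed (use False in simp)
  also have "\<dots> = (\<Sum>\<sigma>\<in>T. t * (1 / real N) ^ k)" by simp
  also have "\<dots> \<le> (\<Sum>\<sigma>\<in>T. prob (W \<sigma>))"
    using t(2) by (intro sum_mono) (auto simp: W(2) T_def intro!: mult_right_mono)
  also have "\<dots> = prob (\<Union>\<sigma>\<in>T. W \<sigma>)"
  proof (rule finite_measure_finite_Union[symmetric, OF finT])
    show "W ` T \<subseteq> sets iid_space" using W(1) by blast
    show "disjoint_family_on W T" unfolding disjoint_family_on_def W_def by blast
  qed
  also have "\<dots> \<le> prob ?U"
    by (rule finite_measure_mono[OF _ U]) (auto simp: W_def l_def)
  finally show ?thesis .
qed

section \<open>Laws of subarrays\<close>

lemma PiM_count_space_finite:
  "finite I \<Longrightarrow> finite S \<Longrightarrow> Pi\<^sub>M I (\<lambda>_. count_space S) = count_space (PiE I (\<lambda>_. S))"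
  by (rule count_space_PiM_finite) (auto intro: countable_finite)

lemma finite_nsets: "finite J \<Longrightarrow> finite ([J]\<^bsup>d\<^esup>)"
  by (rule finite_imp_finite_nsets)

lemma subarray_measurable:
  assumes "\<And>s. s \<in> [J]\<^bsup>d\<^esup> \<Longrightarrow> X s \<in> measurable M (count_space S)"
  shows "(\<lambda>w. \<lambda>s\<in>[J]\<^bsup>d\<^esup>. X s w) \<in> measurable M (Pi\<^sub>M ([J]\<^bsup>d\<^esup>) (\<lambda>_. count_space S))"
  by (rule measurable_restrict) (rule assms)

lemma sets_subarray_law:
  assumes "finite J" "finite S"
  shows "sets (subarray_law M S d X J) = Pow (PiE ([J]\<^bsup>d\<^esup>) (\<lambda>_. S))"
  unfolding subarray_law_def by (simp add: PiM_count_space_finite finite_nsets assms)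

lemma prob_space_subarray_law:
  assumes "prob_space M" "\<And>s. s \<in> [J]\<^bsup>d\<^esup> \<Longrightarrow> X s \<in> measurable M (count_space S)"
  shows "prob_space (subarray_law M S d X J)"
  unfolding subarray_law_def by (rule prob_space.prob_space_distr[OF assms(1) subarray_measurable[OF assms(2)]])

lemma measure_subarray_law:
  assumes "finite J" "finite S" "\<And>s. s \<in> [J]\<^bsup>d\<^esup> \<Longrightarrow> X s \<in> measurable M (count_space S)"
    and "A \<subseteq> PiE ([J]\<^bsup>d\<^esup>) (\<lambda>_. S)"
  shows "measure (subarray_law M S d X J) A = measure M {w \<in> space M. (\<lambda>s\<in>[J]\<^bsup>d\<^esup>. X s w) \<in> A}"
proof -
  have "A \<in> sets (Pi\<^sub>M ([J]\<^bsup>d\<^esup>) (\<lambda>_. count_space S))"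
    using assms by (simp add: PiM_count_space_finite finite_nsets)
  then show ?thesis
    unfolding subarray_law_def
    by (subst measure_distr[OF subarray_measurable[OF assms(3)]])
      (auto intro: arg_cong[where f = "measure M"])
qed

text \<open>The other inequality is the same one for the complement.\<close>

lemma tv_dist_leI:
  assumes "prob_space P" "prob_space Q" and sets: "sets P = sets Q"
    and le: "\<And>A. A \<in> sets P \<Longrightarrow> measure P A \<le> measure Q A + \<epsilon>"
  shows "tv_dist P Q \<le> \<epsilon>"
  unfolding tv_dist_def
proof (rule cSUP_least)
  interpret P: prob_space P by fact
  interpret Q: prob_space Q by fact
  show "sets P \<noteq> {}" by auto
  fix A assume A: "A \<in> sets P"
  have "space P = space Q" using sets by (rule sets_eq_imp_space_eq)
  then have "1 - measure P A \<le> 1 - measure Q A + \<epsilon>"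
    using le[of "space P - A"] A P.prob_compl[OF A] Q.prob_compl[of A] sets by auto
  then show "\<bar>measure P A - measure Q A\<bar> \<le> \<epsilon>" using le[OF A] by linarith
qed

lemma tv_dist_ge:
  assumes "prob_space P" "prob_space Q" "A \<in> sets P"
  shows "\<bar>measure P A - measure Q A\<bar> \<le> tv_dist P Q"
  unfolding tv_dist_def
proof (rule cSUP_upper[OF assms(3)])
  interpret P: prob_space P by fact
  interpret Q: prob_space Q by fact
  have "\<bar>measure P A - measure Q A\<bar> \<le> 1" for A
    using P.prob_le_1[of A] Q.prob_le_1[of A] measure_nonneg[of P A] measure_nonneg[of Q A] by linarith
  then show "bdd_above ((\<lambda>A. \<bar>measure P A - measure Q A\<bar>) ` sets P)" by (intro bdd_aboveI2)
qed

lemma Suc_image_in_nsets: "s \<in> [{..<n}]\<^bsup>d\<^esup> \<Longrightarrow> Suc ` s \<in> [{1..n}]\<^bsup>d\<^esup>"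
  by (auto simp: nsets_def card_image)

text \<open>Vertices are shifted from \<open>{1..n}\<close> to \<open>{..<n}\<close>, and \<open>h\<close> numbers the values. The value \<open>0\<close> outside the
  index sets keeps all values below \<open>m\<close>.\<close>

definition encoded_config :: "('x \<Rightarrow> nat) \<Rightarrow> nat \<Rightarrow> nat \<Rightarrow> (nat set \<Rightarrow> 'w \<Rightarrow> 'x) \<Rightarrow> 'w \<Rightarrow> config" where
  "encoded_config h n d X w = (\<lambda>s. if s \<in> [{..<n}]\<^bsup>d\<^esup> then h (X (Suc ` s) w) else 0)"

text \<open>The array takes finitely many values, so its law is a mass function. An index set with fewer than \<open>d\<close>
  elements, about which \<open>approx_spreadable\<close> says nothing, carries no entries.\<close>

lemma pmf_of_random_array:
  fixes S :: "'x set"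
  assumes X: "random_array M S d {1..n} X" and S: "finite S"
    and h: "h ` S \<subseteq> {..<m}" and m: "0 < m"
    and spr: "approx_spreadable \<eta> M S d {1..n} X" and \<eta>: "0 \<le> \<eta>"
  obtains p where "\<And>x s. x \<in> set_pmf p \<Longrightarrow> x s < m" "spreadable_pmf \<eta> n d p"
    "\<And>A. measure_pmf.prob p A = measure M {w \<in> space M. encoded_config h n d X w \<in> A}"
proof -
  have M: "prob_space M" and Xm: "\<And>s. s \<in> [{1..n}]\<^bsup>d\<^esup> \<Longrightarrow> X s \<in> measurable M (count_space S)"
    using X by (auto simp: random_array_def)
  have XS: "X s w \<in> S" if "s \<in> [{1..n}]\<^bsup>d\<^esup>" "w \<in> space M" for s w
    using measurable_space[OF Xm[OF that(1)] that(2)] by simp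
  define R where "R = PiE ([{1..n}]\<^bsup>d\<^esup>) (\<lambda>_. S)"
  define G where "G w = (\<lambda>s\<in>[{1..n}]\<^bsup>d\<^esup>. X s w)" for w
  have G: "G \<in> measurable M (count_space R)"
    unfolding G_def[abs_def] R_def
      PiM_count_space_finite[OF finite_nsets[OF finite_atLeastAtMost] S, symmetric]
    by (rule subarray_measurable[OF Xm])
  have finR: "finite R" unfolding R_def using S by (intro finite_PiE) (auto intro: finite_nsets)
  obtain p0 where p0: "set_pmf p0 \<subseteq> R"
    "\<And>A. measure_pmf.prob p0 A = measure M {w \<in> space M. G w \<in> A}"
    by (rule pmf_of_finite_random_variable[OF M G finR]) (rule that)
  define conv where "conv f = (\<lambda>s. if s \<in> [{..<n}]\<^bsup>d\<^esup> then h (f (Suc ` s)) else 0)" for f :: "nat set \<Rightarrow> 'x"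
  have conv: "conv (G w) = encoded_config h n d X w" for w
    using Suc_image_in_nsets by (auto simp: conv_def G_def encoded_config_def fun_eq_iff)
  define p where "p = map_pmf conv p0"
  have prob_p: "measure_pmf.prob p A = measure M {w \<in> space M. encoded_config h n d X w \<in> A}" for A
    by (simp add: p_def p0(2) conv)
  have val: "x s < m" if x: "x \<in> set_pmf p" for x s
  proof -
    obtain f where f: "f \<in> R" "x = conv f" using x p0(1) by (auto simp: p_def)
    have "f (Suc ` s) \<in> S" if "s \<in> [{..<n}]\<^bsup>d\<^esup>"
      using f(1) Suc_image_in_nsets[OF that] by (auto simp: R_def)
    then show ?thesis using h m f(2) by (auto simp: conv_def)
  qed
  have "spreadable_pmf \<eta> n d p"
    unfolding spreadable_pmf_def
  proof (intro allI impI, elim conjE)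
    fix J \<phi> assume J: "J \<subseteq> {..<n}" and \<phi>: "strict_mono_on J \<phi>" "\<phi> ` J \<subseteq> {..<n}"
    have finJ: "finite J" using J finite_subset by blast
    show "tv_within \<eta> (map_pmf (\<lambda>x. restrict x ([J]\<^bsup>d\<^esup>)) p)
        (map_pmf (\<lambda>x. restrict (pull \<phi> x) ([J]\<^bsup>d\<^esup>)) p)"
    proof (cases "card J < d")
      case True
      then have "[J]\<^bsup>d\<^esup> = {}" using finJ by (simp add: nsets_eq_empty)
      then show ?thesis using tv_within_mono[OF tv_within_refl \<eta>] by (simp add: restrict_def)
    next
      case False
      define J1 where "J1 = Suc ` J"
      define \<phi>1 where "\<phi>1 i = Suc (\<phi> (i - 1))" for i
      define P1 where "P1 = subarray_law M S d X J1"
      define Q1 where "Q1 = subarray_law M S d (\<lambda>s. X (\<phi>1 ` s)) J1"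
      have J1: "finite J1" "J1 \<subseteq> {1..n}" "card J1 = card J"
        using J finJ by (auto simp: J1_def card_image)
      have mono1: "strict_mono_on J1 \<phi>1"
        using \<phi>(1) by (auto simp: strict_mono_on_def J1_def \<phi>1_def)
      have im1: "\<phi>1 ` J1 \<subseteq> {1..n}" using \<phi>(2) by (force simp: J1_def \<phi>1_def)
      have inj1: "inj_on \<phi>1 J1" by (rule strict_mono_on_imp_inj_on[OF mono1])
      have "finite J1 \<and> finite (\<phi>1 ` J1) \<and> J1 \<subseteq> {1..n} \<and> \<phi>1 ` J1 \<subseteq> {1..n} \<and> card J1 = card (\<phi>1 ` J1) \<and>
          d \<le> card J1 \<and> strict_mono_on J1 \<phi>1 \<and> bij_betw \<phi>1 J1 (\<phi>1 ` J1)"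
        using J1 mono1 im1 False inj1 by (auto simp: card_image inj_on_imp_bij_betw)
      then have tv: "tv_dist P1 Q1 \<le> \<eta>"
        using spr unfolding approx_spreadable_def P1_def Q1_def by blast
      have X1: "X s \<in> measurable M (count_space S)" "X (\<phi>1 ` s) \<in> measurable M (count_space S)"
        if "s \<in> [J1]\<^bsup>d\<^esup>" for s
        using nsets_mono[OF J1(2)] image_in_nsets[OF that mono1 im1] that Xm by blast+
      have "prob_space P1" "prob_space Q1"
        unfolding P1_def Q1_def by (rule prob_space_subarray_law[OF M], erule X1)+
      note ge = tv_dist_ge[OF this]
      have events: "measure_pmf.prob (map_pmf (\<lambda>x. restrict x ([J]\<^bsup>d\<^esup>)) p) A \<le>
          measure_pmf.prob (map_pmf (\<lambda>x. restrict (pull \<phi> x) ([J]\<^bsup>d\<^esup>)) p) A + \<eta>" for A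
      proof -
        define A' where "A' = {f \<in> PiE ([J1]\<^bsup>d\<^esup>) (\<lambda>_. S). (\<lambda>s\<in>[J]\<^bsup>d\<^esup>. h (f (Suc ` s))) \<in> A}"
        have sJ: "Suc ` s \<in> [J1]\<^bsup>d\<^esup>" "s \<in> [{..<n}]\<^bsup>d\<^esup>" "\<phi> ` s \<in> [{..<n}]\<^bsup>d\<^esup>" if "s \<in> [J]\<^bsup>d\<^esup>" for s
          using that nsets_mono[OF J] image_in_nsets[OF that \<phi>]
          by (auto simp: nsets_def J1_def card_image)
        have in1: "(\<lambda>s\<in>[J1]\<^bsup>d\<^esup>. X s w) \<in> PiE ([J1]\<^bsup>d\<^esup>) (\<lambda>_. S)"
          "(\<lambda>s\<in>[J1]\<^bsup>d\<^esup>. X (\<phi>1 ` s) w) \<in> PiE ([J1]\<^bsup>d\<^esup>) (\<lambda>_. S)" if "w \<in> space M" for w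
          using measurable_space[OF X1(1) that] measurable_space[OF X1(2) that] by auto
        have "restrict (encoded_config h n d X w) ([J]\<^bsup>d\<^esup>) = (\<lambda>s\<in>[J]\<^bsup>d\<^esup>. h ((\<lambda>s\<in>[J1]\<^bsup>d\<^esup>. X s w) (Suc ` s)))" for w
          by (rule restrict_ext) (simp add: encoded_config_def sJ)
        then have "{w \<in> space M. restrict (encoded_config h n d X w) ([J]\<^bsup>d\<^esup>) \<in> A} =
            {w \<in> space M. (\<lambda>s\<in>[J1]\<^bsup>d\<^esup>. X s w) \<in> A'}"
          using in1(1) by (auto simp: A'_def)
        then have 1: "measure_pmf.prob (map_pmf (\<lambda>x. restrict x ([J]\<^bsup>d\<^esup>)) p) A = measure P1 A'"
          unfolding P1_def
          by (subst measure_subarray_law[OF J1(1) S X1(1)]) (auto simp: A'_def prob_p)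
        have "\<phi>1 ` Suc ` s = Suc ` \<phi> ` s" for s by (simp add: image_image \<phi>1_def)
        then have "restrict (pull \<phi> (encoded_config h n d X w)) ([J]\<^bsup>d\<^esup>) =
            (\<lambda>s\<in>[J]\<^bsup>d\<^esup>. h ((\<lambda>s\<in>[J1]\<^bsup>d\<^esup>. X (\<phi>1 ` s) w) (Suc ` s)))" for w
          by (intro restrict_ext) (simp add: encoded_config_def sJ pull_def)
        then have "{w \<in> space M. restrict (pull \<phi> (encoded_config h n d X w)) ([J]\<^bsup>d\<^esup>) \<in> A} =
            {w \<in> space M. (\<lambda>s\<in>[J1]\<^bsup>d\<^esup>. X (\<phi>1 ` s) w) \<in> A'}"
          using in1(2) by (auto simp: A'_def)
        then have 2: "measure_pmf.prob (map_pmf (\<lambda>x. restrict (pull \<phi> x) ([J]\<^bsup>d\<^esup>)) p) A = measure Q1 A'"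
          unfolding Q1_def
          by (subst measure_subarray_law[OF J1(1) S X1(2)]) (auto simp: A'_def prob_p)
        have "A' \<in> sets P1" by (auto simp: P1_def sets_subarray_law[OF J1(1) S] A'_def)
        from ge[OF this] show ?thesis unfolding 1 2 using tv by linarith
      qed
      have "finite (set_pmf p)" using p0(1) \<open>finite R\<close> by (auto simp: p_def intro: finite_subset)
      then show ?thesis by (intro tv_withinI_events events) auto
    qed
  qed
  then show ?thesis using that val prob_p by blast
qed

section \<open>The approximating function\<close>

lemma fn_array_cong:
  assumes "finite s" "card s = d" "u 0 = v 0" "\<And>i. i \<in> s \<Longrightarrow> u i = v (\<phi> i)" "strict_mono_on s \<phi>"
  shows "fn_array d f s u = fn_array d f (\<phi> ` s) v"
proof -
  have "(if j = 0 then u 0 else u (sorted_list_of_set s ! (j - 1))) =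
      (if j = 0 then v 0 else v (sorted_list_of_set (\<phi> ` s) ! (j - 1)))" if j: "j \<in> {..d}" for j
  proof (cases "j = 0")
    case False
    then have l: "j - 1 < length (sorted_list_of_set s)" using j assms(2) by auto
    then have "sorted_list_of_set s ! (j - 1) \<in> s"
      using nth_mem[OF l] assms(1) by simp
    then show ?thesis using False l assms(4) by (simp add: sorted_list_of_set_image[OF assms(1,5)])
  qed (use assms(3) in simp)
  then show ?thesis unfolding fn_array_def by (intro arg_cong[where f = f] restrict_ext)
qed

lemma fn_array_measurable:
  assumes f: "f \<in> measurable (borel_cube d) (count_space S)"
    and s: "finite s" "card s = d" "insert 0 s \<subseteq> I"
  shows "fn_array d f s \<in> measurable (Pi\<^sub>M I (\<lambda>_. unif01)) (count_space S)"
proof -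
  have coord: "(\<lambda>u. u i) \<in> measurable (Pi\<^sub>M I (\<lambda>_. unif01)) (restrict_space borel {0..1})"
    if "i \<in> I" for i
    using measurable_component_singleton[OF that, of "\<lambda>_. unif01"]
      measurable_cong_sets[OF refl sets_unif01] by blast
  have "(\<lambda>u. \<lambda>j\<in>{..d}. if j = 0 then u 0 else u (sorted_list_of_set s ! (j - 1)))
      \<in> measurable (Pi\<^sub>M I (\<lambda>_. unif01)) (borel_cube d)"
    unfolding borel_cube_def
  proof (rule measurable_restrict)
    fix j assume j: "j \<in> {..d}"
    show "(\<lambda>u. if j = 0 then u 0 else u (sorted_list_of_set s ! (j - 1)))
        \<in> measurable (Pi\<^sub>M I (\<lambda>_. unif01)) (restrict_space borel {0..1})"
    proof (cases "j = 0")
      case False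
      then have l: "j - 1 < length (sorted_list_of_set s)" using j s(2) by auto
      then have "sorted_list_of_set s ! (j - 1) \<in> s" using nth_mem[OF l] s(1) by simp
      then show ?thesis using False coord s(3) by auto
    qed (use coord s(3) in simp)
  qed
  from measurable_compose[OF this f] show ?thesis unfolding fn_array_def[abs_def] .
qed

lemma fn_array_random_array:
  assumes f: "f \<in> measurable (borel_cube d) (count_space S)"
  shows "random_array iid_space S d {1..} (fn_array d f)"
  unfolding random_array_def
proof (intro conjI ballI)
  fix s :: "nat set" assume "s \<in> [{1..}]\<^bsup>d\<^esup>"
  then show "fn_array d f s \<in> measurable iid_space (count_space S)"
    unfolding iid_space_def by (intro fn_array_measurable[OF f]) (auto simp: nsets_def)
qed (use infinite_Ici[of "1 :: nat"] prob_space_iid_space in auto)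

text \<open>The subarray on \<open>J\<close> is a fixed function of \<open>\<zeta>\<close> and the \<open>\<xi>\<^sub>i\<close> with \<open>i \<in> J\<close>, and replacing \<open>\<xi>\<^sub>i\<close> by \<open>\<xi>\<close> at
  \<open>\<psi> i\<close> does not change the law of an i.i.d. sequence. So the laws are equal, not only close.\<close>

lemma fn_array_spreadable:
  assumes f: "f \<in> measurable (borel_cube d) (count_space S)"
  shows "spreadable iid_space S d {1..} (fn_array d f)"
  unfolding approx_spreadable_def
proof (intro allI impI, elim conjE)
  fix J K :: "nat set" and \<phi> :: "nat \<Rightarrow> nat"
  assume J: "finite J" "J \<subseteq> {1..}" and K: "K \<subseteq> {1..}"
    and \<phi>: "strict_mono_on J \<phi>" "bij_betw \<phi> J K"
  define I where "I = insert 0 J"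
  define U where "U = Pi\<^sub>M I (\<lambda>_. unif01)"
  define \<Phi> where "\<Phi> v = (\<lambda>s\<in>[J]\<^bsup>d\<^esup>. fn_array d f s v)" for v
  define T where "T = Pi\<^sub>M ([J]\<^bsup>d\<^esup>) (\<lambda>_. count_space S)"
  have \<Phi>: "\<Phi> \<in> measurable U T"
    unfolding \<Phi>_def[abs_def] U_def T_def
    by (rule measurable_restrict, rule fn_array_measurable[OF f]) (auto simp: nsets_def I_def)
  have law: "subarray_law iid_space S d (\<lambda>s. fn_array d f (\<psi> ` s)) J = distr U T \<Phi>"
    if \<psi>: "strict_mono_on J \<psi>" "\<psi> ` J \<subseteq> {1..}" for \<psi>
  proof -
    define \<psi>' where "\<psi>' i = (if i = 0 then 0 else \<psi> i)" for i
    have inj: "inj_on \<psi>' I"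
    proof (rule inj_onI)
      fix i j assume ij: "i \<in> I" "j \<in> I" "\<psi>' i = \<psi>' j"
      show "i = j"
      proof (cases "i = 0 \<or> j = 0")
        case True
        then show ?thesis using ij \<psi>(2) by (fastforce simp: \<psi>'_def I_def split: if_splits)
      next
        case False
        then have "i \<in> J" "j \<in> J" "\<psi> i = \<psi> j" using ij by (auto simp: I_def \<psi>'_def)
        then show ?thesis using inj_onD[OF strict_mono_on_imp_inj_on[OF \<psi>(1)]] by blast
      qed
    qed
    have reindex: "distr iid_space U (\<lambda>u. \<lambda>i\<in>I. u (\<psi>' i)) = U"
      unfolding iid_space_def U_def
      by (rule distr_PiM_reindex) (use inj prob_space_unif01 in auto)
    have m: "(\<lambda>u. \<lambda>i\<in>I. u (\<psi>' i)) \<in> measurable iid_space U"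
      unfolding iid_space_def U_def by (intro measurable_restrict measurable_component_singleton) auto
    have "(\<lambda>s\<in>[J]\<^bsup>d\<^esup>. fn_array d f (\<psi> ` s) u) = \<Phi> (\<lambda>i\<in>I. u (\<psi>' i))" for u
      unfolding \<Phi>_def
    proof (rule restrict_ext)
      fix s assume "s \<in> [J]\<^bsup>d\<^esup>"
      then have s: "finite s" "card s = d" "s \<subseteq> J" by (auto simp: nsets_def)
      have "strict_mono_on s \<psi>" using \<psi>(1) s(3) by (auto simp: strict_mono_on_def)
      then show "fn_array d f (\<psi> ` s) u = fn_array d f s (\<lambda>i\<in>I. u (\<psi>' i))"
        using s J(2) by (intro fn_array_cong[symmetric]) (auto simp: I_def \<psi>'_def)
    qed
    then have "subarray_law iid_space S d (\<lambda>s. fn_array d f (\<psi> ` s)) J =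
        distr iid_space T (\<Phi> \<circ> (\<lambda>u. \<lambda>i\<in>I. u (\<psi>' i)))"
      unfolding subarray_law_def T_def[symmetric] by (simp add: o_def)
    also have "\<dots> = distr (distr iid_space U (\<lambda>u. \<lambda>i\<in>I. u (\<psi>' i))) T \<Phi>"
      by (rule distr_distr[OF \<Phi> m, symmetric])
    finally show ?thesis unfolding reindex .
  qed
  have "strict_mono_on J (\<lambda>i. i)" by (simp add: strict_mono_on_def)
  from law[OF this] J(2) have "subarray_law iid_space S d (fn_array d f) J = distr U T \<Phi>" by simp
  moreover have "subarray_law iid_space S d (\<lambda>s. fn_array d f (\<phi> ` s)) J = distr U T \<Phi>"
    using \<phi> K by (intro law) (auto simp: bij_betw_def)
  ultimately show "tv_dist (subarray_law iid_space S d (fn_array d f) J)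
      (subarray_law iid_space S d (\<lambda>s. fn_array d f (\<phi> ` s)) J) \<le> 0"
    by (simp add: tv_dist_def) (subst cSUP_const, auto)
qed

text \<open>The coordinate \<open>0\<close> selects a function on lists through \<open>g\<close>, the other coordinates select the list of cells
  at which it is evaluated, and \<open>v\<close> turns the number found there into a value of the array.\<close>

definition decoded_fn :: "(nat \<Rightarrow> 'x) \<Rightarrow> (real \<Rightarrow> nat list \<Rightarrow> nat) \<Rightarrow> nat \<Rightarrow> nat \<Rightarrow> (nat \<Rightarrow> real) \<Rightarrow> 'x" where
  "decoded_fn v g N d u = v (g (u 0) (map (\<lambda>j. cell N (u (Suc j))) [0..<d]))"

lemma decoded_fn_measurable:
  assumes g: "g \<in> measurable (restrict_space borel {0..1}) (count_space Q)"
    and v: "\<And>Y l. Y \<in> Q \<Longrightarrow> v (Y l) \<in> S"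
  shows "decoded_fn v g N d \<in> measurable (borel_cube d) (count_space S)"
proof -
  have coord: "(\<lambda>u. u i) \<in> measurable (borel_cube d) (restrict_space borel {0..1})" if "i \<le> d" for i
    unfolding borel_cube_def using that by (intro measurable_component_singleton) auto
  have cells: "(\<lambda>u. map (\<lambda>j. cell N (u (Suc j))) [0..<d]) \<in> measurable (borel_cube d) (count_space UNIV)"
    unfolding measurable_count_space_eq2_countable
  proof (intro conjI ballI)
    fix l :: "nat list"
    have map_eq: "map F [0..<d] = l \<longleftrightarrow> length l = d \<and> (\<forall>j\<in>{..<d}. F j = l ! j)" for F
    proof -
      have "map F [0..<d] = l \<longleftrightarrow> length l = d \<and> (\<forall>j<d. map F [0..<d] ! j = l ! j)"
        by (subst list_eq_iff_nth_eq) auto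
      then show ?thesis by auto
    qed
    have "(\<lambda>u. map (\<lambda>j. cell N (u (Suc j))) [0..<d]) -` {l} \<inter> space (borel_cube d) =
        (if length l = d then {u \<in> space (borel_cube d). \<forall>j\<in>{..<d}. cell N (u (Suc j)) = l ! j} else {})"
      unfolding vimage_def singleton_iff map_eq by auto
    also have "\<dots> \<in> sets (borel_cube d)"
    proof -
      have "{u \<in> space (borel_cube d). cell N (u (Suc j)) = l ! j} \<in> sets (borel_cube d)" if "j < d" for j
      proof -
        have "(\<lambda>u. cell N (u (Suc j))) \<in> measurable (borel_cube d) (count_space UNIV)"
          by (rule measurable_compose[OF coord measurable_restrict_space1[OF cell_measurable]])
            (use that in simp)
        from measurable_sets[OF this, of "{l ! j}"] show ?thesis
          by (simp add: vimage_def Int_def conj_commute)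
      qed
      then show ?thesis by (auto intro: sets.sets_Collect_finite_All')
    qed
    finally show "(\<lambda>u. map (\<lambda>j. cell N (u (Suc j))) [0..<d]) -` {l} \<inter> space (borel_cube d)
        \<in> sets (borel_cube d)" .
  qed simp
  have "(\<lambda>u. v (g (u 0) l)) \<in> measurable (borel_cube d) (count_space S)" for l
  proof -
    have "(\<lambda>Y. v (Y l)) \<in> measurable (count_space Q) (count_space S)" using v by simp
    from measurable_compose[OF measurable_compose[OF coord g] this, of 0] show ?thesis by simp
  qed
  from measurable_compose_countable[OF this cells] show ?thesis unfolding decoded_fn_def[abs_def] .
qed

lemma fn_array_decoded_fn:
  assumes "card s = d"
  shows "fn_array d (decoded_fn v g N d) s u =
    v (g (u 0) (map (\<lambda>i. cell N (u i)) (sorted_list_of_set s)))"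
proof -
  have "map (\<lambda>j. cell N ((\<lambda>j\<in>{..d}. if j = 0 then u 0 else u (sorted_list_of_set s ! (j - 1))) (Suc j))) [0..<d]
      = map (\<lambda>i. cell N (u i)) (sorted_list_of_set s)"
    using assms by (intro nth_equalityI) auto
  then show ?thesis unfolding fn_array_def decoded_fn_def by simp
qed


lemma nths_sorted_list_of_set:
  assumes "finite L" "s \<subseteq> L"
  shows "sorted_list_of_set s = nths (sorted_list_of_set L) {i. i < card L \<and> nth_least L i \<in> s}"
proof (rule sorted_distinct_set_unique)
  have "set (nths (sorted_list_of_set L) {i. i < card L \<and> nth_least L i \<in> s}) =
      nth_least L ` {..<card L} \<inter> s"
    by (auto simp: set_nths nth_least_def)
  also have "\<dots> = s" using nth_least_image[OF assms(1)] assms(2) by auto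
  finally show "set (sorted_list_of_set s) = set (nths (sorted_list_of_set L) {i. i < card L \<and> nth_least L i \<in> s})"
    using finite_subset[OF assms(2,1)] by simp
qed (auto intro: sorted_nths)

theorem theorem1p5:
  fixes d m k n :: nat and \<epsilon> :: real
    and S :: "'x set" and M :: "'w measure" and X :: "nat set \<Rightarrow> 'w \<Rightarrow> 'x"
  assumes "1 \<le> d" and "2 \<le> m" and "d \<le> k"
    and "0 < \<epsilon>" and "\<epsilon> \<le> 1"
    and "spread_const d m k \<epsilon> \<le> real n"
    and "card S = m"
    and "random_array M S d {1..n} X"
    and "approx_spreadable (1 / spread_const d m k \<epsilon>) M S d {1..n} X"
  shows "\<exists>f \<in> measurable (borel_cube d) (count_space S).
           random_array iid_space S d {1..} (fn_array d f) \<and>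
           spreadable iid_space S d {1..} (fn_array d f) \<and>
           (\<forall>L. L \<subseteq> {1..n} \<and> card L = k \<longrightarrow>
              tv_dist (subarray_law M S d X L)
                (subarray_law iid_space S d (fn_array d f) L) \<le> \<epsilon>)"
proof -
  note d = assms(1) and m = assms(2) and dk = assms(3) and \<epsilon> = assms(4,5)
  define C where "C = spread_const d m k \<epsilon>"
  define \<eta> where "\<eta> = 1 / C"
  have finS: "finite S" using assms(2,7) by (intro card_ge_0_finite) simp
  have C_ge: "4 / \<epsilon> \<le> C"
  proof -
    have "4 / \<epsilon> \<le> 2 ^ 8 * real m ^ (7 * k ^ d) / \<epsilon>\<^sup>2"
    proof -
      have "1 \<le> real m ^ (7 * k ^ d)" using m by (intro one_le_power) simp
      then have "4 * \<epsilon> \<le> 2 ^ 8 * real m ^ (7 * k ^ d)" using \<epsilon> by simp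
      then show ?thesis using \<epsilon> by (simp add: field_simps power2_eq_square)
    qed
    also have "\<dots> \<le> C" unfolding C_def spread_const_def by (rule exp_iter_ge)
    finally show ?thesis .
  qed
  moreover have "0 < 4 / \<epsilon>" using \<epsilon> by simp
  ultimately have C0: "0 < C" by linarith
  have \<eta>: "0 \<le> \<eta>" "\<eta> * C \<le> 1" "\<eta> \<le> \<epsilon> / 4"
    using C0 C_ge \<epsilon> by (auto simp: \<eta>_def field_simps)
  have threshold: "threshold d m k (\<epsilon> / 2) = C"
    by (simp add: threshold_def C_def spread_const_def power_divide)
  obtain h where h: "bij_betw h S {0..<card S}" using ex_bij_betw_finite_nat[OF finS] by blast
  then have h_inj: "inj_on h S" and h_im: "h ` S = {..<m}"
    using assms(7) by (auto simp: bij_betw_def atLeast0LessThan)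
  define dec where "dec = inv_into S h"
  have dec_h: "dec (h x) = x" if "x \<in> S" for x
    unfolding dec_def by (rule inv_into_f_f[OF h_inj that])
  have dec_S: "dec a \<in> S" if "a < m" for a
    unfolding dec_def using that h_im by (intro inv_into_into) auto
  have M: "prob_space M" and Xm: "\<And>s. s \<in> [{1..n}]\<^bsup>d\<^esup> \<Longrightarrow> X s \<in> measurable M (count_space S)"
    using assms(8) by (auto simp: random_array_def)
  have spread_X: "approx_spreadable \<eta> M S d {1..n} X" using assms(9) by (simp add: \<eta>_def C_def)
  obtain p where p: "\<And>x s. x \<in> set_pmf p \<Longrightarrow> x s < m" "spreadable_pmf \<eta> n d p"
    "\<And>A. measure_pmf.prob p A = measure M {w \<in> space M. encoded_config h n d X w \<in> A}"
    by (rule pmf_of_random_array[OF assms(8) finS _ _ spread_X \<eta>(1), of h m])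
      (use h_im m that in auto)
  define N where "N = Suc (k + nat \<lceil>4 * real k ^ 2 / \<epsilon>\<rceil>)"
  have N: "k < N" "real k ^ 2 / real N \<le> \<epsilon> / 4"
  proof -
    have "4 * real k ^ 2 / \<epsilon> \<le> real N" unfolding N_def by linarith
    moreover have "0 < real N" by (simp add: N_def)
    ultimately show "real k ^ 2 / real N \<le> \<epsilon> / 4" using \<epsilon> by (simp add: field_simps)
  qed (simp add: N_def)
  have "\<exists>q. (\<forall>Y\<in>set_pmf q. \<forall>l. Y l < m) \<and> extends_to_tuples (\<epsilon> / 2) N d k p q"
    by (rule extension_to_tuples[where n = n and \<eta> = \<eta>])
      (use d m dk \<epsilon> p(1,2) \<eta> assms(6) in \<open>auto simp: threshold C_def[symmetric]\<close>)
  then obtain q where q: "\<And>Y l. Y \<in> set_pmf q \<Longrightarrow> Y l < m"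
    and ext: "extends_to_tuples (\<epsilon> / 2) N d k p q" by blast
  obtain g where g: "g \<in> measurable (restrict_space borel {0..1 :: real}) (count_space (set_pmf q))"
    and gq: "\<And>A. measure unif01 {x \<in> {0..1}. g x \<in> A} = measure_pmf.prob q A"
    by (rule exists_sampler[of q]) (rule that)
  define f where "f = decoded_fn dec g N d"
  have f: "f \<in> measurable (borel_cube d) (count_space S)"
    unfolding f_def by (rule decoded_fn_measurable[OF g]) (simp add: dec_S q)
  have close: "tv_dist (subarray_law M S d X L) (subarray_law iid_space S d (fn_array d f) L) \<le> \<epsilon>"
    if L: "L \<subseteq> {1..n}" "card L = k" for L
  proof -
    have finL: "finite L" using L(1) finite_subset by blast
    have L0: "0 \<notin> L" using L(1) by auto
    have kn: "k \<le> n" using card_mono[OF _ L(1)] L(2) by simp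
    have nL: "[L]\<^bsup>d\<^esup> \<subseteq> [{1..n}]\<^bsup>d\<^esup>" by (rule nsets_mono[OF L(1)])
    have X_L: "X s \<in> measurable M (count_space S)" if "s \<in> [L]\<^bsup>d\<^esup>" for s
      using Xm nL that by blast
    have f_L: "fn_array d f s \<in> measurable iid_space (count_space S)" if "s \<in> [L]\<^bsup>d\<^esup>" for s
      unfolding iid_space_def using that by (intro fn_array_measurable[OF f]) (auto simp: nsets_def)
    show ?thesis
    proof (rule tv_dist_leI)
      show "prob_space (subarray_law M S d X L)" by (rule prob_space_subarray_law[OF M X_L])
      show "prob_space (subarray_law iid_space S d (fn_array d f) L)"
        by (rule prob_space_subarray_law[OF prob_space_iid_space f_L])
      show "sets (subarray_law M S d X L) = sets (subarray_law iid_space S d (fn_array d f) L)"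
        by (simp add: sets_subarray_law[OF finL finS])
      fix A assume "A \<in> sets (subarray_law M S d X L)"
      then have A: "A \<subseteq> PiE ([L]\<^bsup>d\<^esup>) (\<lambda>_. S)" by (simp add: sets_subarray_law[OF finL finS])
      define l where "l = sorted_list_of_set L"
      define pos where "pos s = {i. i < k \<and> nth_least L i \<in> s}" for s
      have mono: "strict_mono_on {..<k} (nth_least L)"
        using strict_mono_on_nth_least[OF finL] L(2) by simp
      have pos: "pos s \<in> [{..<k}]\<^bsup>d\<^esup>" "nth_least L ` pos s = s" if s: "s \<in> [L]\<^bsup>d\<^esup>" for s
      proof -
        have "s \<subseteq> nth_least L ` {..<k}" using s nth_least_image[OF finL] L(2) by (auto simp: nsets_def)
        then show im: "nth_least L ` pos s = s" by (auto simp: pos_def)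
        have "inj_on (nth_least L) (pos s)"
          by (rule inj_on_subset[OF strict_mono_on_imp_inj_on[OF mono]]) (auto simp: pos_def)
        then have "card (pos s) = d" using card_image[of "nth_least L" "pos s"] im s by (simp add: nsets_def)
        then show "pos s \<in> [{..<k}]\<^bsup>d\<^esup>" by (auto simp: nsets_def pos_def)
      qed
      \<comment> \<open>\<open>A\<close> in terms of the positions \<open>{..<k}\<close> instead of the elements of \<open>L\<close>.\<close>
      define E where "E = {y. (\<lambda>s\<in>[L]\<^bsup>d\<^esup>. dec (y (pos s))) \<in> A}"
      define \<phi> where "\<phi> i = nth_least L i - 1" for i
      have nth_L: "nth_least L i \<in> {1..n}" if "i < k" for i
        using nth_least_in[OF finL, of i] that L by auto
      have Suc_\<phi>: "Suc (\<phi> i) = nth_least L i" if "i < k" for i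
        using nth_L[OF that] by (simp add: \<phi>_def)
      have \<phi>_mono: "strict_mono_on {..<k} \<phi>"
      proof (rule strict_mono_onI)
        fix i j assume ij: "i \<in> {..<k}" "j \<in> {..<k}" "i < j"
        then show "\<phi> i < \<phi> j"
          using strict_mono_onD[OF mono ij] nth_L[of i] by (auto simp: \<phi>_def)
      qed
      have \<phi>_im: "\<phi> ` {..<k} \<subseteq> {..<n}" using nth_L by (force simp: \<phi>_def)
      have law_X: "measure (subarray_law M S d X L) A =
          measure_pmf.prob (map_pmf (\<lambda>x. restrict (pull \<phi> x) ([{..<k}]\<^bsup>d\<^esup>)) p) E"
      proof -
        have "(\<lambda>s\<in>[L]\<^bsup>d\<^esup>. X s w) =
            (\<lambda>s\<in>[L]\<^bsup>d\<^esup>. dec (restrict (pull \<phi> (encoded_config h n d X w)) ([{..<k}]\<^bsup>d\<^esup>) (pos s)))"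
          if w: "w \<in> space M" for w
        proof (rule restrict_ext)
          fix s assume s: "s \<in> [L]\<^bsup>d\<^esup>"
          have "Suc ` \<phi> ` pos s = nth_least L ` pos s"
            unfolding image_image by (rule image_cong) (auto simp: Suc_\<phi> pos_def)
          then have "Suc ` \<phi> ` pos s = s" using pos(2)[OF s] by simp
          moreover have "\<phi> ` pos s \<in> [{..<n}]\<^bsup>d\<^esup>" by (rule image_in_nsets[OF pos(1)[OF s] \<phi>_mono \<phi>_im])
          moreover have "X s w \<in> S" using measurable_space[OF X_L[OF s] w] by simp
          ultimately show "X s w = dec (restrict (pull \<phi> (encoded_config h n d X w)) ([{..<k}]\<^bsup>d\<^esup>) (pos s))"
            using pos(1)[OF s] by (simp add: pull_def encoded_config_def dec_h)
        qed
        then have "{w \<in> space M. (\<lambda>s\<in>[L]\<^bsup>d\<^esup>. X s w) \<in> A} =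
            {w \<in> space M. restrict (pull \<phi> (encoded_config h n d X w)) ([{..<k}]\<^bsup>d\<^esup>) \<in> E}"
          by (auto simp: E_def)
        then show ?thesis by (simp add: measure_subarray_law[OF finL finS X_L A] p(3))
      qed
      define F where "F \<sigma> = {Y. (\<lambda>s\<in>[{..<k}]\<^bsup>d\<^esup>. Y (nths \<sigma> s)) \<in> E}" for \<sigma> :: "nat list"
      have law_f: "measure (subarray_law iid_space S d (fn_array d f) L) A =
          measure iid_space {u \<in> space iid_space. g (u 0) \<in> F (map (\<lambda>i. cell N (u i)) (sorted_list_of_set L))}"
        and F_meas: "{u \<in> space iid_space. g (u 0) \<in> F (map (\<lambda>i. cell N (u i)) (sorted_list_of_set L))}
          \<in> sets iid_space"
      proof -
        have "(\<lambda>s\<in>[L]\<^bsup>d\<^esup>. fn_array d f s u) = (\<lambda>s\<in>[L]\<^bsup>d\<^esup>. dec ((\<lambda>s\<in>[{..<k}]\<^bsup>d\<^esup>.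
            g (u 0) (nths (map (\<lambda>i. cell N (u i)) l) s)) (pos s)))" for u
        proof (rule restrict_ext)
          fix s assume s: "s \<in> [L]\<^bsup>d\<^esup>"
          then have "sorted_list_of_set s = nths l (pos s)"
            using nths_sorted_list_of_set[OF finL, of s] by (simp add: nsets_def l_def pos_def L(2))
          then show "fn_array d f s u = dec ((\<lambda>s\<in>[{..<k}]\<^bsup>d\<^esup>.
              g (u 0) (nths (map (\<lambda>i. cell N (u i)) l) s)) (pos s))"
            using s pos(1)[OF s] unfolding f_def
            by (subst fn_array_decoded_fn) (auto simp: nsets_def nths_map)
        qed
        then have eq: "{u \<in> space iid_space. (\<lambda>s\<in>[L]\<^bsup>d\<^esup>. fn_array d f s u) \<in> A} =
            {u \<in> space iid_space. g (u 0) \<in> F (map (\<lambda>i. cell N (u i)) (sorted_list_of_set L))}"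
          by (simp add: F_def E_def l_def)
        show "measure (subarray_law iid_space S d (fn_array d f) L) A =
          measure iid_space {u \<in> space iid_space. g (u 0) \<in> F (map (\<lambda>i. cell N (u i)) (sorted_list_of_set L))}"
          by (simp add: measure_subarray_law[OF finL finS f_L A] eq)
        have "A \<in> sets (Pi\<^sub>M ([L]\<^bsup>d\<^esup>) (\<lambda>_. count_space S))"
          using A by (simp add: PiM_count_space_finite finite_nsets finL finS)
        from measurable_sets[OF subarray_measurable[OF f_L] this]
        show "{u \<in> space iid_space. g (u 0) \<in> F (map (\<lambda>i. cell N (u i)) (sorted_list_of_set L))}
          \<in> sets iid_space"
          unfolding eq[symmetric] by (simp add: vimage_def Int_def conj_commute)
      qed
      \<comment> \<open>It is enough to bound one law from below by the other, since \<open>A\<close> is arbitrary. Moving \<open>L\<close> to \<open>{..<k}\<close> costs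
        \<open>\<eta>\<close>, the extension to tuples costs \<open>\<epsilon> / 2\<close>, and collisions of cells cost \<open>k\<^sup>2 / N\<close>.\<close>
      define t where "t = measure (subarray_law M S d X L) A - (\<eta> + \<epsilon> / 2)"
      have "t - real k ^ 2 / real N \<le> measure (subarray_law iid_space S d (fn_array d f) L) A"
        unfolding law_f
      proof (rule sampled_prob_ge[OF g gq finL L0 L(2) N(1) _ _ F_meas])
        show "t \<le> 1"
        proof -
          have "measure (subarray_law M S d X L) A \<le> 1"
            unfolding law_X by (rule measure_pmf.prob_le_1)
          then show ?thesis using \<eta>(1) \<epsilon> unfolding t_def by linarith
        qed
        fix \<sigma> :: "nat list" assume \<sigma>: "distinct \<sigma>" "length \<sigma> = k" "set \<sigma> \<subseteq> {..<N}"
        have "{..<k} \<subseteq> {..<n}" using kn by auto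
        then have "tv_within \<eta> (map_pmf (\<lambda>x. restrict x ([{..<k}]\<^bsup>d\<^esup>)) p)
            (map_pmf (\<lambda>x. restrict (pull \<phi> x) ([{..<k}]\<^bsup>d\<^esup>)) p)"
          by (rule spreadable_pmf_transport[OF p(2) _ \<phi>_mono \<phi>_im]) (auto intro: restrict_ext)
        moreover have "tv_within (\<epsilon> / 2) (map_pmf (\<lambda>x. restrict x ([{..<k}]\<^bsup>d\<^esup>)) p)
            (map_pmf (\<lambda>Y. \<lambda>s\<in>[{..<k}]\<^bsup>d\<^esup>. Y (nths \<sigma> s)) q)"
          using ext \<sigma> unfolding extends_to_tuples_def by simp
        ultimately have "tv_within (\<eta> + \<epsilon> / 2) (map_pmf (\<lambda>x. restrict (pull \<phi> x) ([{..<k}]\<^bsup>d\<^esup>)) p)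
            (map_pmf (\<lambda>Y. \<lambda>s\<in>[{..<k}]\<^bsup>d\<^esup>. Y (nths \<sigma> s)) q)"
          by (rule tv_within_trans[OF tv_within_sym])
        from tv_within_prob[OF this, of E] show "t \<le> measure_pmf.prob q (F \<sigma>)"
          by (simp add: t_def law_X F_def vimage_def)
      qed
      then show "measure (subarray_law M S d X L) A \<le>
          measure (subarray_law iid_space S d (fn_array d f) L) A + \<epsilon>"
        using \<eta>(3) N(2) unfolding t_def by linarith
    qed
  qed
  show ?thesis
    using f fn_array_random_array[OF f] fn_array_spreadable[OF f] close by (intro bexI[of _ f]) auto
qed

end
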